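(* Let $q$ be a power of a prime, let $G=L_2(q^3)=\mathrm{PSL}_2(q^3)$, let $\rho_0,\rho_1,\rho_2$ be involutions of $G$ and let $\alpha$ be an outer automorphism of $G$ of order $3$ such that: (1) $\alpha$ cyclically permutes $\rho_0,\rho_2,\rho_0\rho_2$; (2) $\alpha$ fixes $\rho_1$; (3) $\rho_0$ and $\rho_2$ commute; (4) $\langle\rho_0,\rho_1,\rho_2\rangle=G$; (5) no element of $\mathrm{Aut}(G)$ swaps $\rho_0$ and $\rho_2$ and fixes $\rho_1$. Let $\Delta=\Gamma(G;\{G_0,G_1,G_2,G_3\})$ be the coset geometry with $G_0=\langle\rho_0,\rho_1\rangle$, $G_1=\langle\rho_0,\rho_2\rangle$, $G_2=\langle\rho_1,\rho_2\rangle$, $G_3=\langle\rho_1,\rho_0\rho_2\rangle$, and let $\Delta_\alpha$ be its absolute geometry with respect to the triality $\alpha$. Then $\Delta_\alpha$ is a graph which is the disjoint union of $\frac{|L_2(q)|}{2}$ paths of length $2$.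
   Context: The coset geometry $\Gamma(G;\{G_0,G_1,G_2,G_3\})$ has as elements of type $i\in\{0,1,2,3\}$ the right cosets $G_ig$, $g\in G$; cosets $G_ig$ and $G_jh$ of different types $i\neq j$ are incident iff $G_ig\cap G_jh\neq\emptyset$ (and every element is incident to itself). A flag is a set of pairwise incident elements. The automorphism $\alpha$ acts on $\Delta$ by mapping $G_ig$ to its image $\alpha(G_ig)=\alpha(G_i)\alpha(g)$; this permutes the types $0,2,3$ cyclically and fixes type $1$, and is a triality of $\Delta$. The absolute geometry $\Delta_\alpha$ has as elements the minimal nonempty $\alpha$-invariant flags of $\Delta$, two such flags $F,F'$ being incident iff $F\cup F'$ is a flag of $\Delta$; the type of an element is the $\alpha$-orbit of types occurring in it. Thus its elements are of two kinds: the flags $\{v,\alpha(v),\alpha^2(v)\}$ of type $\{0,2,3\}$ (the vertices, or absolute points), and the cosets $G_1x$ fixed by $\alpha$ (the edges). $\Delta_\alpha$ is regarded as a graph with these vertices and edges; the length of a path is its number of edges. *)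

theory Defs
  imports "HOL-Analysis.Analysis" "HOL-Algebra.Algebra" "HOL-Number_Theory.Prime_Powers"
begin

definition SL2 :: "'a::field itself \<Rightarrow> ('a^2^2) monoid" where
  "SL2 _ = \<lparr>carrier = {A. det A = 1}, mult = (**), one = mat 1\<rparr>"

definition group_center :: "('g, 'm) monoid_scheme \<Rightarrow> 'g set" where
  "group_center G = {z \<in> carrier G. \<forall>g\<in>carrier G. z \<otimes>\<^bsub>G\<^esub> g = g \<otimes>\<^bsub>G\<^esub> z}"

text \<open>The scalar matrices of determinant 1 are the center of \<open>SL\<^sub>2\<close>.\<close>

definition PSL2 :: "'a::field itself \<Rightarrow> ('a^2^2) set monoid" where
  "PSL2 T = SL2 T Mod group_center (SL2 T)"

definition involution :: "('g, 'm) monoid_scheme \<Rightarrow> 'g \<Rightarrow> bool" where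
  "involution G x \<longleftrightarrow> x \<in> carrier G \<and> group.ord G x = 2"

definition inner_auto :: "('g, 'm) monoid_scheme \<Rightarrow> 'g \<Rightarrow> ('g \<Rightarrow> 'g)" where
  "inner_auto G g = (\<lambda>x\<in>carrier G. g \<otimes>\<^bsub>G\<^esub> x \<otimes>\<^bsub>G\<^esub> inv\<^bsub>G\<^esub> g)"

definition outer_auto :: "('g, 'm) monoid_scheme \<Rightarrow> ('g \<Rightarrow> 'g) \<Rightarrow> bool" where
  "outer_auto G \<alpha> \<longleftrightarrow> \<alpha> \<in> auto G \<and> \<alpha> \<notin> inner_auto G ` carrier G"

text \<open>Either direction of the 3-cycle counts as permuting cyclically.\<close>

definition cyclically_permutes :: "('g \<Rightarrow> 'g) \<Rightarrow> 'g \<Rightarrow> 'g \<Rightarrow> 'g \<Rightarrow> bool" where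
  "cyclically_permutes f x y z \<longleftrightarrow>
     (f x = y \<and> f y = z \<and> f z = x) \<or> (f x = z \<and> f z = y \<and> f y = x)"

text \<open>The geometry \<open>\<Gamma>(G; {G\<^sub>0, \<dots>, G\<^sub>n\<^sub>-\<^sub>1})\<close> is given by \<open>G\<close> and the list of the \<open>G\<^sub>i\<close>. An element
  of the geometry is a coset tagged with its type: the pair \<open>(i, G\<^sub>i g)\<close>.\<close>

definition coset_elements ::
    "('g, 'm) monoid_scheme \<Rightarrow> 'g set list \<Rightarrow> (nat \<times> 'g set) set" where
  "coset_elements G Hs = {(i, S). i < length Hs \<and> S \<in> rcosets\<^bsub>G\<^esub> (Hs ! i)}"

definition incident :: "nat \<times> 'g set \<Rightarrow> nat \<times> 'g set \<Rightarrow> bool" where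
  "incident x y \<longleftrightarrow> x = y \<or> (fst x \<noteq> fst y \<and> snd x \<inter> snd y \<noteq> {})"

definition flag ::
    "('g, 'm) monoid_scheme \<Rightarrow> 'g set list \<Rightarrow> (nat \<times> 'g set) set \<Rightarrow> bool" where
  "flag G Hs F \<longleftrightarrow> F \<subseteq> coset_elements G Hs \<and> (\<forall>x\<in>F. \<forall>y\<in>F. incident x y)"

text \<open>The action \<open>G\<^sub>i g \<mapsto> \<alpha>(G\<^sub>i g) = \<alpha>(G\<^sub>i) \<alpha>(g)\<close> of an automorphism permuting the (pairwise
  distinct) subgroups \<open>G\<^sub>i\<close>; the type of the image is the \<open>j\<close> with \<open>\<alpha>(G\<^sub>i) = G\<^sub>j\<close>.\<close>

definition coset_act ::
    "'g set list \<Rightarrow> ('g \<Rightarrow> 'g) \<Rightarrow> nat \<times> 'g set \<Rightarrow> nat \<times> 'g set" where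
  "coset_act Hs \<alpha> x = ((THE j. j < length Hs \<and> Hs ! j = \<alpha> ` (Hs ! fst x)), \<alpha> ` snd x)"

definition invariant_flag ::
    "('g, 'm) monoid_scheme \<Rightarrow> 'g set list \<Rightarrow> ('g \<Rightarrow> 'g) \<Rightarrow> (nat \<times> 'g set) set \<Rightarrow> bool" where
  "invariant_flag G Hs \<alpha> F \<longleftrightarrow> flag G Hs F \<and> coset_act Hs \<alpha> ` F = F"

definition absolute_elements ::
    "('g, 'm) monoid_scheme \<Rightarrow> 'g set list \<Rightarrow> ('g \<Rightarrow> 'g) \<Rightarrow> (nat \<times> 'g set) set set" where
  "absolute_elements G Hs \<alpha> =
     {F. F \<noteq> {} \<and> invariant_flag G Hs \<alpha> F \<and>
         (\<forall>F'. F' \<noteq> {} \<and> F' \<subseteq> F \<and> invariant_flag G Hs \<alpha> F' \<longrightarrow> F' = F)}"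

definition absolute_incident ::
    "('g, 'm) monoid_scheme \<Rightarrow> 'g set list \<Rightarrow> (nat \<times> 'g set) set \<Rightarrow> (nat \<times> 'g set) set \<Rightarrow> bool"
  where
  "absolute_incident G Hs F F' \<longleftrightarrow> flag G Hs (F \<union> F')"

definition absolute_elements_of_type ::
    "('g, 'm) monoid_scheme \<Rightarrow> 'g set list \<Rightarrow> ('g \<Rightarrow> 'g) \<Rightarrow> nat set \<Rightarrow> (nat \<times> 'g set) set set"
  where
  "absolute_elements_of_type G Hs \<alpha> J = {F \<in> absolute_elements G Hs \<alpha>. fst ` F = J}"

definition incidence_graph :: "'v set \<Rightarrow> 'e set \<Rightarrow> ('v \<Rightarrow> 'e \<Rightarrow> bool) \<Rightarrow> bool" where
  "incidence_graph V E I \<longleftrightarrow>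
     (\<forall>e\<in>E. card {v\<in>V. I v e} = 2) \<and> inj_on (\<lambda>e. {v\<in>V. I v e}) E"

definition path_graph :: "nat \<Rightarrow> 'v set \<Rightarrow> 'e set \<Rightarrow> ('v \<Rightarrow> 'e \<Rightarrow> bool) \<Rightarrow> bool" where
  "path_graph n V E I \<longleftrightarrow>
     (\<exists>v e. bij_betw v {..n} V \<and> bij_betw e {..<n} E \<and>
        (\<forall>i\<le>n. \<forall>j<n. I (v i) (e j) \<longleftrightarrow> i = j \<or> i = Suc j))"

definition disjoint_union_of_paths ::
    "nat \<Rightarrow> nat \<Rightarrow> 'v set \<Rightarrow> 'e set \<Rightarrow> ('v \<Rightarrow> 'e \<Rightarrow> bool) \<Rightarrow> bool" where
  "disjoint_union_of_paths N n V E I \<longleftrightarrow>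
     (\<exists>W D. V = (\<Union>k<N. W k) \<and> E = (\<Union>k<N. D k) \<and>
        disjoint_family_on W {..<N} \<and> disjoint_family_on D {..<N} \<and>
        (\<forall>k<N. path_graph n (W k) (D k) I) \<and>
        (\<forall>k<N. \<forall>l<N. k \<noteq> l \<longrightarrow> (\<forall>v\<in>W k. \<forall>e\<in>D l. \<not> I v e)))"

end

theory Submission
  imports Defs "HOL-Number_Theory.Residues"
begin

text \<open>
  Every automorphism of \<open>PSL\<^sub>2\<close> over a finite field is semilinear. It preserves the elements of
  order the characteristic, so after an inner correction it normalises the two opposite unipotent
  groups, and the relations with the Weyl elements force the induced additive map of the field to be
  a field automorphism. As \<open>\<alpha>\<close> is outer of order 3, this field automorphism has order 3, and
  Hilbert 90 makes \<open>\<alpha>\<close> conjugate to it; hence the fixed points of \<open>\<alpha>\<close> form a copy of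
  \<open>L\<^sub>2(q)\<close>.

  Since \<open>\<alpha>\<close> acts on the four-group \<open>G\<^sub>1\<close> without nontrivial fixed points, every edge is
  \<open>G\<^sub>1 x\<close> for a unique fixed point \<open>x\<close>. Choosing \<open>y\<close> in the intersection of two of its cosets, a
  vertex corresponds to some \<open>g\<close> in the dihedral group \<open>G\<^sub>0\<close> with \<open>g \<cdot> \<alpha>(g) \<cdot> \<alpha>\<^sup>2(g) = 1\<close>.
  Traces of products of trace-zero lifts of the involutions show that only
  \<open>1\<close>, \<open>\<rho>\<^sub>0\<close> and \<open>\<rho>\<^sub>1 \<rho>\<^sub>0 \<rho>\<^sub>1\<close> occur. So every vertex contains
  \<open>G\<^sub>0 x\<close> (the middle of a path, shared by the edges of \<open>x\<close> and \<open>\<rho>\<^sub>1 x\<close>) or \<open>G\<^sub>0 \<rho>\<^sub>2 x\<close> (an end,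
  lying on the edge of \<open>x\<close> only) for a fixed point \<open>x\<close>.
\<close>

section \<open>Two-by-two matrices and projective special linear groups\<close>

text \<open>Two obstacles shape the argument: group elements are matrices only up to sign, while the
  proof works with entries and traces, and all characteristics are treated at once. In
  characteristic 2 signs are void. Elsewhere they are removed by normalising a trace to 2, or by the
  odd order of \<open>\<alpha>\<close>: a class fixed by \<open>\<alpha>\<close> consists of
  matrices fixed by the lift of \<open>\<alpha>\<close>, which is a semilinear ring automorphism of
  all 2 by 2 matrices, so that linear combinations and traces survive it. The lifts of
  \<open>\<rho>\<^sub>0\<close>, \<open>\<rho>\<^sub>2\<close> and their product multiply like
  quaternion units. Their three traces against the lift of \<open>\<rho>\<^sub>1\<close> are
  conjugate under the field automorphism, and nonzero because \<open>\<rho>\<^sub>0\<close> and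
  \<open>\<rho>\<^sub>1\<close> do not commute; unwanted elements of the dihedral groups are mostly
  excluded by exhibiting such a trace as a factor of something that vanishes. The number of paths is
  half the number of fixed points because left multiplication by \<open>\<rho>\<^sub>1\<close>
  permutes the fixed points in pairs, one pair for each path.\<close>

definition mk :: "'a \<Rightarrow> 'a \<Rightarrow> 'a \<Rightarrow> 'a \<Rightarrow> 'a^2^2" where
  "mk a b c d = (\<chi> i j. if i = 1 then (if j = 1 then a else b) else (if j = 1 then c else d))"

lemma mk_nth [simp]:
  "mk a b c d $ 1 $ 1 = a" "mk a b c d $ 1 $ 2 = b"
  "mk a b c d $ 2 $ 1 = c" "mk a b c d $ 2 $ 2 = d"
  by (simp_all add: mk_def)

lemma mk_eq_iff [simp]: "mk a b c d = mk a' b' c' d' \<longleftrightarrow> a = a' \<and> b = b' \<and> c = c' \<and> d = d'"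
  by (metis mk_nth)

lemma mk_eta: "A = mk (A$1$1) (A$1$2) (A$2$1) (A$2$2)"
  by (simp add: vec_eq_iff forall_2)

lemma mk_cases: obtains a b c d where "A = mk a b c d"
  using mk_eta by blast

lemma mk_mult [simp]:
  fixes a :: "'a::semiring_1"
  shows "mk a b c d ** mk a' b' c' d' =
    mk (a * a' + b * c') (a * b' + b * d') (c * a' + d * c') (c * b' + d * d')"
  by (simp add: vec_eq_iff forall_2 matrix_matrix_mult_def sum_2)

lemma mk_uminus [simp]: "- mk a b c d = mk (- a) (- b) (- c) (- (d :: 'a::group_add))"
  by (simp add: vec_eq_iff forall_2)

lemma det_mk [simp]: "det (mk a b c d) = a * d - b * (c :: 'a::comm_ring_1)"
  by (simp add: det_2)

lemma mat_mk: "mat k = mk k 0 0 (k :: 'a::zero)"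
  by (simp add: vec_eq_iff forall_2 mat_def)

definition tr :: "'a::semiring_1^2^2 \<Rightarrow> 'a" where "tr A = A$1$1 + A$2$2"

lemma tr_mk [simp]: "tr (mk a b c d) = a + d" by (simp add: tr_def)

definition adj :: "'a::ring_1^2^2 \<Rightarrow> 'a^2^2" where
  "adj A = mk (A$2$2) (- A$1$2) (- A$2$1) (A$1$1)"

lemma adj_mk [simp]: "adj (mk a b c d) = mk d (- b) (- c) (a :: 'a::ring_1)"
  by (simp add: adj_def)

definition scal :: "'a::semiring_1 \<Rightarrow> 'a^2^2 \<Rightarrow> 'a^2^2" where
  "scal k A = mk (k * A$1$1) (k * A$1$2) (k * A$2$1) (k * A$2$2)"

lemma scal_mk [simp]: "scal k (mk a b c d) = mk (k * a) (k * b) (k * c) (k * (d :: 'a::semiring_1))"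
  by (simp add: scal_def)

lemma mk_add [simp]: "mk a b c d + mk a' b' c' d' = mk (a + a') (b + b') (c + c') (d + (d' :: 'a::plus))"
  by (simp add: vec_eq_iff forall_2)

lemma mk_zero: "0 = mk 0 0 0 (0::'a::zero)"
  by (simp add: vec_eq_iff forall_2)

lemma minus_mult_left2:
  fixes A B :: "'a::ring_1^2^2"
  shows "(- A) ** B = - (A ** B)"
  by (cases A rule: mk_cases, cases B rule: mk_cases) simp

lemma minus_mult_right2:
  fixes A B :: "'a::ring_1^2^2"
  shows "A ** (- B) = - (A ** B)"
  by (cases A rule: mk_cases, cases B rule: mk_cases) simp

lemma det_minus2: "det (- A) = det (A :: 'a::comm_ring_1^2^2)"
  by (cases A rule: mk_cases) simp

lemma adj_right: "A ** adj A = mat (det (A :: 'a::comm_ring_1^2^2))"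
  by (cases A rule: mk_cases) (simp add: mat_mk algebra_simps)

lemma adj_left: "adj A ** A = mat (det (A :: 'a::comm_ring_1^2^2))"
  by (cases A rule: mk_cases) (simp add: mat_mk algebra_simps)

lemma det_adj [simp]: "det (adj A) = det (A :: 'a::comm_ring_1^2^2)"
  by (cases A rule: mk_cases) (simp add: algebra_simps)

lemma adj_mult: "adj (A ** B) = adj B ** adj (A :: 'a::comm_ring_1^2^2)"
  by (cases A rule: mk_cases, cases B rule: mk_cases) (simp add: algebra_simps)

section \<open>The special linear group, its center and the quotient by sign\<close>

lemma carrier_SL2 [simp]: "carrier (SL2 T) = {A. det A = 1}"
  and mult_SL2 [simp]: "A \<otimes>\<^bsub>SL2 T\<^esub> B = A ** B"
  and one_SL2 [simp]: "\<one>\<^bsub>SL2 T\<^esub> = mat 1"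
  by (simp_all add: SL2_def)

lemma group_SL2: "group (SL2 T)"
proof (rule groupI)
  fix A assume "A \<in> carrier (SL2 T)"
  then show "\<exists>B\<in>carrier (SL2 T). B \<otimes>\<^bsub>SL2 T\<^esub> A = \<one>\<^bsub>SL2 T\<^esub>"
    by (intro bexI[of _ "adj A"]) (auto simp: adj_left)
qed (auto simp: det_mul matrix_mul_assoc)

text \<open>Commuting with the two elementary matrices at 1 already forces a scalar matrix, and
  determinant 1 makes the scalar a square root of 1.\<close>

lemma center_SL2: "group_center (SL2 T) = {mat 1, - mat (1::'a::field)}"
proof (intro equalityI subsetI)
  fix z :: "'a^2^2"
  assume z: "z \<in> group_center (SL2 T)"
  obtain a b c d where [simp]: "z = mk a b c d" by (rule mk_cases)
  have "z ** mk 1 1 0 1 = mk 1 1 0 1 ** z" "z ** mk 1 0 1 1 = mk 1 0 1 1 ** z" "det z = 1"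
    using z by (auto simp: group_center_def simp del: mk_mult)
  then have "c = 0" "b = 0" "a = d" "a * d = 1"
    by auto
  then show "z \<in> {mat 1, - mat 1}"
    by (auto simp: mat_mk power2_eq_square[symmetric] power2_eq_1_iff)
next
  fix z :: "'a^2^2"
  assume "z \<in> {mat 1, - mat 1}"
  then show "z \<in> group_center (SL2 T)"
    by (auto simp: group_center_def det_minus2 minus_mult_left2 minus_mult_right2)
qed

text \<open>The coset of the center that contains \<open>A\<close>, a singleton in characteristic 2.
  It is defined for every matrix, so sign arguments can be made without tracking
  determinants.\<close>

definition pr :: "'a::ring_1^2^2 \<Rightarrow> ('a^2^2) set" where "pr A = {A, - A}"

lemma pr_eq_iff: "pr A = pr B \<longleftrightarrow> A = B \<or> A = - B"
  by (auto simp: pr_def doubleton_eq_iff)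

lemma pr_uminus [simp]: "pr (- A) = pr A"
  by (simp add: pr_eq_iff)

lemma rcoset_center: "group_center (SL2 T) #>\<^bsub>SL2 T\<^esub> A = pr (A :: 'a::field^2^2)"
  by (auto simp: r_coset_def center_SL2 pr_def minus_mult_left2)

lemma normal_center: "normal (group_center (SL2 T)) (SL2 T)"
proof -
  interpret group "SL2 T" by (rule group_SL2)
  have "subgroup (group_center (SL2 T)) (SL2 T)"
  proof (rule subgroupI)
    fix a assume a: "a \<in> group_center (SL2 T)"
    have "\<And>b. det b = 1 \<Longrightarrow> det (adj b) = 1" by simp
    have "inv\<^bsub>SL2 T\<^esub> a = a"
      using a by (intro inv_equality) (auto simp: center_SL2 minus_mult_left2 det_minus2)
    then show "inv\<^bsub>SL2 T\<^esub> a \<in> group_center (SL2 T)" using a by simp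
  next
    fix a b assume "a \<in> group_center (SL2 T)" "b \<in> group_center (SL2 T)"
    then show "a \<otimes>\<^bsub>SL2 T\<^esub> b \<in> group_center (SL2 T)"
      by (auto simp: center_SL2 minus_mult_left2)
  qed (auto simp: center_SL2 det_minus2)
  then show ?thesis
    by (rule normalI) (auto simp: r_coset_def l_coset_def center_SL2 minus_mult_left2 minus_mult_right2)
qed

lemma group_PSL2: "group (PSL2 T)"
  unfolding PSL2_def by (rule normal.factorgroup_is_group[OF normal_center])

lemma carrier_PSL2: "carrier (PSL2 T) = pr ` {A. det A = 1}"
  by (auto simp: PSL2_def FactGroup_def RCOSETS_def rcoset_center)

lemma one_PSL2: "\<one>\<^bsub>PSL2 T\<^esub> = pr (mat 1)"
  by (auto simp: PSL2_def FactGroup_def pr_def center_SL2)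

lemma mult_PSL2 [simp]: "pr A \<otimes>\<^bsub>PSL2 T\<^esub> pr B = pr (A ** B)"
  by (auto simp: PSL2_def FactGroup_def set_mult_def pr_def minus_mult_left2 minus_mult_right2)

lemma pr_in [simp]: "det A = 1 \<Longrightarrow> pr A \<in> carrier (PSL2 T)"
  by (auto simp: carrier_PSL2)

lemma PSL2_cases:
  assumes "x \<in> carrier (PSL2 T)" obtains A where "det A = 1" "x = pr A"
  using assms by (auto simp: carrier_PSL2)

lemma inv_PSL2: "det A = 1 \<Longrightarrow> inv\<^bsub>PSL2 T\<^esub> (pr A) = pr (adj A)"
  by (rule group.inv_equality[OF group_PSL2]) (auto simp: one_PSL2 adj_left)

section \<open>Conjugation and unipotent elements\<close>

abbreviation psl :: "('a::field^2^2) set monoid" where "psl \<equiv> PSL2 TYPE('a)"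

text \<open>Automorphisms of \<open>PSL2\<close> come from conjugation by any invertible matrix, not
  only by determinant 1, hence the division by \<open>det A\<close>.\<close>

definition minv :: "'a::field^2^2 \<Rightarrow> 'a^2^2" where
  "minv A = scal (inverse (det A)) (adj A)"

lemma mat_mult_1 [simp]: "mat 1 ** A = (A :: 'a::semiring_1^2^2)" "A ** mat 1 = A"
  by simp_all

lemma scal_mult_right: "A ** scal k B = scal k (A ** B :: 'a::comm_ring_1^2^2)"
  and scal_mult_left: "scal k A ** B = scal k (A ** B :: 'a::comm_ring_1^2^2)"
  by (cases A rule: mk_cases, cases B rule: mk_cases, simp add: algebra_simps)+

lemma scal_mat: "scal k (mat d) = mat (k * d)"
  by (simp add: mat_mk)

lemma minv_right: "det A \<noteq> 0 \<Longrightarrow> A ** minv A = mat 1"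
  by (simp add: minv_def scal_mult_right adj_right scal_mat)

lemma minv_left: "det A \<noteq> 0 \<Longrightarrow> minv A ** A = mat 1"
  by (simp add: minv_def scal_mult_left adj_left scal_mat)

lemma minv_mult_cancel [simp]:
  assumes "det A \<noteq> 0"
  shows "A ** (minv A ** M) = M" "minv A ** (A ** M) = M"
  by (simp_all add: assms matrix_mul_assoc minv_left minv_right)

lemma det_minv: "det A \<noteq> 0 \<Longrightarrow> det (minv A) = inverse (det A)"
  by (metis det_I det_mul inverse_unique minv_right)

lemma minv_minv: "det A \<noteq> 0 \<Longrightarrow> minv (minv A) = A"
  by (metis det_minv inverse_nonzero_iff_nonzero mat_mult_1(2) minv_left minv_mult_cancel(1))

lemma minv_unique: "A ** B = mat 1 \<Longrightarrow> minv A = (B :: 'a::field^2^2)"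
  by (metis det_I det_mul mat_mult_1(2) minv_mult_cancel(2) mult_zero_left zero_neq_one)

lemma minv_mult: "det A \<noteq> 0 \<Longrightarrow> det B \<noteq> 0 \<Longrightarrow> minv (A ** B) = minv B ** minv A"
  by (rule minv_unique) (simp add: matrix_mul_assoc[symmetric] minv_right)

lemma minv_SL: "det A = 1 \<Longrightarrow> minv A = adj A"
  by (rule minv_unique) (simp add: adj_right)

lemma conj_det: "det A \<noteq> 0 \<Longrightarrow> det (A ** M ** minv A) = det M"
  by (simp add: det_mul det_minv)

lemma conj_eqI: "det A \<noteq> 0 \<Longrightarrow> Y ** A = A ** M \<Longrightarrow> Y = A ** M ** minv A"
  by (metis mat_mult_1(2) matrix_mul_assoc minv_right)

lemma conj_mult:
  "det A \<noteq> 0 \<Longrightarrow> A ** (M ** Y) ** minv A = (A ** M ** minv A) ** (A ** Y ** minv A)"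
  by (simp add: matrix_mul_assoc[symmetric])

lemma conj_comp:
  "det A \<noteq> 0 \<Longrightarrow> det B \<noteq> 0 \<Longrightarrow>
    A ** (B ** M ** minv B) ** minv A = (A ** B) ** M ** minv (A ** B)"
  by (simp add: minv_mult matrix_mul_assoc)

fun mpow :: "'a::semiring_1^2^2 \<Rightarrow> nat \<Rightarrow> 'a^2^2" where
  "mpow M 0 = mat 1"
| "mpow M (Suc n) = mpow M n ** M"

lemma det_mpow: "det (mpow M n) = det (M :: 'a::comm_ring_1^2^2) ^ n"
  by (induction n) (auto simp: det_mul)

lemma pr_pow: "pr M [^]\<^bsub>psl\<^esub> n = pr (mpow M n)"
  by (induction n) (auto simp: one_PSL2)

text \<open>Matrices of type \<open>vec\<close> multiply componentwise as a ring, so the freshman's dream is applied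
  in the polynomial ring and then evaluated at the matrix.\<close>

definition pev :: "'a::comm_ring_1^2^2 \<Rightarrow> 'a poly \<Rightarrow> 'a^2^2" where
  "pev M p = fold_coeffs (\<lambda>a N. mat a + N ** M) p 0"

lemma pev_0 [simp]: "pev M 0 = 0"
  by (simp add: pev_def)

lemma mat_0: "mat 0 = (0 :: 'a::comm_ring_1^2^2)"
  by (simp add: mat_mk mk_zero)

lemma pev_pCons [simp]: "pev M (pCons a p) = mat a + pev M p ** M"
  by (cases "p = 0 \<and> a = 0") (auto simp: pev_def mat_0)

lemma pev_add: "pev M (p + q) = pev M p + pev M q"
proof (induction p q rule: poly_induct2)
  case (pCons a p b q)
  then show ?case
    by (cases "pev M p" rule: mk_cases, cases "pev M q" rule: mk_cases, cases M rule: mk_cases)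
       (simp add: mat_mk algebra_simps)
qed simp

lemma pev_smult: "pev M (Polynomial.smult c p) = scal c (pev M p)"
proof (induction p)
  case 0
  then show ?case by (simp add: mk_zero)
next
  case (pCons a p)
  then show ?case
    by (cases "pev M p" rule: mk_cases, cases M rule: mk_cases) (simp add: mat_mk algebra_simps)
qed

lemma pev_commute: "pev M p ** M = M ** pev M p"
proof (induction p)
  case 0
  then show ?case by (cases M rule: mk_cases) (simp add: mk_zero)
next
  case (pCons a p)
  have "pev M (pCons a p) ** M = scal a M + (pev M p ** M) ** M"
    by (cases "pev M p" rule: mk_cases, cases M rule: mk_cases) (simp add: mat_mk algebra_simps)
  also have "\<dots> = scal a M + M ** (pev M p ** M)"
    by (metis pCons.IH matrix_mul_assoc)
  also have "\<dots> = M ** pev M (pCons a p)"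
    by (cases "pev M p" rule: mk_cases, cases M rule: mk_cases) (simp add: mat_mk algebra_simps)
  finally show ?case .
qed

lemma pev_mult: "pev M (p * q) = pev M p ** pev M q"
proof (induction p)
  case 0
  then show ?case by simp
next
  case (pCons a p)
  have "pev M (pCons a p * q) = scal a (pev M q) + mat 0 + (pev M p ** pev M q) ** M"
    by (simp add: pev_add pev_smult pCons)
  also have "(pev M p ** pev M q) ** M = pev M p ** M ** pev M q"
    by (metis matrix_mul_assoc pev_commute)
  also have "scal a (pev M q) + mat 0 + pev M p ** M ** pev M q = (mat a + pev M p ** M) ** pev M q"
    by (cases "pev M p ** M" rule: mk_cases, cases "pev M q" rule: mk_cases)
       (simp add: mat_mk algebra_simps)
  finally show ?case by simp
qed

lemma pev_power: "pev M (p ^ n) = mpow (pev M p) n"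
proof (induction n)
  case 0
  then show ?case by (simp add: one_pCons)
next
  case (Suc n)
  then show ?case by (simp add: pev_mult mult.commute[of p] del: mult.commute)
qed

text \<open>In characteristic p one has \<open>(X - e)^p = X^p - e\<close> for \<open>e = 1\<close>
  or \<open>e = - 1\<close>. Evaluated at \<open>M\<close> this makes \<open>M - e\<close>
  nilpotent, and \<open>det (M - e) = 0\<close> together with \<open>det M = 1\<close> says
  \<open>e * tr M = 2\<close>.\<close>

lemma trace_of_char_torsion:
  fixes M :: "'a::field^2^2"
  assumes M: "det M = 1" and p: "Factorial_Ring.prime CHAR('a)" "n = CHAR('a)"
    and e: "e = 1 \<or> e = - 1" and Xn: "mpow M n = mat e"
  shows "tr M = 2 * e"
proof -
  have "[:- e, 1:] ^ n = [:0, 1:] ^ n + [:- e:] ^ n"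
    using freshmans_dream[of n "[:0, 1::'a:]" "[:- e:]"] p by simp
  also have "[:- e:] ^ n = [:(- e) ^ n:]"
    by (simp add: poly_const_pow)
  also have "(- e) ^ n = - e"
    using e minus_power_prime_CHAR[OF p(2), of 1] p by auto
  finally have "pev M ([:- e, 1:] ^ n) = pev M ([:0, 1:] ^ n) + pev M [:- e:]"
    by (simp add: pev_add)
  then have "mpow (mat (- e) + M) n = mat e + mat (- e)"
    by (simp add: pev_power mat_0 Xn)
  then have "mpow (mat (- e) + M) n = 0"
    by (simp add: mat_mk mk_zero)
  then have "det (mat (- e) + M) ^ n = 0"
    by (metis det_mpow det_0 mat_0)
  then have "det (mat (- e) + M) = 0" by simp
  moreover have ee: "e * e = 1" using e by auto
  ultimately have "e * tr M = 2"
    using M by (cases M rule: mk_cases) (auto simp: mat_mk algebra_simps)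
  then have "(e * e) * tr M = e * 2" by (simp only: mult.assoc)
  then show ?thesis by (simp add: ee)
qed

section \<open>The two opposite root subgroups and their centralizers\<close>

definition upp :: "'a::field \<Rightarrow> 'a^2^2" where "upp t = mk 1 t 0 1"
definition low :: "'a::field \<Rightarrow> 'a^2^2" where "low t = mk 1 0 t 1"

lemma det_upp [simp]: "det (upp t) = 1" and det_low [simp]: "det (low t) = 1"
  by (simp_all add: upp_def low_def)

lemma upp_add: "upp s ** upp t = upp (s + t)" and low_add: "low s ** low t = low (s + t)"
  by (simp_all add: upp_def low_def add.commute)

text \<open>A single nonzero element equal to its negative means characteristic 2, where every sign
  ambiguity disappears. This is how sign cases are closed without a case split on the
  characteristic.\<close>

lemma minus_eq_self_imp:
  fixes a x :: "'a::idom"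
  assumes "a = - a" "a \<noteq> 0"
  shows "- x = x"
proof -
  have "a * (1 + 1) = 0" using assms(1) by (metis add.right_inverse distrib_left mult.right_neutral)
  then have "(1 + 1 :: 'a) = 0" using \<open>a \<noteq> 0\<close> by simp
  then have "x * (1 + 1) = 0" by simp
  then have "x + x = 0" by (simp only: distrib_left mult.right_neutral)
  then show ?thesis by (metis add_eq_0_iff)
qed

lemma pr_upp_eq_iff [simp]: "pr (upp s) = pr (upp t) \<longleftrightarrow> s = t"
  and pr_low_eq_iff [simp]: "pr (low s) = pr (low t) \<longleftrightarrow> s = t"
  using minus_eq_self_imp[of 1] by (auto simp: pr_eq_iff upp_def low_def)

lemma mpow_upp: "mpow (upp s) n = upp (of_nat n * s)" and mpow_low: "mpow (low s) n = low (of_nat n * s)"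
  by (induction n) (auto simp: upp_add low_add algebra_simps, simp_all add: upp_def low_def mat_mk)

lemma minus_eq_self_matrix:
  fixes a :: "'a::idom"
  assumes "a = - a" "a \<noteq> 0"
  shows "- N = (N :: 'a^2^2)"
  by (cases N rule: mk_cases) (simp add: minus_eq_self_imp[OF assms])

text \<open>A nontrivial element of a root subgroup has that root subgroup as its centralizer.
  Commuting in \<open>PSL2\<close> leaves a sign open, but a minus sign makes a nonzero entry of
  \<open>M\<close> equal to its negative, so it is harmless.\<close>

lemma commute_upp:
  assumes "det M = 1" "c \<noteq> 0" "pr (M ** upp c) = pr (upp c ** M)"
  shows "\<exists>t. pr M = pr (upp t)"
proof -
  obtain a b d e where M: "M = mk a b d e" by (rule mk_cases)
  have "M ** upp c = upp c ** M"
  proof (cases "M ** upp c = upp c ** M")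
    case False
    then have *: "M ** upp c = - (upp c ** M)" using assms by (auto simp: pr_eq_iff)
    have "a = - a \<and> a \<noteq> 0 \<or> d = - d \<and> d \<noteq> 0"
      using * assms by (cases "d = 0") (auto simp: M upp_def)
    then show ?thesis
      using * minus_eq_self_matrix by metis
  qed
  then have "d = 0" "a = e" "a * a = 1"
    using assms by (auto simp: M upp_def)
  then have "a = 1 \<or> a = - 1"
    by (metis power2_eq_1_iff power2_eq_square)
  then show ?thesis
  proof
    assume "a = 1"
    then show ?thesis using \<open>d = 0\<close> \<open>a = e\<close> by (intro exI[of _ b]) (simp add: M upp_def)
  next
    assume "a = - 1"
    then show ?thesis using \<open>d = 0\<close> \<open>a = e\<close>
      by (intro exI[of _ "- b"]) (simp add: M upp_def pr_eq_iff)
  qed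
qed

lemma commute_low:
  assumes "det M = 1" "c \<noteq> 0" "pr (M ** low c) = pr (low c ** M)"
  shows "\<exists>t. pr M = pr (low t)"
proof -
  \<comment> \<open>Conjugation by this Weyl element exchanges the two root subgroups, which
    transfers the result for \<open>upp\<close>.\<close>
  let ?J = "mk 0 1 (- 1) 0 :: 'a^2^2"
  have J: "det ?J = 1" by simp
  have sw: "?J ** low t ** minv ?J = upp (- t)" for t
    by (simp add: minv_SL low_def upp_def)
  have cj: "pr (?J ** A ** minv ?J) = pr (?J ** B ** minv ?J) \<longleftrightarrow> pr A = pr B" for A B
    by (cases A rule: mk_cases, cases B rule: mk_cases) (auto simp: pr_eq_iff minv_SL)
  have "det (?J ** M ** minv ?J) = 1" using assms by (simp add: conj_det del: mk_mult)
  moreover have "pr ((?J ** M ** minv ?J) ** upp (- c)) = pr (upp (- c) ** (?J ** M ** minv ?J))"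
    using assms(3) by (subst sw[symmetric])+ (simp add: conj_mult[symmetric] cj del: mk_mult)
  ultimately obtain t where "pr (?J ** M ** minv ?J) = pr (upp t)"
    using commute_upp[of "?J ** M ** minv ?J" "- c"] assms(2) by (auto simp del: mk_mult)
  then have "pr M = pr (low (- t))"
    by (subst cj[symmetric]) (simp add: sw del: mk_mult)
  then show ?thesis ..
qed

text \<open>A Jordan basis: the columns of \<open>A\<close> are \<open>(Y - 1) v\<close> and
  \<open>v\<close>, where \<open>v\<close> is the first basis vector if \<open>c\<close> is nonzero
  and the second otherwise.\<close>

lemma conj_unipotent:
  assumes "det Y = 1" "tr Y = 2" "Y \<noteq> mat 1"
  shows "\<exists>A. det A \<noteq> 0 \<and> Y = A ** upp 1 ** minv A"
proof -
  obtain a b c d where Y: "Y = mk a b c d" by (rule mk_cases)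
  have d: "d = 2 - a" and dt: "a * d - b * c = 1" using assms by (auto simp: Y algebra_simps)
  show ?thesis
  proof (cases "c = 0")
    case False
    have "Y ** mk (a - 1) 1 c 0 = mk (a - 1) 1 c 0 ** upp 1"
      using dt by (auto simp: Y upp_def d algebra_simps)
    then show ?thesis using False
      by (intro exI[of _ "mk (a - 1) 1 c 0"]) (auto intro!: conj_eqI)
  next
    case True
    then have "(a - 1)\<^sup>2 = 0" using dt by (simp add: d power2_eq_square algebra_simps)
    then have "a = 1" "d = 1" by (auto simp: d)
    then have "b \<noteq> 0" using assms True by (auto simp: Y mat_mk)
    moreover have "Y ** mk b 0 0 1 = mk b 0 0 1 ** upp 1"
      by (simp add: Y upp_def True \<open>a = 1\<close> \<open>d = 1\<close>)
    ultimately show ?thesis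
      by (intro exI[of _ "mk b 0 0 1"]) (auto intro!: conj_eqI)
  qed
qed

section \<open>Automorphisms of projective special linear groups\<close>

definition fld_hom :: "('a::field \<Rightarrow> 'a) \<Rightarrow> bool" where
  "fld_hom s \<longleftrightarrow> s 1 = 1 \<and> (\<forall>x y. s (x + y) = s x + s y) \<and> (\<forall>x y. s (x * y) = s x * s y)"

definition mmap :: "('a \<Rightarrow> 'a) \<Rightarrow> 'a^2^2 \<Rightarrow> 'a^2^2" where
  "mmap s A = mk (s (A$1$1)) (s (A$1$2)) (s (A$2$1)) (s (A$2$2))"

lemma mmap_mk [simp]: "mmap s (mk a b c d) = mk (s a) (s b) (s c) (s d)"
  by (simp add: mmap_def)

lemma
  assumes "fld_hom s"
  shows fld_hom_0: "s 0 = 0" and fld_hom_1: "s 1 = 1"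
    and fld_hom_add: "s (x + y) = s x + s y"
    and fld_hom_mult: "s (x * y) = s x * s y"
    and fld_hom_minus: "s (- x) = - s x"
    and fld_hom_diff: "s (x - y) = s x - s y"
    and fld_hom_inverse: "s (inverse x) = inverse (s x)"
    and fld_hom_divide: "s (x / y) = s x / s y"
    and fld_hom_eq_0: "s x = 0 \<longleftrightarrow> x = 0"
proof -
  have add: "s (x + y) = s x + s y" and mult: "s (x * y) = s x * s y" and one: "s 1 = 1" for x y
    using assms by (auto simp: fld_hom_def)
  have zero: "s 0 = 0" by (metis add add_0 add_cancel_right_right)
  have neg: "s (- x) = - s x" for x using add[of x "- x"] zero by (simp add: eq_neg_iff_add_eq_0 add.commute)
  have inv: "s (inverse x) = inverse (s x)" for x
  proof (cases "x = 0")
    case False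
    then show ?thesis using mult[of x "inverse x"] one by (simp add: inverse_unique)
  qed (simp add: zero)
  have nz: "s x \<noteq> 0" if "x \<noteq> 0" for x
    using mult[of x "inverse x"] one that by auto
  show "s 0 = 0" "s 1 = 1" "s (x + y) = s x + s y" "s (x * y) = s x * s y"
    "s (- x) = - s x" "s (inverse x) = inverse (s x)"
    by fact+
  show "s (x - y) = s x - s y" "s (x / y) = s x / s y"
    by (simp_all add: diff_conv_add_uminus add neg divide_inverse mult inv del: add_uminus_conv_diff)
  show "s x = 0 \<longleftrightarrow> x = 0" using nz zero by auto
qed

lemmas fld_hom_simps = fld_hom_0 fld_hom_1 fld_hom_add fld_hom_mult fld_hom_minus fld_hom_diff
  fld_hom_inverse fld_hom_divide

lemma mmap_mult: "fld_hom s \<Longrightarrow> mmap s (A ** B) = mmap s A ** mmap s B"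
  by (cases A rule: mk_cases, cases B rule: mk_cases) (simp add: fld_hom_simps)

lemma det_mmap: "fld_hom s \<Longrightarrow> det (mmap s A) = s (det A)"
  by (cases A rule: mk_cases) (simp add: fld_hom_simps)

lemma tr_uminus: "tr (- A) = - tr (A :: 'a::ring_1^2^2)"
  by (cases A rule: mk_cases) simp

lemma iso_mult:
  assumes "f \<in> iso psl psl" "x \<in> carrier psl" "y \<in> carrier psl"
  shows "f (x \<otimes>\<^bsub>psl\<^esub> y) = f x \<otimes>\<^bsub>psl\<^esub> f y"
  using assms by (auto simp: iso_def hom_def)

lemma iso_closed: "f \<in> iso psl psl \<Longrightarrow> x \<in> carrier psl \<Longrightarrow> f x \<in> carrier psl"
  by (auto simp: iso_def hom_def)

lemma iso_inj: "f \<in> iso psl psl \<Longrightarrow> x \<in> carrier psl \<Longrightarrow> y \<in> carrier psl \<Longrightarrow> f x = f y \<longleftrightarrow> x = y"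
  by (auto simp: iso_def bij_betw_def inj_on_def)

lemma iso_one:
  assumes "f \<in> iso psl psl" shows "f \<one>\<^bsub>psl\<^esub> = \<one>\<^bsub>psl\<^esub>"
  using assms by (intro hom_one[OF _ group_PSL2 group_PSL2]) (simp add: iso_def)

lemma iso_pow:
  assumes "f \<in> iso psl psl" "x \<in> carrier psl" shows "f (x [^]\<^bsub>psl\<^esub> (n::nat)) = f x [^]\<^bsub>psl\<^esub> n"
proof (induction n)
  case (Suc n)
  interpret group psl by (rule group_PSL2)
  show ?case using assms Suc by (simp add: iso_mult)
qed (simp add: iso_one assms)

text \<open>The p-th power of a representative of the image is 1 or -1, so its trace is 2 or -2;
  changing the sign of the representative makes the trace 2.\<close>

lemma iso_char_torsion:
  fixes f :: "('a::{field,finite}^2^2) set \<Rightarrow> ('a^2^2) set"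
  assumes f: "f \<in> iso psl psl" and N: "det N = 1" "pr N \<noteq> pr (mat 1)"
    and NC: "mpow N CHAR('a) = mat 1"
  shows "\<exists>Y. det Y = 1 \<and> tr Y = 2 \<and> Y \<noteq> mat 1 \<and> f (pr N) = pr Y"
proof -
  have p: "Factorial_Ring.prime CHAR('a)"
    by (rule prime_CHAR_semidom[OF finite_imp_CHAR_pos[OF finite]])
  have "f (pr N) \<in> carrier psl" using N by (intro iso_closed[OF f]) simp
  then obtain Y where Y: "det Y = 1" "f (pr N) = pr Y" by (rule PSL2_cases)
  have "pr (mpow Y CHAR('a)) = pr (mat 1)"
    using iso_pow[OF f, of "pr N" "CHAR('a)"] iso_one[OF f] N NC
    by (simp add: Y pr_pow one_PSL2)
  then obtain e where e: "e = 1 \<or> e = - 1" "mpow Y CHAR('a) = mat e"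
    by (auto simp: pr_eq_iff mat_mk)
  have "tr Y = 2 * e"
    using trace_of_char_torsion[OF Y(1) p refl e] .
  then consider "tr Y = 2" | "tr (- Y) = 2"
    using e(1) by (auto simp: tr_uminus)
  moreover have "pr Y \<noteq> pr (mat 1)"
    using N iso_inj[OF f, of "pr N" "pr (mat 1)"] iso_one[OF f] by (auto simp: Y one_PSL2)
  then have "Y \<noteq> mat 1" "- Y \<noteq> mat 1" unfolding pr_eq_iff by (metis minus_minus)+
  ultimately show ?thesis
  proof cases
    case 1
    then show ?thesis using Y \<open>Y \<noteq> mat 1\<close> by blast
  next
    case 2
    then show ?thesis using Y by (intro exI[of _ "- Y"]) (simp add: det_minus2 \<open>- Y \<noteq> mat 1\<close>)
  qed
qed

lemma char_torsion_upp: "mpow (upp (s::'a::field)) CHAR('a) = mat 1"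
  and char_torsion_low: "mpow (low (s::'a::field)) CHAR('a) = mat 1"
  by (simp_all add: mpow_upp mpow_low, simp_all add: upp_def low_def mat_mk)

lemma upp_0: "upp 0 = mat 1" and low_0: "low 0 = mat 1"
  by (simp_all add: upp_def low_def mat_mk)

text \<open>The images of \<open>upp 1\<close> and \<open>low 1\<close> are unipotent up to sign and
  do not commute, so they fix different lines. A basis adapted to both lines puts the first image
  into the form \<open>upp 1\<close> and the second into the form \<open>low c\<close>.\<close>

lemma iso_standard_generators:
  fixes f :: "('a::{field,finite}^2^2) set \<Rightarrow> ('a^2^2) set"
  assumes f: "f \<in> iso psl psl"
  shows "\<exists>A c. det A \<noteq> 0 \<and> c \<noteq> 0 \<and> f (pr (upp 1)) = pr (A ** upp 1 ** minv A) \<and>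
    f (pr (low 1)) = pr (A ** low c ** minv A)"
proof -
  obtain Y where Y: "det Y = 1" "tr Y = 2" "Y \<noteq> mat 1" "f (pr (upp 1)) = pr Y"
    using iso_char_torsion[OF f, of "upp 1"] char_torsion_upp by (auto simp flip: upp_0)
  then obtain A where A: "det A \<noteq> 0" "Y = A ** upp 1 ** minv A"
    using conj_unipotent by blast
  obtain Z where Z: "det Z = 1" "tr Z = 2" "f (pr (low 1)) = pr Z"
    using iso_char_torsion[OF f, of "low 1"] char_torsion_low by (auto simp flip: low_0)
  define W where "W = minv A ** Z ** A"
  have ZW: "Z = A ** W ** minv A" using A by (simp add: W_def matrix_mul_assoc[symmetric] minv_right)
  have dW: "det W = 1" using Z(1) A(1) by (simp add: ZW conj_det)
  have trW: "tr W = 2"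
  proof -
    have "tr (P ** Q) = tr (Q ** P)" for P Q :: "'a^2^2"
      by (cases P rule: mk_cases, cases Q rule: mk_cases) simp
    then have "tr W = tr (A ** (minv A ** Z))" by (metis W_def)
    then show ?thesis using A Z by simp
  qed
  obtain a b c d where W: "W = mk a b c d" by (rule mk_cases)
  \<comment> \<open>With \<open>c = 0\<close> the matrix \<open>W\<close> would be upper triangular
    unipotent and would commute with \<open>upp 1\<close>, although \<open>low 1\<close> and
    \<open>upp 1\<close> do not commute even up to sign.\<close>
  have c: "c \<noteq> 0"
  proof
    assume "c = 0"
    have d: "d = 2 - a" using trW by (simp add: W algebra_simps)
    have "(a - 1)\<^sup>2 = 0"
      using dW \<open>c = 0\<close> by (simp add: W d algebra_simps power2_eq_square)
    then have "W ** upp 1 = upp 1 ** W"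
      using \<open>c = 0\<close> by (auto simp: W d upp_def)
    then have "Z ** Y = Y ** Z"
      by (simp add: ZW A conj_mult[symmetric])
    then have "f (pr (low 1) \<otimes>\<^bsub>psl\<^esub> pr (upp 1)) = f (pr (upp 1) \<otimes>\<^bsub>psl\<^esub> pr (low 1))"
      using iso_mult[OF f, of "pr (low 1)" "pr (upp 1)"] iso_mult[OF f, of "pr (upp 1)" "pr (low 1)"]
      by (simp add: Y Z)
    then have "pr (low 1 ** upp 1) = pr (upp 1 ** low (1::'a))"
      by (subst (asm) iso_inj[OF f]) (auto simp: det_mul)
    moreover have "(1::'a) \<noteq> 2"
      by (metis add_cancel_right_right one_add_one zero_neq_one)
    \<comment> \<open>Agreement of the two products up to a minus sign would need both 2 = 0 and 3 =
      0.\<close>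
    moreover have "(2::'a) \<noteq> 0 \<or> (3::'a) \<noteq> 0"
      using add_0 numeral_3_eq_3 by (metis (no_types) add_0 numeral_plus_one one_add_one zero_neq_one semiring_norm(5))
    ultimately show False
      unfolding pr_eq_iff low_def upp_def mk_mult mk_uminus mk_eq_iff by simp
  qed
  \<comment> \<open>The vector \<open>(x, 1)\<close> is fixed by \<open>W\<close>. The matrix
    \<open>upp x\<close> takes the fixed vector \<open>(0, 1)\<close> of \<open>low c\<close> to it
    and commutes with \<open>upp 1\<close>.\<close>
  define x where "x = (1 - d) / c"
  have xc: "c * x = 1 - d" using c by (simp add: x_def)
  have a: "a = 2 - d" using trW by (simp add: W algebra_simps)
  have "a * d - b * c = 1" using dW by (simp add: W)
  then have "(1 - d) * (1 - d) + b * c = 0" by (simp add: a algebra_simps)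
  moreover have "c * ((1 - d) * x + b) = (1 - d) * (c * x) + b * c" by (simp add: algebra_simps)
  ultimately have "c * ((1 - d) * x + b) = 0" by (simp only: xc)
  then have "(1 - d) * x + b = 0" using c by simp
  then have "W ** upp x = upp x ** low c"
    using xc by (simp add: W upp_def low_def a algebra_simps)
  then have Wx: "W = upp x ** low c ** minv (upp x)"
    by (intro conj_eqI) auto
  have "Z = (A ** upp x) ** low c ** minv (A ** upp x)"
    by (simp add: ZW Wx conj_comp A(1))
  moreover have "Y = (A ** upp x) ** upp 1 ** minv (A ** upp x)"
  proof -
    have "upp 1 = upp x ** upp 1 ** minv (upp x)"
      by (intro conj_eqI) (auto simp: upp_add add.commute)
    then show ?thesis using A by (metis conj_comp det_upp one_neq_zero)
  qed
  ultimately show ?thesis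
    using Y Z A c by (intro exI[of _ "A ** upp x"] exI[of _ c]) (auto simp: det_mul)
qed

text \<open>\<open>low u\<close> on the left keeps the first row, while \<open>upp t\<close> on the
  right adds \<open>t\<close> times the first column to the second; comparing first rows kills the
  corner entry. So a product of this shape that carries \<open>upp t\<close> to \<open>low u\<close>
  is a genuine Weyl element.\<close>

lemma commute_sign_weyl:
  fixes a b t u :: "'a::field"
  defines "M \<equiv> upp a ** low b ** upp a"
  assumes "pr (M ** upp t) = pr (low u ** M)" "t \<noteq> 0"
  shows "1 + a * b = 0"
proof (rule ccontr)
  assume m: "1 + a * b \<noteq> 0"
  have "M ** upp t = low u ** M"
  proof (cases "M ** upp t = low u ** M")
    case False
    then have *: "M ** upp t = - (low u ** M)" using assms by (auto simp: pr_eq_iff)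
    then have "1 + a * b = - (1 + a * b)" by (simp add: M_def upp_def low_def)
    then show ?thesis using * minus_eq_self_matrix[OF _ m] by metis
  qed
  then have "(M ** upp t) $ 1 $ 2 = (low u ** M) $ 1 $ 2" by simp
  then have "(1 + a * b) * t = 0" by (simp add: M_def upp_def low_def algebra_simps)
  then show False using m \<open>t \<noteq> 0\<close> by simp
qed

text \<open>The Weyl element with upper right entry \<open>a\<close> conjugates \<open>upp t\<close>
  to \<open>low (- (t / (a * a)))\<close>. This is where squares of field elements enter.\<close>

lemma weyl_relation:
  fixes a b t u :: "'a::field"
  defines "M \<equiv> upp a ** low b ** upp a"
  assumes "pr (M ** upp t) = pr (low u ** M)" and ab: "1 + a * b = 0"
  shows "u * (a * a) = - t"
proof -
  have M: "M = mk 0 a b 0"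
    using ab by (simp add: M_def upp_def low_def mult.commute add.commute)
  have a: "a \<noteq> 0" using ab by auto
  have "M ** upp t = low u ** M"
  proof (cases "M ** upp t = low u ** M")
    case False
    then have *: "M ** upp t = - (low u ** M)" using assms by (auto simp: pr_eq_iff)
    then have "a = - a" by (simp add: M upp_def low_def)
    then show ?thesis using * minus_eq_self_matrix[OF _ a] by metis
  qed
  then have "u * a = b * t" by (simp add: M upp_def low_def)
  then have "u * (a * a) = (a * b) * t" by (simp add: algebra_simps)
  also have "a * b = - 1" using ab by (simp add: eq_neg_iff_add_eq_0 add.commute)
  finally show ?thesis by simp
qed

text \<open>A nonzero lower left entry describes the big Bruhat cell, on which the factorisation is
  explicit; an upper triangular matrix is moved into that cell by \<open>low 1\<close>.\<close>

lemma SL2_generation: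
  assumes "det M = 1"
  obtains (big) x y z where "M = upp x ** low y ** upp z"
  | (small) x y z where "M = low (- 1) ** (upp x ** low y ** upp z)"
proof -
  have *: "\<exists>x y z. N = upp x ** low y ** upp z" if "det N = 1" "N $ 2 $ 1 \<noteq> 0" for N :: "'a^2^2"
  proof -
    obtain a b c d where N: "N = mk a b c d" by (rule mk_cases)
    have c: "c \<noteq> 0" and ad: "a * d = 1 + b * c" using that by (auto simp: N algebra_simps)
    have "N = upp ((a - 1) / c) ** low c ** upp ((d - 1) / c)"
      using c ad by (simp add: N upp_def low_def field_simps)
    then show ?thesis by blast
  qed
  show ?thesis
  proof (cases "M $ 2 $ 1 = 0")
    case True
    obtain a b c d where M: "M = mk a b c d" by (rule mk_cases)
    have "(low 1 ** M) $ 2 $ 1 \<noteq> 0" using True assms by (auto simp: M low_def)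
    then obtain x y z where "low 1 ** M = upp x ** low y ** upp z"
      using *[of "low 1 ** M"] assms by (auto simp: det_mul)
    moreover have "low (- 1) ** (low 1 ** M) = M"
      by (simp add: matrix_mul_assoc low_add low_0)
    ultimately show ?thesis using small by metis
  qed (use * assms big in blast)
qed

text \<open>The centralizers of \<open>upp 1\<close> and \<open>low c\<close> provide maps
  \<open>f\<close> and \<open>h\<close> on the parameters of the two root subgroups, and Weyl
  elements tie \<open>h\<close> to \<open>f\<close>. The relations only give
  \<open>f (t * (a * a)) = f t * (f a * f a)\<close>; full multiplicativity follows because every
  element of a finite field is a square in characteristic 2 and a difference of two squares
  otherwise.\<close>

lemma iso_fixing_generators:
  fixes g :: "('a::{field,finite}^2^2) set \<Rightarrow> ('a^2^2) set"
  assumes g: "g \<in> iso psl psl" and g1: "g (pr (upp 1)) = pr (upp 1)"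
    and gl: "g (pr (low 1)) = pr (low c)" and c: "c \<noteq> 0"
  shows "\<exists>s. fld_hom s \<and> (\<forall>M. det M = 1 \<longrightarrow> g (pr M) = pr (mmap s M))"
proof -
  have gm: "g (pr (A ** B)) = pr (A' ** B')"
    if "det A = 1" "det B = 1" "g (pr A) = pr A'" "g (pr B) = pr B'" for A B A' B'
    using iso_mult[OF g, of "pr A" "pr B"] that by simp
  have "\<exists>r. g (pr (upp t)) = pr (upp r)" for t
  proof -
    obtain Y where Y: "det Y = 1" "g (pr (upp t)) = pr Y"
      using iso_closed[OF g, of "pr (upp t)"] by (auto elim: PSL2_cases)
    have "pr (Y ** upp 1) = g (pr (upp t ** upp 1))"
      by (rule gm[OF _ _ Y(2) g1, symmetric]) simp_all
    also have "upp t ** upp 1 = upp 1 ** upp t" by (simp add: upp_add add.commute)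
    also have "g (pr (upp 1 ** upp t)) = pr (upp 1 ** Y)"
      by (rule gm[OF _ _ g1 Y(2)]) simp_all
    finally show ?thesis using commute_upp[OF Y(1) one_neq_zero] Y(2) by metis
  qed
  then obtain f where f: "\<And>t. g (pr (upp t)) = pr (upp (f t))" by metis
  have "\<exists>r. g (pr (low t)) = pr (low r)" for t
  proof -
    obtain Y where Y: "det Y = 1" "g (pr (low t)) = pr Y"
      using iso_closed[OF g, of "pr (low t)"] by (auto elim: PSL2_cases)
    have "pr (Y ** low c) = g (pr (low t ** low 1))"
      by (rule gm[OF _ _ Y(2) gl, symmetric]) simp_all
    also have "low t ** low 1 = low 1 ** low t" by (simp add: low_add add.commute)
    also have "g (pr (low 1 ** low t)) = pr (low c ** Y)"
      by (rule gm[OF _ _ gl Y(2)]) simp_all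
    finally show ?thesis using commute_low[OF Y(1) c] Y(2) by metis
  qed
  then obtain h where h: "\<And>t. g (pr (low t)) = pr (low (h t))" by metis
  have add: "f (s + t) = f s + f t" for s t
    using gm[OF _ _ f f, of s t] by (simp add: upp_add f)
  have one: "f 1 = 1" using f[of 1] g1 by simp
  have rel: "h (- (t / (a * a))) * (f a * f a) = - f t" if a: "a \<noteq> 0" for a t
  proof -
    let ?M = "upp a ** low (- (1 / a)) ** upp a"
    let ?N = "upp (f a) ** low (h (- (1 / a))) ** upp (f a)"
    have dM: "det ?M = 1" by (simp add: det_mul)
    have M: "g (pr ?M) = pr ?N" by (intro gm f h) (simp_all add: det_mul)
    have r: "pr (?N ** upp (f t)) = pr (low (h (- (t / (a * a)))) ** ?N)" for t
    proof -
      \<comment> \<open>\<open>?M\<close> is the Weyl element attached to \<open>a\<close>. Its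
        image must exchange the root subgroups in the same way.\<close>
      have "?M ** upp t = low (- (t / (a * a))) ** ?M"
        using a by (simp add: upp_def low_def field_simps)
      then show ?thesis using gm[OF dM _ M f, of t] gm[OF _ dM h M, of "- (t / (a * a))"]
        by simp
    qed
    \<comment> \<open>The parameter \<open>t = 1\<close> is a legitimate test because
      \<open>f 1 = 1\<close> is nonzero.\<close>
    have "1 + f a * h (- (1 / a)) = 0"
      using commute_sign_weyl[OF r[of 1]] one by simp
    from weyl_relation[OF r this] show ?thesis .
  qed
  have hf: "h (- t) = - f t" for t using rel[of 1 t] one by simp
  have "f 0 = 0" by (metis add add_0 add_cancel_right_right)
  have sq: "f (t * (a * a)) = f t * (f a * f a)" for t a
  proof (cases "a = 0")
    case False
    then show ?thesis using rel[of a "t * (a * a)"] hf[of t] by simp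
  qed (simp add: \<open>f 0 = 0\<close>)
  have neg: "f (- t) = - f t" for t
    using add[of t "- t"] \<open>f 0 = 0\<close> by (simp add: eq_neg_iff_add_eq_0 add.commute)
  have mult: "f (t * b) = f t * f b" for t b
  proof (cases "(2::'a) = 0")
    case True
    have sum2: "x + x = 0" for x :: 'a using True by (metis mult_2 mult_zero_left)
    \<comment> \<open>In characteristic 2 squaring is injective, hence surjective on a finite
      field.\<close>
    have "inj (\<lambda>x::'a. x * x)"
    proof (rule injI)
      fix x y :: 'a assume "x * x = y * y"
      then have "(x + y) * (x + y) = 0"
        using True by (simp add: algebra_simps)
      then have "x + y = 0" by simp
      then show "x = y" using sum2[of y] by (metis add_right_cancel)
    qed
    then have "surj (\<lambda>x::'a. x * x)" by (simp add: finite_UNIV_inj_surj)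
    then obtain a where "b = a * a" by (metis surjD)
    then show ?thesis using sq[of t a] sq[of 1 a] one by simp
  next
    case False
    \<comment> \<open>These satisfy \<open>x + y = b\<close> and \<open>x - y = 1\<close>, which
      makes \<open>b\<close> the difference of their squares.\<close>
    define x y where "x = (b + 1) / 2" and "y = (b - 1) / 2"
    have "x + y = b" "x - y = 1"
      using False by (simp_all add: x_def y_def flip: add_divide_distrib diff_divide_distrib)
    moreover have "(x + y) * (x - y) = x * x + - (y * y)" by (simp add: algebra_simps)
    ultimately have b: "b = x * x + - (y * y)" by simp
    have fb: "f (t * b) = f t * (f x * f x) - f t * (f y * f y)" for t
    proof -
      have "t * b = t * (x * x) + - (t * (y * y))" by (simp add: b algebra_simps)
      then have "f (t * b) = f (t * (x * x)) + - f (t * (y * y))" by (simp only: add neg)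
      then show ?thesis by (simp add: sq)
    qed
    have "f b = f x * f x - f y * f y" using fb[of 1] one by simp
    then show ?thesis by (simp only: fb right_diff_distrib)
  qed
  have fh: "fld_hom f" by (simp add: fld_hom_def one add mult)
  have u: "g (pr (upp t)) = pr (mmap f (upp t))" for t
    using f one \<open>f 0 = 0\<close> by (simp add: upp_def)
  have l: "g (pr (low t)) = pr (mmap f (low t))" for t
    using h one \<open>f 0 = 0\<close> hf[of "- t"] neg[of t] by (simp add: low_def)
  have "g (pr M) = pr (mmap f M)" if "det M = 1" for M
    using that
  proof (cases M rule: SL2_generation)
    case (big x y z)
    then show ?thesis by (simp add: mmap_mult[OF fh]) (intro gm u l; simp add: det_mul)
  next
    case (small x y z)
    then show ?thesis by (simp add: mmap_mult[OF fh]) (intro gm u l; simp add: det_mul)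
  qed
  then show ?thesis using fh by blast
qed

text \<open>Acts on sign classes elementwise. For determinant 1 it is an inner automorphism of
  \<open>PSL2\<close>, for other determinants it need not be.\<close>

definition cj :: "'a::field^2^2 \<Rightarrow> ('a^2^2) set \<Rightarrow> ('a^2^2) set" where
  "cj A S = (\<lambda>M. A ** M ** minv A) ` S"

lemma cj_pr [simp]: "cj A (pr M) = pr (A ** M ** minv A)"
  by (simp add: cj_def pr_def minus_mult_left2 minus_mult_right2)

lemma cj_iso:
  assumes "det A \<noteq> 0" shows "cj A \<in> iso psl psl"
proof -
  have "cj A \<in> hom psl psl"
    by (rule homI; elim PSL2_cases) (auto simp: assms conj_det conj_mult)
  moreover have "bij_betw (cj A) (carrier psl) (carrier psl)"
  proof (rule bij_betw_byWitness[where f' = "cj (minv A)"])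
    have m: "minv A ** (A ** M ** minv A) ** minv (minv A) = M"
      "A ** (minv A ** M ** minv (minv A)) ** minv A = M" for M
      using assms by (simp_all add: minv_minv matrix_mul_assoc[symmetric] minv_left minv_right)
    show "\<forall>x\<in>carrier psl. cj (minv A) (cj A x) = x" "\<forall>x\<in>carrier psl. cj A (cj (minv A) x) = x"
      by (auto elim!: PSL2_cases simp: m)
    show "cj A ` carrier psl \<subseteq> carrier psl" "cj (minv A) ` carrier psl \<subseteq> carrier psl"
      using assms by (auto elim!: PSL2_cases intro!: pr_in simp: conj_det det_minv)
  qed
  ultimately show ?thesis by (simp add: iso_def)
qed

theorem PSL2_automorphism:
  fixes f :: "('a::{field,finite}^2^2) set \<Rightarrow> ('a^2^2) set"
  assumes f: "f \<in> iso psl psl"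
  shows "\<exists>A s. det A \<noteq> 0 \<and> fld_hom s \<and>
    (\<forall>M. det M = 1 \<longrightarrow> f (pr M) = pr (A ** mmap s M ** minv A))"
proof -
  obtain A c where A: "det A \<noteq> 0" and c: "c \<noteq> 0"
    and fu: "f (pr (upp 1)) = pr (A ** upp 1 ** minv A)"
    and fl: "f (pr (low 1)) = pr (A ** low c ** minv A)"
    using iso_standard_generators[OF f] by blast
  have dA: "det (minv A) \<noteq> 0" using A by (simp add: det_minv)
  have undo: "cj (minv A) (pr (A ** M ** minv A)) = pr M" for M
    using A by (simp add: minv_minv matrix_mul_assoc[symmetric] minv_left)
  let ?g = "cj (minv A) \<circ> f"
  have g: "?g \<in> iso psl psl"
    using iso_set_trans[OF f cj_iso[OF dA]] .
  have "?g (pr (upp 1)) = pr (upp 1)" "?g (pr (low 1)) = pr (low c)"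
    by (simp_all only: o_apply fu fl undo)
  from iso_fixing_generators[OF g this c] obtain s
    where s: "fld_hom s" "\<And>M. det M = 1 \<Longrightarrow> ?g (pr M) = pr (mmap s M)" by blast
  have "f (pr M) = pr (A ** mmap s M ** minv A)" if M: "det M = 1" for M
  proof -
    obtain Y where Y: "f (pr M) = pr Y"
      using iso_closed[OF f pr_in[OF M]] by (auto elim: PSL2_cases)
    have "pr (minv A ** Y ** A) = pr (mmap s M)"
      using s(2)[OF M] A by (simp add: Y minv_minv)
    then have "cj A (pr (minv A ** Y ** A)) = cj A (pr (mmap s M))" by simp
    then show ?thesis using A by (simp add: Y matrix_mul_assoc[symmetric] minv_right)
  qed
  then show ?thesis using A s(1) by blast
qed

section \<open>Automorphisms of order three and Hilbert 90\<close>

definition cubic_hom :: "('a::field \<Rightarrow> 'a) \<Rightarrow> bool" where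
  "cubic_hom s \<longleftrightarrow> fld_hom s \<and> (\<forall>x. s (s (s x)) = x) \<and> (\<exists>x. s x \<noteq> x)"

lemma tr_mult_commute: "tr (A ** B) = tr (B ** (A :: 'a::comm_ring_1^2^2))"
  by (cases A rule: mk_cases, cases B rule: mk_cases) (simp add: mult.commute)

lemma tr_conj: "det A \<noteq> 0 \<Longrightarrow> tr (A ** M ** minv A) = tr M"
  by (subst tr_mult_commute) (simp add: matrix_mul_assoc minv_left)

lemma mmap_minv: "fld_hom s \<Longrightarrow> det A \<noteq> 0 \<Longrightarrow> mmap s (minv A) = minv (mmap s A)"
  by (rule minv_unique[symmetric]) (simp add: mmap_mult[symmetric] minv_right mat_mk fld_hom_simps)

lemma mmap_mat: "fld_hom s \<Longrightarrow> mmap s (mat k) = mat (s k)"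
  by (simp add: mat_mk fld_hom_simps)

lemma mmap_add: "fld_hom s \<Longrightarrow> mmap s (A + B) = mmap s A + mmap s B"
  by (cases A rule: mk_cases, cases B rule: mk_cases) (simp add: fld_hom_simps)

lemma mmap_scal: "fld_hom s \<Longrightarrow> mmap s (scal k A) = scal (s k) (mmap s A)"
  by (cases A rule: mk_cases) (simp add: fld_hom_simps)

lemma tr_mmap: "fld_hom s \<Longrightarrow> tr (mmap s A) = s (tr A)"
  by (cases A rule: mk_cases) (simp add: fld_hom_simps)

text \<open>Trace 2 singles out one representative of a class: if both signs have trace 2, the
  characteristic is 2 and they coincide.\<close>

lemma pr_eq_tr2:
  assumes "pr M = pr N" "tr M = 2" "tr N = (2 :: 'a::field)"
  shows "M = N"
proof (rule ccontr)
  assume ne: "M \<noteq> N"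
  then have MN: "M = - N" using assms by (simp add: pr_eq_iff)
  then have 2: "(2::'a) = - 2" using assms tr_uminus by metis
  have "- N = N"
  proof (cases "(2::'a) = 0")
    case True
    then have "(1::'a) = - 1" by (metis add_eq_0_iff one_add_one)
    then show ?thesis using minus_eq_self_matrix zero_neq_one by metis
  qed (rule minus_eq_self_matrix[OF 2])
  then show False using ne MN by simp
qed

lemma tr_upp [simp]: "tr (upp t) = 2" and tr_low [simp]: "tr (low t) = 2"
  by (simp_all add: upp_def low_def)

lemma mmap_upp: "fld_hom s \<Longrightarrow> mmap s (upp t) = upp (s t)"
  and mmap_low: "fld_hom s \<Longrightarrow> mmap s (low t) = low (s t)"
  by (simp_all add: upp_def low_def fld_hom_simps)

text \<open>On \<open>upp t\<close> and \<open>low t\<close> the trace fixes the sign, so the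
  relation holds for matrices. The parameter 1 makes \<open>D\<close> scalar, and the remaining
  parameters then show that \<open>s\<close> is the identity.\<close>

lemma semilinear_conj_trivial:
  assumes D: "det D \<noteq> 0" and s: "fld_hom s"
    and triv: "\<And>M. det M = 1 \<Longrightarrow> pr (D ** mmap s M ** minv D) = pr M"
  shows "s x = x \<and> (\<exists>k. D = mat k)"
proof -
  have conj: "D ** mmap s M ** minv D = M \<longleftrightarrow> D ** mmap s M = M ** D" for M
  proof
    assume "D ** mmap s M ** minv D = M"
    then have "(D ** mmap s M ** minv D) ** D = M ** D" by simp
    then show "D ** mmap s M = M ** D" using D by (simp add: matrix_mul_assoc[symmetric] minv_left)
  qed (use conj_eqI[OF D, of M "mmap s M"] in simp)
  have "D ** mmap s (upp t) ** minv D = upp t" "D ** mmap s (low t) ** minv D = low t" for t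
    by (rule pr_eq_tr2[OF triv]; simp add: tr_conj[OF D] mmap_upp[OF s] mmap_low[OF s])+
  then have u: "D ** upp (s t) = upp t ** D" and l: "D ** low (s t) = low t ** D" for t
    by (simp_all add: conj mmap_upp[OF s, symmetric] mmap_low[OF s, symmetric])
  obtain a b c d where Dmk: "D = mk a b c d" by (rule mk_cases)
  have *: "c = 0" "b = 0" "a = d"
    using u[of 1] l[of 1] s by (auto simp: Dmk upp_def low_def fld_hom_simps)
  then have "a \<noteq> 0" using D by (auto simp: Dmk)
  moreover have "a * s x = x * d" using u[of x] by (auto simp: Dmk upp_def *)
  ultimately show ?thesis using * by (auto simp: Dmk mat_mk)
qed

lemma scal_cancel:
  assumes "k \<noteq> 0" "det A \<noteq> 0"
  shows "scal k A ** M ** minv (scal k A) = A ** M ** minv (A :: 'a::field^2^2)"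
proof -
  have "det (scal k A) = k * k * det A" by (cases A rule: mk_cases) (simp add: algebra_simps)
  then have "det (scal k A) \<noteq> 0" using assms by simp
  moreover have "(A ** M ** minv A) ** scal k A = scal k A ** M"
    using assms by (simp add: scal_mult_right scal_mult_left matrix_mul_assoc[symmetric] minv_left)
  ultimately show ?thesis by (intro conj_eqI[symmetric])
qed

text \<open>The cube of \<open>f\<close> is semilinear with matrix
  \<open>A ** mmap s A ** mmap s (mmap s A)\<close> and field map \<open>s\<close> applied three
  times, so triviality of the cube makes the matrix scalar and \<open>s\<close> of order dividing 3.
  If \<open>s\<close> were trivial, a scalar multiple of \<open>A\<close> would have determinant 1
  and \<open>f\<close> would be inner.\<close>

lemma order3_automorphism:
  fixes f :: "('a::{field,finite}^2^2) set \<Rightarrow> ('a^2^2) set"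
  assumes f: "f \<in> iso psl psl" and f3: "\<And>x. x \<in> carrier psl \<Longrightarrow> f (f (f x)) = x"
    and outer: "\<And>A. det A = 1 \<Longrightarrow> \<exists>x\<in>carrier psl. f x \<noteq> cj A x"
  obtains A s k where "det A \<noteq> 0" "cubic_hom s" "A ** mmap s A ** mmap s (mmap s A) = mat k"
    "\<And>M. det M = 1 \<Longrightarrow> f (pr M) = pr (A ** mmap s M ** minv A)"
proof -
  obtain A s where A: "det A \<noteq> 0" and s: "fld_hom s"
    and fA: "\<And>M. det M = 1 \<Longrightarrow> f (pr M) = pr (A ** mmap s M ** minv A)"
    using PSL2_automorphism[OF f] by blast
  let ?D = "A ** mmap s A ** mmap s (mmap s A)"
  let ?t = "\<lambda>x. s (s (s x))"
  have nz: "det (mmap s M) \<noteq> 0" if "det M \<noteq> 0" for M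
    using that s by (simp add: det_mmap fld_hom_eq_0)
  have D: "det ?D \<noteq> 0" using A by (simp add: det_mul nz)
  have t: "fld_hom ?t" using s by (simp add: fld_hom_def)
  have mt: "mmap ?t M = mmap s (mmap s (mmap s M))" for M by (cases M rule: mk_cases) simp
  have "pr (?D ** mmap ?t M ** minv ?D) = pr M" if M: "det M = 1" for M
  proof -
    have d1: "det (A ** mmap s M ** minv A) = 1" if "det M = 1" for M
      using that A s by (simp add: conj_det det_mmap fld_hom_simps)
    have "f (f (f (pr M))) = pr (A ** mmap s (A ** mmap s (A ** mmap s M ** minv A) ** minv A) ** minv A)"
      using M d1 by (simp add: fA)
    also have "\<dots> = pr (?D ** mmap ?t M ** minv ?D)"
      using A s by (simp add: mmap_mult mmap_minv mt minv_mult nz det_mul matrix_mul_assoc)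
    finally show ?thesis using f3 M by simp
  qed
  from semilinear_conj_trivial[OF D t this] obtain k where s3: "\<And>x. s (s (s x)) = x" and k: "?D = mat k"
    by blast
  have "\<exists>x. s x \<noteq> x"
  proof (rule ccontr)
    assume "\<not> (\<exists>x. s x \<noteq> x)"
    then have id: "mmap s M = M" for M by (cases M rule: mk_cases) simp
    have "det ?D = k * k" by (simp add: k mat_mk)
    then have dA: "det A * (det A * det A) = k * k" by (simp add: id det_mul mult.assoc)
    \<comment> \<open>Here \<open>A\<close> cubed is the scalar \<open>k\<close>, so the cube of
      \<open>det A\<close> is the square of \<open>k\<close>, and
      \<open>l * l * det A = 1\<close>.\<close>
    define l where "l = det A / k"
    have "k \<noteq> 0" using dA A by auto
    then have l: "l * l * det A = 1" "l \<noteq> 0" using dA A by (auto simp: l_def field_simps)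
    have "det (scal l A) = 1" using l(1) by (cases A rule: mk_cases) (simp add: algebra_simps)
    moreover have "f x = cj (scal l A) x" if "x \<in> carrier psl" for x
      using that A l by (auto elim!: PSL2_cases simp: fA id scal_cancel)
    ultimately show False using outer by blast
  qed
  then show ?thesis using that[OF A _ k fA] s s3 by (simp add: cubic_hom_def)
qed

section \<open>Independence of conjugates and descent\<close>

lemma cubic_distinct:
  assumes "cubic_hom s" "s x \<noteq> x"
  shows "s (s x) \<noteq> x" "s (s x) \<noteq> s x"
  using assms unfolding cubic_hom_def by metis+

lemma vandermonde3:
  fixes x y z :: "'a::field"
  assumes "x \<noteq> y" "x \<noteq> z" and "p + q + r = 0" "x * p + y * q + z * r = 0"
    "x * x * p + y * y * q + z * z * r = 0"
  shows "p = 0"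
proof -
  \<comment> \<open>The coefficients are those of the polynomial \<open>(T - y) * (T - z)\<close>,
    which vanishes at the other two nodes.\<close>
  have "(x - y) * (x - z) * p = (x * x * p + y * y * q + z * z * r)
      - (y + z) * (x * p + y * q + z * r) + y * z * (p + q + r)"
    by (simp add: algebra_simps)
  then show ?thesis using assms by simp
qed

text \<open>Dedekind independence of the three powers of \<open>s\<close>: testing on
  \<open>1\<close>, \<open>x\<close> and \<open>x * x\<close> for a moved element \<open>x\<close>
  gives a Vandermonde system in its three distinct conjugates.\<close>

lemma cubic_independence:
  assumes s: "cubic_hom s" and "\<And>c. c * p + s c * q + s (s c) * r = 0"
  shows "p = (0::'a::field)"
proof -
  obtain x where x: "s x \<noteq> x" using s by (auto simp: cubic_hom_def)
  have "fld_hom s" using s by (simp add: cubic_hom_def)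
  then show ?thesis
    using vandermonde3[of x "s x" "s (s x)" p q r] assms(2)[of 1] assms(2)[of x] assms(2)[of "x * x"]
      x cubic_distinct[OF s x] by (simp add: fld_hom_simps)
qed

text \<open>Averaging over the group generated by \<open>s\<close>, twisted by the cocycle of
  \<open>A\<close>, sends every \<open>C\<close> to a solution \<open>T C\<close> of the equation.
  The work lies in finding a \<open>C\<close> for which \<open>T C\<close> is invertible.\<close>

lemma hilbert90_normalized:
  fixes A :: "'a::field^2^2"
  assumes s: "cubic_hom s" and A3: "A ** mmap s A ** mmap s (mmap s A) = mat 1"
  shows "\<exists>B. det B \<noteq> 0 \<and> A ** mmap s B = B"
proof -
  have fs: "fld_hom s" and s3: "\<And>x. s (s (s x)) = x" using s by (auto simp: cubic_hom_def)
  have m3: "mmap s (mmap s (mmap s M)) = M" for M by (cases M rule: mk_cases) (simp add: s3)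
  let ?Q = "A ** mmap s A"
  define T where "T C = C + A ** mmap s C + ?Q ** mmap s (mmap s C)" for C
  have "A ** mmap s (T C) = A ** mmap s C + ?Q ** mmap s (mmap s C)
      + (A ** mmap s A ** mmap s (mmap s A)) ** C" for C
    by (simp add: T_def mmap_add[OF fs] mmap_mult[OF fs] m3 matrix_add_ldistrib matrix_mul_assoc)
  then have TC: "A ** mmap s (T C) = T C" for C
    by (simp only: A3 mat_mult_1) (simp add: T_def add_ac)
  obtain p q r t where A: "A = mk p q r t" by (rule mk_cases)
  obtain p' q' r' t' where Q: "?Q = mk p' q' r' t'" by (rule mk_cases)
  define u where "u x y = x + p * s x + q * s y + p' * s (s x) + q' * s (s y)" for x y
  define v where "v x y = y + r * s x + t * s y + r' * s (s x) + t' * s (s y)" for x y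
  \<comment> \<open>\<open>T\<close> acts on each column separately, through the pair
    \<open>u\<close>, \<open>v\<close>, so the columns of \<open>C\<close> can be chosen one after
    the other.\<close>
  have Tmk: "T (mk a b c d) = mk (u a c) (u b d) (v a c) (v b d)" for a b c d
    unfolding T_def Q by (simp add: A u_def v_def add_ac)
  have s0: "s 0 = 0" using fs by (simp add: fld_hom_simps)
  have "\<exists>a c. u a c \<noteq> 0 \<or> v a c \<noteq> 0"
  proof (rule ccontr)
    assume "\<not> ?thesis"
    then have "u c 0 = 0" for c by blast
    then have "c * 1 + s c * p + s (s c) * p' = 0" for c
      by (simp add: u_def s0 mult.commute)
    then show False using cubic_independence[OF s] zero_neq_one by metis
  qed
  then obtain a c where ac: "u a c \<noteq> 0 \<or> v a c \<noteq> 0" by blast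
  \<comment> \<open>Otherwise all images of columns lie on the line of the first one, so a linear
    form vanishes on all of them. Independence then annihilates its untwisted coefficients,
    \<open>- v a c\<close> and \<open>u a c\<close>.\<close>
  have "\<exists>b d. u a c * v b d - v a c * u b d \<noteq> 0"
  proof (rule ccontr)
    assume "\<not> ?thesis"
    then have *: "u a c * v b d - v a c * u b d = 0" for b d by blast
    have "x * (- v a c) + s x * (u a c * r - v a c * p) + s (s x) * (u a c * r' - v a c * p') = 0" for x
      using *[of x 0] by (simp add: u_def[of x] v_def[of x] s0 algebra_simps)
    then have "- v a c = 0" by (rule cubic_independence[OF s])
    moreover have "x * u a c + s x * (u a c * t - v a c * q) + s (s x) * (u a c * t' - v a c * q') = 0" for x
      using *[of 0 x] by (simp add: u_def[of 0] v_def[of 0] s0 algebra_simps)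
    then have "u a c = 0" by (rule cubic_independence[OF s])
    ultimately show False using ac by simp
  qed
  then obtain b d where "u a c * v b d - v a c * u b d \<noteq> 0" by blast
  then have "det (T (mk a b c d)) \<noteq> 0" by (simp add: Tmk mult.commute)
  then show ?thesis using TC by blast
qed

lemma matrix_add_rdistrib2:
  fixes A B M :: "'a::semiring_1^2^2"
  shows "(A + B) ** M = A ** M + B ** M"
  by (cases A rule: mk_cases, cases B rule: mk_cases, cases M rule: mk_cases)
     (simp add: algebra_simps)

text \<open>The entrywise field automorphism written in the basis \<open>B\<close>. It is a
  semilinear ring automorphism of the full matrix ring and serves as the lift of the given
  automorphism of \<open>PSL2\<close>.\<close>

definition twist :: "'a::field^2^2 \<Rightarrow> ('a \<Rightarrow> 'a) \<Rightarrow> 'a^2^2 \<Rightarrow> 'a^2^2" where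
  "twist B s M = B ** mmap s (minv B ** M ** B) ** minv B"

lemma det_scal: "det (scal k A) = k * k * det (A :: 'a::comm_ring_1^2^2)"
  by (cases A rule: mk_cases) (simp add: algebra_simps)

lemma scal_scal: "scal k (scal l A) = scal (k * l) (A :: 'a::comm_ring_1^2^2)"
  by (cases A rule: mk_cases) (simp add: algebra_simps)

text \<open>The cocycle condition holds only up to the scalar \<open>k\<close>. Degree 3 and
  dimension 2 being coprime, \<open>k\<close> is a norm: \<open>k\<close> is fixed by
  \<open>s\<close> and \<open>det A\<close> has norm \<open>k * k\<close>, so \<open>k\<close> is
  the norm of \<open>k / det A\<close>. Rescaling \<open>A\<close> by the inverse of that element
  makes the condition exact.\<close>

lemma hilbert90_twist:
  fixes A :: "'a::field^2^2"
  assumes s: "cubic_hom s" and A: "det A \<noteq> 0"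
    and A3: "A ** mmap s A ** mmap s (mmap s A) = mat k"
  obtains B where "det B \<noteq> 0" "\<And>M. A ** mmap s M ** minv A = twist B s M"
proof -
  have fs: "fld_hom s" and s3: "\<And>x. s (s (s x)) = x" using s by (auto simp: cubic_hom_def)
  have m3: "mmap s (mmap s (mmap s M)) = M" for M by (cases M rule: mk_cases) (simp add: s3)
  \<comment> \<open>Applying \<open>s\<close> rotates the three factors cyclically. With the product
    equal to \<open>mat k\<close> this compares \<open>s k\<close> with \<open>k\<close>.\<close>
  have "A ** mmap s (A ** mmap s A ** mmap s (mmap s A)) = (A ** mmap s A ** mmap s (mmap s A)) ** A"
    by (simp add: mmap_mult[OF fs] m3 matrix_mul_assoc)
  then have sk: "s k = k"
    unfolding A3 mmap_mat[OF fs] using A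
    by (cases A rule: mk_cases) (auto simp: mat_mk mult.commute[of _ "s k"])
  have dk: "det A * s (det A) * s (s (det A)) = k * k"
    using arg_cong[OF A3, of det] by (simp add: det_mul det_mmap[OF fs]) (simp add: mat_mk)
  have k: "k \<noteq> 0" using dk A fs by (auto simp: fld_hom_eq_0)
  define l where "l = det A / k"
  have l0: "l \<noteq> 0" using A k by (simp add: l_def)
  have "l * s l * s (s l) * k = 1"
    using dk k by (simp add: l_def fld_hom_simps[OF fs] sk field_simps)
  then have "scal l A ** mmap s (scal l A) ** mmap s (mmap s (scal l A)) = mat 1"
    by (simp add: mmap_scal[OF fs] scal_mult_left scal_mult_right scal_scal A3 scal_mat mult_ac)
  from hilbert90_normalized[OF s this] obtain B
    where B: "det B \<noteq> 0" and AB: "scal l A ** mmap s B = B" by blast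
  have sB: "det (mmap s B) \<noteq> 0" using B fs by (simp add: det_mmap fld_hom_eq_0)
  have "scal l A = B ** minv (mmap s B)"
    using AB sB by (metis mat_mult_1(2) matrix_mul_assoc minv_right)
  moreover have "det (minv (mmap s B)) \<noteq> 0" using sB by (simp add: det_minv)
  ultimately have "scal l A ** mmap s M ** minv (scal l A) = twist B s M" for M
    using B sB by (simp add: twist_def mmap_mult[OF fs] mmap_minv[OF fs] minv_mult minv_minv matrix_mul_assoc)
  then show ?thesis using that B scal_cancel[OF l0 A] by metis
qed

lemma
  assumes B: "det B \<noteq> 0" and fs: "fld_hom s"
  shows twist_mult: "twist B s (M ** N) = twist B s M ** twist B s N"
    and det_twist: "det (twist B s M) = s (det M)"
    and tr_twist: "tr (twist B s M) = s (tr M)"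
    and twist_scal: "twist B s (scal k M) = scal (s k) (twist B s M)"
    and twist_add: "twist B s (M + N) = twist B s M + twist B s N"
    and twist_mat: "twist B s (mat k) = mat (s k)"
    and twist_twist: "twist B s (twist B s M) = twist B (\<lambda>x. s (s x)) M"
proof -
  have mat_scal: "mat k = scal k (mat 1 :: 'a^2^2)" for k :: 'a by (simp add: mat_mk)
  have "minv B ** (M ** N) ** B = (minv B ** M ** B) ** (minv B ** N ** B)"
    using B by (simp add: matrix_mul_assoc[symmetric])
  then show "twist B s (M ** N) = twist B s M ** twist B s N"
    using B by (simp add: twist_def mmap_mult[OF fs] conj_mult)
  have "det (minv B ** M ** B) = det M" using B by (simp add: det_mul det_minv)
  then show "det (twist B s M) = s (det M)" using B by (simp add: twist_def conj_det det_mmap[OF fs])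
  have "tr (minv B ** M ** B) = tr M"
    using B by (subst tr_mult_commute) (simp add: matrix_mul_assoc minv_right)
  then show "tr (twist B s M) = s (tr M)" using B by (simp add: twist_def tr_conj tr_mmap[OF fs])
  show sc: "twist B s (scal k M) = scal (s k) (twist B s M)" for k M
    by (simp add: twist_def scal_mult_left scal_mult_right mmap_scal[OF fs])
  show "twist B s (M + N) = twist B s M + twist B s N"
    by (simp add: twist_def matrix_add_ldistrib matrix_add_rdistrib2 mmap_add[OF fs])
  have "twist B s (mat 1) = mat 1"
    using B by (simp add: twist_def minv_left minv_right mmap_mat[OF fs] fld_hom_simps[OF fs])
  then show "twist B s (mat k) = mat (s k)" by (subst (1 2) mat_scal) (simp add: sc)
  have mm: "mmap s (mmap s N) = mmap (\<lambda>x. s (s x)) N" for N by (cases N rule: mk_cases) simp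
  have "minv B ** (B ** N ** minv B) ** B = N" for N
    using B by (simp add: matrix_mul_assoc[symmetric] minv_left)
  then show "twist B s (twist B s M) = twist B (\<lambda>x. s (s x)) M"
    by (simp add: twist_def mm)
qed

lemma twist_id: "det B \<noteq> 0 \<Longrightarrow> twist B (\<lambda>x. x) M = M"
proof -
  assume B: "det B \<noteq> 0"
  have "mmap (\<lambda>x. x) N = N" for N :: "'a^2^2" by (cases N rule: mk_cases) simp
  then show ?thesis using B by (simp add: twist_def matrix_mul_assoc[symmetric] minv_right)
qed

lemma twist3:
  assumes "det B \<noteq> 0" "cubic_hom s"
  shows "twist B s (twist B s (twist B s M)) = M"
proof -
  have fs: "fld_hom s" and s3: "\<And>x. s (s (s x)) = x" using assms by (auto simp: cubic_hom_def)
  have "twist B s (twist B s (twist B s M)) = twist B (\<lambda>x. s (s x)) (twist B s M)"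
    by (rule twist_twist[OF assms(1) fs])
  also have "\<dots> = twist B (\<lambda>x. s (s (s x))) M"
  proof -
    have mm: "mmap (\<lambda>x. s (s x)) (mmap s N) = mmap (\<lambda>x. s (s (s x))) N" for N :: "'a^2^2"
      by (cases N rule: mk_cases) simp
    have "minv B ** (B ** N ** minv B) ** B = N" for N
      using assms(1) by (simp add: matrix_mul_assoc[symmetric] minv_left)
    then show ?thesis by (simp add: twist_def mm)
  qed
  finally show ?thesis using assms(1) by (simp add: s3 twist_id)
qed

section \<open>Counting fixed points\<close>

text \<open>The degree is 3, shown by two injections between the field and triples of fixed
  elements: a triple is sent to a polynomial of degree at most 2 in a moved element
  \<open>x\<close>, and \<open>w\<close> to the traces of \<open>w\<close>, \<open>x * w\<close> and
  \<open>x * x * w\<close>.\<close>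

lemma card_fixed_field:
  fixes s :: "'a::{field,finite} \<Rightarrow> 'a"
  assumes s: "cubic_hom s"
  shows "card {x. s x = x} ^ 3 = CARD('a)"
proof -
  have fs: "fld_hom s" and s3: "\<And>x. s (s (s x)) = x" using s by (auto simp: cubic_hom_def)
  obtain x where x: "s x \<noteq> x" using s by (auto simp: cubic_hom_def)
  let ?F = "{x. s x = x}"
  define y z where "y = s x" and "z = s (s x)"
  have d: "x \<noteq> y" "x \<noteq> z" "y \<noteq> z" using x cubic_distinct[OF s x] by (auto simp: y_def z_def)
  have sy: "s x = y" "s y = z" "s z = x" by (auto simp: y_def z_def s3)
  let ?P = "\<lambda>(a, b, c). a + b * x + c * (x * x)"
  have "inj_on ?P (?F \<times> ?F \<times> ?F)"
  proof (rule inj_onI, clarsimp)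
    fix a b c a' b' c'
    assume F: "s a = a" "s b = b" "s c = c" "s a' = a'" "s b' = b'" "s c' = c'"
      and e: "a + b * x + c * (x * x) = a' + b' * x + c' * (x * x)"
    have e1: "a + b * y + c * (y * y) = a' + b' * y + c' * (y * y)"
      using arg_cong[OF e, of s] by (simp add: fld_hom_simps[OF fs] F sy)
    have e2: "a + b * z + c * (z * z) = a' + b' * z + c' * (z * z)"
      using arg_cong[OF e1, of s] by (simp add: fld_hom_simps[OF fs] F sy)
    \<comment> \<open>Divided differences of the equations at \<open>x\<close>, \<open>y\<close> and
      \<open>z\<close> isolate the leading coefficient.\<close>
    have "(x - y) * ((b - b') + (c - c') * (x + y)) =
        (a + b * x + c * (x * x)) - (a' + b' * x + c' * (x * x))
        - ((a + b * y + c * (y * y)) - (a' + b' * y + c' * (y * y)))"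
      by (simp add: algebra_simps)
    then have 1: "(b - b') + (c - c') * (x + y) = 0" using e e1 d by simp
    have "(y - z) * ((b - b') + (c - c') * (y + z)) =
        (a + b * y + c * (y * y)) - (a' + b' * y + c' * (y * y))
        - ((a + b * z + c * (z * z)) - (a' + b' * z + c' * (z * z)))"
      by (simp add: algebra_simps)
    then have 2: "(b - b') + (c - c') * (y + z) = 0" using e1 e2 d by simp
    have "(c - c') * (x - z) = ((b - b') + (c - c') * (x + y)) - ((b - b') + (c - c') * (y + z))"
      by (simp add: algebra_simps)
    then have "c = c'" using 1 2 d by simp
    then show "a = a' \<and> b = b' \<and> c = c'" using 1 e by simp
  qed
  then have "card (?F \<times> ?F \<times> ?F) \<le> CARD('a)"
    by (rule card_inj_on_le) auto
  moreover
  let ?T = "\<lambda>y. y + s y + s (s y)"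
  have "inj (\<lambda>w. (?T w, ?T (x * w), ?T (x * x * w)))"
  proof (rule injI, clarsimp)
    fix w w'
    assume e: "?T w = ?T w'" "?T (x * w) = ?T (x * w')" "?T (x * x * w) = ?T (x * x * w')"
    have T: "?T (k * w) - ?T (k * w') = k * (w - w') + s k * (s w - s w') + s (s k) * (s (s w) - s (s w'))" for k
      by (simp add: fld_hom_simps[OF fs] algebra_simps)
    have "w - w' = 0"
      using vandermonde3[OF d(1,2), of "w - w'" "s w - s w'" "s (s w) - s (s w')"]
        T[of 1] T[of x] T[of "x * x"] e
      by (simp add: fld_hom_simps[OF fs] sy)
    then show "w = w'" by simp
  qed
  moreover have "s (?T w) = ?T w" for w
    by (simp add: fld_hom_simps[OF fs] s3 add_ac)
  ultimately have "CARD('a) \<le> card (?F \<times> ?F \<times> ?F)"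
    by (intro card_inj_on_le[of "\<lambda>w. (?T w, ?T (x * w), ?T (x * x * w))"]) auto
  with \<open>card (?F \<times> ?F \<times> ?F) \<le> CARD('a)\<close> show ?thesis
    by (simp add: card_cartesian_product power3_eq_cube mult.assoc)
qed

text \<open>For \<open>F\<close> the fixed field this is the special linear group over
  \<open>F\<close>, kept inside the matrices over the large field because \<open>F\<close> is a set
  and not a type.\<close>

definition slf :: "'a::field set \<Rightarrow> ('a^2^2) set" where
  "slf F = {A. det A = 1 \<and> (\<forall>i j. A $ i $ j \<in> F)}"

lemma mk_slf: "mk a b c d \<in> slf F \<longleftrightarrow> a * d - b * c = 1 \<and> a \<in> F \<and> b \<in> F \<and> c \<in> F \<and> d \<in> F"
  by (auto simp: slf_def forall_2)

text \<open>The two summands count the matrices with nonzero and with zero upper left entry: in the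
  first case the lower right entry is determined by the rest, in the second
  \<open>c = - inverse b\<close> and \<open>d\<close> is free.\<close>

lemma card_slf:
  fixes F :: "'a::{field,finite} set"
  assumes F: "0 \<in> F" "1 \<in> F" "\<And>x y. x \<in> F \<Longrightarrow> y \<in> F \<Longrightarrow> x + y \<in> F"
    "\<And>x y. x \<in> F \<Longrightarrow> y \<in> F \<Longrightarrow> x * y \<in> F" "\<And>x. x \<in> F \<Longrightarrow> - x \<in> F"
    "\<And>x. x \<in> F \<Longrightarrow> inverse x \<in> F"
  shows "card (slf F) = (card F - 1) * card F * card F + (card F - 1) * card F"
proof -
  let ?f = "\<lambda>(a, b, c). mk a b c ((1 + b * c) * inverse a)"
  let ?g = "\<lambda>(b, d). mk 0 b (- inverse b) d"
  let ?A = "(F - {0}) \<times> F \<times> F" and ?B = "(F - {0}) \<times> F"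
  have "slf F = ?f ` ?A \<union> ?g ` ?B"
  proof (intro equalityI subsetI)
    fix M assume "M \<in> slf F"
    moreover obtain a b c d where M: "M = mk a b c d" by (rule mk_cases)
    ultimately have *: "a * d - b * c = 1" "a \<in> F" "b \<in> F" "c \<in> F" "d \<in> F" by (auto simp: mk_slf)
    show "M \<in> ?f ` ?A \<union> ?g ` ?B"
    proof (cases "a = 0")
      case True
      then have bc: "b * (- c) = 1" using * by simp
      then have "b \<noteq> 0" "- c = inverse b" using inverse_unique[OF bc] by auto
      then have "c = - inverse b" by (metis minus_minus)
      then have "M = ?g (b, d)" using True by (simp add: M)
      then show ?thesis using * \<open>b \<noteq> 0\<close> by blast
    next
      case False
      then have "a * d = 1 + b * c" using *(1) by (simp add: algebra_simps)
      then have "d = (1 + b * c) * inverse a" using False by (metis mult.commute mult.left_commute right_inverse mult.right_neutral)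
      then have "M = ?f (a, b, c)" by (simp add: M)
      then show ?thesis using * False by blast
    qed
  next
    fix M
    have 1: "a * (k * inverse a) = (if a = 0 then 0 else k)" for a k :: 'a
      by (simp add: mult.left_commute)
    have 2: "a * inverse a = (if a = 0 then 0 else 1)" for a :: 'a by simp
    assume "M \<in> ?f ` ?A \<union> ?g ` ?B"
    then show "M \<in> slf F" by (auto simp: mk_slf F 1 2 split: if_splits)
  qed
  moreover have "card (?f ` ?A \<union> ?g ` ?B) = card (?f ` ?A) + card (?g ` ?B)"
    by (rule card_Un_disjoint) auto
  moreover have "card (?f ` ?A) = card ?A" by (rule card_image) (auto simp: inj_on_def)
  moreover have "card (?g ` ?B) = card ?B" by (rule card_image) (auto simp: inj_on_def)
  moreover have "card (F - {0}) = card F - 1" using F(1) by simp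
  ultimately show ?thesis by (simp add: card_cartesian_product mult.assoc)
qed

lemma card_pr_image:
  fixes S :: "('a::{field,finite}^2^2) set"
  assumes S: "\<And>M. M \<in> S \<Longrightarrow> - M \<in> S" "\<And>M. M \<in> S \<Longrightarrow> det M = 1"
  shows "card (pr ` S) * (if (2::'a) = 0 then 1 else 2) = card S"
proof (cases "(2::'a) = 0")
  case True
  then have "(1::'a) = - 1" by (metis add_eq_0_iff one_add_one)
  then have "- M = M" for M :: "'a^2^2" using minus_eq_self_matrix zero_neq_one by metis
  then have "inj_on pr S" by (auto simp: inj_on_def pr_eq_iff)
  then show ?thesis using True by (simp add: card_image)
next
  case False
  have "M \<noteq> - M" if "M \<in> S" for M
  proof
    assume *: "M = - M"
    obtain a b c d where M: "M = mk a b c d" by (rule mk_cases)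
    have "a = - a" "b = - b" using * unfolding M mk_uminus mk_eq_iff by blast+
    then have "2 * a = 0" "2 * b = 0" by (metis add.right_inverse mult_2)+
    then show False using False S(2)[OF that] by (simp add: M)
  qed
  then have "card (pr M) = 2" if "M \<in> S" for M using that by (auto simp: pr_def card_2_iff)
  moreover have U: "\<Union> (pr ` S) = S" using S(1) by (auto simp: pr_def)
  ultimately have "2 * card (pr ` S) = card (\<Union> (pr ` S))"
    by (intro card_partition) (auto simp: pr_def)
  then show ?thesis using False by (simp add: U)
qed

lemma carrier_psl_slf: "carrier (PSL2 TYPE('a::field)) = pr ` slf (UNIV :: 'a set)"
  by (simp add: carrier_PSL2 slf_def)

text \<open>The order of the twist is odd: if it negated \<open>M\<close>, its third power would
  too, and so \<open>- M = M\<close>.\<close>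

lemma twist_eq_sign:
  assumes B: "det B \<noteq> 0" and s: "cubic_hom s" and M: "pr (twist B s M) = pr M"
  shows "twist B s M = M"
proof (cases "twist B s M = M")
  case False
  then have *: "twist B s M = - M" using M by (auto simp: pr_eq_iff)
  have fs: "fld_hom s" using s by (simp add: cubic_hom_def)
  have neg: "twist B s (- N) = - twist B s N" for N
  proof -
    have "- N = scal (- 1) N" for N :: "'a^2^2" by (cases N rule: mk_cases) simp
    then show ?thesis using twist_scal[OF B fs, of "- 1"] by (simp add: fld_hom_simps[OF fs])
  qed
  show ?thesis using twist3[OF B s, of M] by (simp add: * neg)
qed simp

text \<open>Fixed classes are classes of fixed matrices, and these are the conjugates by
  \<open>B\<close> of the matrices with entries in \<open>F\<close>.\<close>

lemma card_fixed_points: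
  fixes f :: "('a::{field,finite}^2^2) set \<Rightarrow> ('a^2^2) set"
  assumes B: "det B \<noteq> 0" and s: "cubic_hom s"
    and f: "\<And>M. det M = 1 \<Longrightarrow> f (pr M) = pr (twist B s M)"
    and F: "F = {x. s x = x}"
  shows "card {x \<in> carrier psl. f x = x} = card (pr ` slf F)"
proof -
  have fs: "fld_hom s" using s by (simp add: cubic_hom_def)
  have fixm: "mmap s N = N \<longleftrightarrow> (\<forall>i j. N $ i $ j \<in> F)" for N
    by (cases N rule: mk_cases) (simp add: F forall_2)
  have tw: "twist B s M = M \<longleftrightarrow> mmap s (minv B ** M ** B) = minv B ** M ** B" for M
  proof
    assume "twist B s M = M"
    then have "minv B ** twist B s M ** B = minv B ** M ** B" by simp
    then show "mmap s (minv B ** M ** B) = minv B ** M ** B"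
      using B by (simp add: twist_def matrix_mul_assoc[symmetric] minv_left)
  next
    assume "mmap s (minv B ** M ** B) = minv B ** M ** B"
    then show "twist B s M = M" using B by (simp add: twist_def matrix_mul_assoc[symmetric] minv_right)
  qed
  have "{x \<in> carrier psl. f x = x} = pr ` {M. det M = 1 \<and> twist B s M = M}"
  proof (intro equalityI subsetI)
    fix x assume "x \<in> {x \<in> carrier psl. f x = x}"
    moreover from this obtain M where M: "det M = 1" "x = pr M" by (auto elim: PSL2_cases)
    ultimately have "twist B s M = M" by (intro twist_eq_sign[OF B s]) (simp add: f)
    then show "x \<in> pr ` {M. det M = 1 \<and> twist B s M = M}" using M by blast
  qed (auto simp: f)
  also have "{M. det M = 1 \<and> twist B s M = M} = (\<lambda>N. B ** N ** minv B) ` slf F"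
  proof (intro equalityI subsetI)
    fix M assume "M \<in> {M. det M = 1 \<and> twist B s M = M}"
    then have "minv B ** M ** B \<in> slf F" and "B ** (minv B ** M ** B) ** minv B = M"
      using B by (auto simp: slf_def tw fixm[symmetric] det_mul det_minv matrix_mul_assoc[symmetric] minv_right)
    then show "M \<in> (\<lambda>N. B ** N ** minv B) ` slf F" by (metis imageI)
  next
    fix M assume "M \<in> (\<lambda>N. B ** N ** minv B) ` slf F"
    then obtain N where N: "N \<in> slf F" "M = B ** N ** minv B" by blast
    have "minv B ** M ** B = N" using B by (simp add: N matrix_mul_assoc[symmetric] minv_left)
    then show "M \<in> {M. det M = 1 \<and> twist B s M = M}"
      using N B by (simp add: tw conj_det slf_def fixm)
  qed
  also have "pr ` ((\<lambda>N. B ** N ** minv B) ` slf F) = cj B ` (pr ` slf F)"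
    by (simp add: image_image)
  also have "card \<dots> = card (pr ` slf F)"
  proof (rule card_image)
    have "bij_betw (cj B) (carrier psl) (carrier psl)" using cj_iso[OF B] by (simp add: iso_def)
    moreover have "pr ` slf F \<subseteq> carrier psl" by (auto simp: slf_def)
    ultimately show "inj_on (cj B) (pr ` slf F)" by (meson bij_betw_def inj_on_subset)
  qed
  finally show ?thesis .
qed

text \<open>The two fields are unrelated types. Equality of characteristics ensures that passing to
  sign classes divides both group orders by the same factor.\<close>

lemma CHAR_eq_of_card_primepow:
  assumes "primepow q" "CARD('a::{field,finite}) = q ^ n" "CARD('b::{field,finite}) = q"
  shows "CHAR('a) = CHAR('b)"
proof -
  obtain p k where p: "Factorial_Ring.prime p" "q = p ^ k" using assms(1) by (auto simp: primepow_def)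
  have a: "Factorial_Ring.prime CHAR('a)" by (rule prime_CHAR_semidom[OF finite_imp_CHAR_pos[OF finite]])
  have b: "Factorial_Ring.prime CHAR('b)" by (rule prime_CHAR_semidom[OF finite_imp_CHAR_pos[OF finite]])
  have "CHAR('a) dvd p" using CHAR_dvd_CARD[where 'a = 'a] by (metis a assms(2) p(2) prime_dvd_power)
  moreover have "CHAR('b) dvd p" using CHAR_dvd_CARD[where 'a = 'b] by (metis b assms(3) p(2) prime_dvd_power)
  ultimately show ?thesis using a b p(1) by (metis primes_dvd_imp_eq)
qed

lemma card_fixed_points_PSL2:
  fixes f :: "('a::{field,finite}^2^2) set \<Rightarrow> ('a^2^2) set"
  assumes q: "primepow q" "CARD('a) = q ^ 3" "CARD('b::{field,finite}) = q"
    and B: "det B \<noteq> 0" and s: "cubic_hom s"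
    and f: "\<And>M. det M = 1 \<Longrightarrow> f (pr M) = pr (twist B s M)"
  shows "card {x \<in> carrier psl. f x = x} = order (PSL2 TYPE('b))"
proof -
  have fs: "fld_hom s" using s by (simp add: cubic_hom_def)
  define F where "F = {x. s x = x}"
  have "card F ^ 3 = q ^ 3" using card_fixed_field[OF s] q by (simp add: F_def)
  then have F: "card F = q" by (simp add: power_eq_iff_eq_base)
  have "card (slf F) = card (slf (UNIV :: 'b set))"
  proof -
    have "card (slf F) = (card F - 1) * card F * card F + (card F - 1) * card F"
      by (rule card_slf) (auto simp: F_def fld_hom_simps[OF fs])
    moreover have "card (slf (UNIV :: 'b set)) = (q - 1) * q * q + (q - 1) * q"
      using card_slf[of "UNIV :: 'b set"] by (simp add: q)
    ultimately show ?thesis by (simp add: F)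
  qed
  moreover have "(2::'a) = 0 \<longleftrightarrow> (2::'b) = 0"
    using of_nat_eq_0_iff_char_dvd[where 'a = 'a, of 2] of_nat_eq_0_iff_char_dvd[where 'a = 'b, of 2]
      CHAR_eq_of_card_primepow[OF q] by simp
  moreover have "card (pr ` slf F) * (if (2::'a) = 0 then 1 else 2) = card (slf F)"
    by (rule card_pr_image) (auto simp: slf_def F_def fld_hom_simps[OF fs] det_minus2)
  moreover have "card (pr ` slf (UNIV :: 'b set)) * (if (2::'b) = 0 then 1 else 2) = card (slf (UNIV :: 'b set))"
    by (rule card_pr_image) (auto simp: slf_def det_minus2)
  ultimately have "card (pr ` slf F) = card (pr ` slf (UNIV :: 'b set))" by (auto split: if_splits)
  then show ?thesis
    using card_fixed_points[OF B s f F_def] by (simp add: order_def carrier_psl_slf)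
qed

section \<open>Trace-zero matrices and dihedral subgroups\<close>

lemma tr_add: "tr (A + B) = tr A + tr (B :: 'a::comm_ring_1^2^2)"
  by (simp add: tr_def)

lemma tr_scal: "tr (scal k A) = k * tr (A :: 'a::comm_ring_1^2^2)"
  by (cases A rule: mk_cases) (simp add: algebra_simps)

lemma tr_one: "tr (mat 1) = (2 :: 'a::comm_ring_1)"
  by (simp add: mat_mk)

lemma scal_add: "scal k (A + B) = scal k A + scal k (B :: 'a::comm_ring_1^2^2)"
  by (cases A rule: mk_cases, cases B rule: mk_cases) (simp add: algebra_simps)

lemma scal_one [simp]: "scal 1 A = (A :: 'a::comm_ring_1^2^2)"
  by (cases A rule: mk_cases) simp

lemma scal_zero [simp]: "scal 0 A = (0 :: 'a::comm_ring_1^2^2)"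
  by (cases A rule: mk_cases) (simp add: mk_zero)

lemma scal_minus_one: "scal (- 1) A = - (A :: 'a::comm_ring_1^2^2)"
  by (cases A rule: mk_cases) simp

lemmas lin = scal_mult_left scal_mult_right matrix_add_ldistrib matrix_add_rdistrib2
  tr_add tr_scal scal_add scal_scal matrix_mul_assoc

lemma traceless_square:
  "tr A = 0 \<Longrightarrow> A ** A = scal (- det A) (mat (1 :: 'a::comm_ring_1))"
  by (cases A rule: mk_cases) (auto simp: mat_mk eq_neg_iff_add_eq_0[symmetric] algebra_simps)

text \<open>Polarised Cayley-Hamilton: \<open>A ** B + B ** A\<close> is the scalar
  \<open>tr (A ** B)\<close>. Hence a vanishing trace of the product means that the classes of
  \<open>A\<close> and \<open>B\<close> commute in \<open>PSL2\<close>.\<close>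

lemma traceless_anticommute:
  assumes "tr A = 0" "tr B = 0"
  shows "B ** A = scal (tr (A ** B)) (mat 1) + scal (- 1) (A ** (B :: 'a::comm_ring_1^2^2))"
proof -
  obtain a b c d where A: "A = mk a b c d" by (rule mk_cases)
  obtain a' b' c' d' where B: "B = mk a' b' c' d'" by (rule mk_cases)
  have "d = - a" "d' = - a'" using assms by (simp_all add: A B add_eq_0_iff)
  then show ?thesis by (simp add: A B mat_mk algebra_simps)
qed

lemma det_traceless_comb:
  assumes "tr A = 0" "tr B = 0"
  shows "det (scal x A + scal y B) =
    x * x * det A + y * y * det B - x * y * tr (A ** (B :: 'a::comm_ring_1^2^2))"
proof -
  obtain a b c d where A: "A = mk a b c d" by (rule mk_cases)
  obtain a' b' c' d' where B: "B = mk a' b' c' d'" by (rule mk_cases)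
  have "d = - a" "d' = - a'" using assms by (simp_all add: A B add_eq_0_iff)
  then show ?thesis by (simp add: A B algebra_simps)
qed

text \<open>The rotations lie in the span of \<open>mat 1\<close> and \<open>P ** Q\<close>, the
  reflections in the span of \<open>P\<close> and \<open>Q\<close>. Both shapes are kept by
  multiplication since \<open>P\<close> and \<open>Q\<close> square to -1 and \<open>Q ** P\<close>
  reduces to \<open>P ** Q\<close>. Coefficients replace the enumeration of powers of the
  rotation.\<close>

lemma dihedral_elements:
  fixes P Q :: "'a::field^2^2"
  assumes P: "tr P = 0" "det P = 1" and Q: "tr Q = 0" "det Q = 1"
    and g: "g \<in> generate psl {pr P, pr Q}"
  shows "\<exists>M. det M = 1 \<and> g = pr M \<and>
    ((\<exists>a b. M = scal a (mat 1) + scal b (P ** Q)) \<or> (\<exists>x y. M = scal x P + scal y Q))"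
    (is "\<exists>M. ?D M g")
  using g
proof (induction rule: generate.induct)
  case one
  have "?D (mat 1) (pr (mat 1))"
    by (intro conjI disjI1 exI[of _ 1] exI[of _ 0]) auto
  then show ?case unfolding one_PSL2 by blast
next
  case (incl h)
  have "?D P (pr P)"
    using P by (intro conjI disjI2 exI[of _ 1] exI[of _ 0]) auto
  moreover have "?D Q (pr Q)"
    using Q by (intro conjI disjI2 exI[of _ 0] exI[of _ 1]) auto
  ultimately show ?case using incl by blast
next
  case (inv h)
  have adj: "adj A = - A" if "tr A = 0" for A :: "'a^2^2"
    using that by (cases A rule: mk_cases) (simp add: add_eq_0_iff)
  have "?D P (inv\<^bsub>psl\<^esub> pr P)"
    using P by (intro conjI disjI2 exI[of _ 1] exI[of _ 0]) (auto simp: inv_PSL2 adj)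
  moreover have "?D Q (inv\<^bsub>psl\<^esub> pr Q)"
    using Q by (intro conjI disjI2 exI[of _ 0] exI[of _ 1]) (auto simp: inv_PSL2 adj)
  ultimately show ?case using inv by blast
next
  case (eng g h)
  then obtain M N where M: "?D M g" and N: "?D N h" by blast
  let ?t = "tr (P ** Q)"
  have PP: "P ** P = scal (- 1) (mat 1)" and QQ: "Q ** Q = scal (- 1) (mat 1)"
    using traceless_square P Q by metis+
  have QP: "Q ** P = scal ?t (mat 1) + scal (- 1) (P ** Q)"
    using traceless_anticommute P Q by metis
  have QP': "K ** Q ** P = scal ?t K + scal (- 1) (K ** P ** Q)" for K
    by (simp add: matrix_mul_assoc[symmetric] QP) (simp add: lin)
  have PP': "K ** P ** P = scal (- 1) K" and QQ': "K ** Q ** Q = scal (- 1) K" for K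
    by (simp_all add: matrix_mul_assoc[symmetric] PP QQ) (simp_all add: lin)
  note rew = lin PP QQ QP QP' PP' QQ'
  have ent: "scal k (mk a b c d) = mk (k * a) (k * b) (k * c) (k * d)" for k a b c d :: 'a by simp
  have "(\<exists>a b. M ** N = scal a (mat 1) + scal b (P ** Q)) \<or> (\<exists>x y. M ** N = scal x P + scal y Q)"
    using M N
  proof (elim conjE disjE exE)
    fix a b a' b'
    assume "M = scal a (mat 1) + scal b (P ** Q)" "N = scal a' (mat 1) + scal b' (P ** Q)"
    then have "M ** N = scal (a * a' - b * b') (mat 1) + scal (a * b' + b * a' + b * b' * ?t) (P ** Q)"
      by (simp add: rew) (cases "P ** Q" rule: mk_cases, simp add: mat_mk algebra_simps)
    then show ?thesis by blast
  next
    fix a b x y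
    assume "M = scal a (mat 1) + scal b (P ** Q)" "N = scal x P + scal y Q"
    then have "M ** N = scal (a * x + b * x * ?t - b * y) P + scal (a * y + b * x) Q"
      by (simp add: rew) (cases P rule: mk_cases, cases Q rule: mk_cases, simp add: algebra_simps)
    then show ?thesis by blast
  next
    fix x y a b
    assume "M = scal x P + scal y Q" "N = scal a (mat 1) + scal b (P ** Q)"
    then have "M ** N = scal (x * a + y * b) P + scal (y * a - x * b + y * b * ?t) Q"
      by (simp add: rew) (cases P rule: mk_cases, cases Q rule: mk_cases, simp add: algebra_simps)
    then show ?thesis by blast
  next
    fix x y x' y'
    assume "M = scal x P + scal y Q" "N = scal x' P + scal y' Q"
    then have "M ** N = scal (y * x' * ?t - x * x' - y * y') (mat 1) + scal (x * y' - y * x') (P ** Q)"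
      by (simp add: rew) (cases "P ** Q" rule: mk_cases, simp add: mat_mk algebra_simps)
    then show ?thesis by blast
  qed
  then have "?D (M ** N) (g \<otimes>\<^bsub>psl\<^esub> h)" using M N by (auto simp: det_mul)
  then show ?case by blast
qed

text \<open>\<open>P0\<close>, \<open>P2\<close>, \<open>P3\<close> lift \<open>r0\<close>,
  \<open>r2\<close> and their product, and the twist rotates them. The sign \<open>e\<close> is
  present because the product of two chosen lifts matches the third only up to sign.\<close>

locale triality_frame =
  fixes B :: "'a::field^2^2" and s :: "'a \<Rightarrow> 'a" and P0 P1 P2 P3 :: "'a^2^2" and e :: 'a
  assumes B: "det B \<noteq> 0" and s: "cubic_hom s"
    and P0: "tr P0 = 0" "det P0 = 1" and P1: "tr P1 = 0" "det P1 = 1"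
    and S1: "twist B s P1 = P1" and S0: "twist B s P0 = P2" and S2: "twist B s P2 = P3"
    and P02: "P0 ** P2 = scal e P3" and e: "e * e = 1"
    and noncommuting: "pr (P0 ** P1) \<noteq> pr (P1 ** P0)"
    and distinct: "pr P0 \<noteq> pr P2"
begin

lemma fs: "fld_hom s" and s3: "s (s (s x)) = x"
  using s by (auto simp: cubic_hom_def)

lemma S3: "twist B s P3 = P0"
  using twist3[OF B s, of P0] by (simp add: S0 S2)

lemma P2: "tr P2 = 0" "det P2 = 1" and P3: "tr P3 = 0" "det P3 = 1"
  using tr_twist[OF B fs] det_twist[OF B fs] P0
  by (auto simp: S0[symmetric] S2[symmetric] fld_hom_simps[OF fs])

lemma se: "s e = e"
proof -
  have "e = 1 \<or> e = - 1" using e by (metis power2_eq_1_iff power2_eq_square)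
  then show ?thesis by (auto simp: fld_hom_simps[OF fs])
qed

lemma e_nonzero: "e \<noteq> 0" using e by auto

lemma P23: "P2 ** P3 = scal e P0" and P30: "P3 ** P0 = scal e P2"
proof -
  show 1: "P2 ** P3 = scal e P0"
    using arg_cong[OF P02, of "twist B s"]
    by (simp add: twist_mult[OF B fs] twist_scal[OF B fs] S0 S2 S3 se)
  show "P3 ** P0 = scal e P2"
    using arg_cong[OF 1, of "twist B s"]
    by (simp add: twist_mult[OF B fs] twist_scal[OF B fs] S0 S2 S3 se)
qed

lemma square [simp]:
  "P0 ** P0 = scal (- 1) (mat 1)" "P1 ** P1 = scal (- 1) (mat 1)"
  "P2 ** P2 = scal (- 1) (mat 1)" "P3 ** P3 = scal (- 1) (mat 1)"
  using traceless_square P0 P1 P2 P3 by metis+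

text \<open>The pairings of \<open>P1\<close> with the rotating frame. Since the twist fixes
  \<open>P1\<close>, they are permuted by \<open>s\<close>, so nonvanishing of one gives
  nonvanishing of all.\<close>

definition "t0 = tr (P0 ** P1)"
definition "t2 = tr (P2 ** P1)"
definition "t3 = tr (P3 ** P1)"

lemma s_t: "s t0 = t2" "s t2 = t3" "s t3 = t0"
  unfolding t0_def t2_def t3_def
  by (simp_all add: tr_twist[OF B fs, symmetric] twist_mult[OF B fs] S0 S1 S2 S3)

lemma t0_nonzero: "t0 \<noteq> 0"
proof
  assume "t0 = 0"
  then have "P1 ** P0 = - (P0 ** P1)"
    using traceless_anticommute[OF P0(1) P1(1)] by (simp add: t0_def scal_minus_one)
  then show False using noncommuting by simp
qed

lemma t_nonzero: "t0 \<noteq> 0" "t2 \<noteq> 0" "t3 \<noteq> 0"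
  using t0_nonzero s_t fld_hom_eq_0[OF fs] by metis+

lemma tr_frame [simp]:
  "tr (P0 ** P2) = 0" "tr (P2 ** P0) = 0" "tr (P2 ** P3) = 0" "tr (P3 ** P2) = 0"
  "tr (P3 ** P0) = 0" "tr (P0 ** P3) = 0"
  using P0 P2 P3 tr_mult_commute[of P2 P0] tr_mult_commute[of P3 P2] tr_mult_commute[of P0 P3]
  by (simp_all add: P02 P23 P30 tr_scal)

lemma swap_frame: "P2 ** P0 = scal (- e) P3" "P3 ** P2 = scal (- e) P0" "P0 ** P3 = scal (- e) P2"
  using traceless_anticommute[of P0 P2] traceless_anticommute[of P2 P3] traceless_anticommute[of P3 P0]
  by (simp_all add: P0 P2 P3 P02 P23 P30 scal_scal tr_scal)

lemma tr_1: "tr (P1 ** P0) = t0" "tr (P1 ** P2) = t2" "tr (P1 ** P3) = t3"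
  "tr (P0 ** P1) = t0" "tr (P2 ** P1) = t2" "tr (P3 ** P1) = t3"
  by (simp_all add: t0_def t2_def t3_def tr_mult_commute)

lemma cancel_square [simp]:
  "K ** P0 ** P0 = scal (- 1) K" "K ** P1 ** P1 = scal (- 1) K"
  "K ** P2 ** P2 = scal (- 1) K" "K ** P3 ** P3 = scal (- 1) K"
  by (simp_all add: matrix_mul_assoc[symmetric]) (simp_all add: scal_mult_right)

lemma det_zero_neq_one: "det (0::'a^2^2) \<noteq> 1"
  by (simp add: mk_zero)

text \<open>A common element has an expression in each of the two dihedral spans. Traces against
  suitable frame matrices isolate single coefficients, multiplied by factors known to be nonzero;
  the mixed cases, a rotation equal to a reflection, end in \<open>M = 0\<close>.\<close>

lemma dihedral_intersection:
  assumes "g \<in> generate psl {pr P0, pr P1}" "g \<in> generate psl {pr P2, pr P1}"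
  shows "g = pr (mat 1) \<or> g = pr P1"
proof -
  obtain M where M: "det M = 1" "g = pr M"
    "(\<exists>a b. M = scal a (mat 1) + scal b (P0 ** P1)) \<or> (\<exists>x y. M = scal x P0 + scal y P1)"
    using dihedral_elements[OF P0 P1 assms(1)] by blast
  obtain N' where N': "det N' = 1" "g = pr N'"
    "(\<exists>a b. N' = scal a (mat 1) + scal b (P2 ** P1)) \<or> (\<exists>x y. N' = scal x P2 + scal y P1)"
    using dihedral_elements[OF P2 P1 assms(2)] by blast
  have neg: "- (scal a A + scal b C) = scal (- a) A + scal (- b) C" for a b and A C :: "'a^2^2"
    by (cases A rule: mk_cases, cases C rule: mk_cases) simp
  have "M = N' \<or> M = - N'" using M N' by (auto simp: pr_eq_iff)
  then have "(\<exists>a b. M = scal a (mat 1) + scal b (P2 ** P1)) \<or> (\<exists>x y. M = scal x P2 + scal y P1)"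
    using N'(3) neg by metis
  with M(3) show ?thesis
  proof (elim disjE exE)
    fix a b a' b'
    assume 1: "M = scal a (mat 1) + scal b (P0 ** P1)" and 2: "M = scal a' (mat 1) + scal b' (P2 ** P1)"
    have "tr (P0 ** M) = 0" by (simp add: 1 lin P0 P1)
    moreover have "tr (P0 ** M) = b' * e * t3" by (simp add: 2 lin P0 P02 tr_1)
    ultimately have "b' = 0" using e_nonzero t_nonzero by simp
    have "tr (P3 ** M) = b * e * t2" by (simp add: 1 lin P3 P30 tr_1)
    moreover have "tr (P3 ** M) = 0" by (simp add: 2 lin P3 \<open>b' = 0\<close>)
    ultimately have "b = 0" using e_nonzero t_nonzero by simp
    then have "M = scal a (mat 1)" by (simp add: 1)
    moreover have "a * a = 1" using M(1) calculation by (simp add: det_scal)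
    then have "a = 1 \<or> a = - 1" by (metis power2_eq_1_iff power2_eq_square)
    ultimately show ?thesis by (auto simp: M(2) scal_minus_one)
  next
    fix a b x y
    assume 1: "M = scal a (mat 1) + scal b (P0 ** P1)" and 2: "M = scal x P2 + scal y P1"
    have "tr (P0 ** M) = 0" by (simp add: 1 lin P0 P1)
    moreover have "tr (P0 ** M) = y * t0" by (simp add: 2 lin tr_1)
    ultimately have "y = 0" using t_nonzero by simp
    have "tr (P1 ** M) = 0"
      by (subst tr_mult_commute) (simp add: 1 lin P0 P1)
    moreover have "tr (P1 ** M) = x * t2" by (simp add: 2 lin tr_1 \<open>y = 0\<close>)
    ultimately have "x = 0" using t_nonzero by simp
    then have "M = 0" by (simp add: 2 \<open>y = 0\<close>)
    then show ?thesis using M(1) det_zero_neq_one by simp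
  next
    fix x y a b
    assume 1: "M = scal x P0 + scal y P1" and 2: "M = scal a (mat 1) + scal b (P2 ** P1)"
    have "tr (P2 ** M) = 0" by (simp add: 2 lin P2 P1)
    moreover have "tr (P2 ** M) = y * t2" by (simp add: 1 lin tr_1)
    ultimately have "y = 0" using t_nonzero by simp
    have "tr (P1 ** M) = 0"
      by (subst tr_mult_commute) (simp add: 2 lin P2 P1)
    moreover have "tr (P1 ** M) = x * t0" by (simp add: 1 lin tr_1 \<open>y = 0\<close>)
    ultimately have "x = 0" using t_nonzero by simp
    then have "M = 0" by (simp add: 1 \<open>y = 0\<close>)
    then show ?thesis using M(1) det_zero_neq_one by simp
  next
    fix x y x' y'
    assume 1: "M = scal x P0 + scal y P1" and 2: "M = scal x' P2 + scal y' P1"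
    have "tr (P3 ** M) = y * t3" by (simp add: 1 lin tr_1)
    moreover have "tr (P3 ** M) = y' * t3" by (simp add: 2 lin tr_1)
    ultimately have "y = y'" using t_nonzero by simp
    \<comment> \<open>The extra factor \<open>P1\<close> on the right turns the coefficient of
      \<open>P2\<close> into a multiple of \<open>tr (P3 ** P1)\<close>, while the other terms give
      multiples of traces that vanish.\<close>
    have "tr (P0 ** M ** P1) = - (y * tr P0)"
      by (simp add: 1 lin P0 P1)
    moreover have "tr (P0 ** M ** P1) = x' * e * t3 - y' * tr P0"
      by (simp add: 2 lin P02 tr_1)
    ultimately have "x' = 0" using t_nonzero e_nonzero P0 by simp
    have "tr (P2 ** M ** P1) = - (x * e * t3)"
      by (simp add: 1 lin P2 tr_1 swap_frame)
    moreover have "tr (P2 ** M ** P1) = 0"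
      by (simp add: 2 lin P2 P1)
    ultimately have "x = 0" using t_nonzero e_nonzero by simp
    then have "M = scal y P1" by (simp add: 1)
    moreover have "y * y = 1" using M(1) calculation by (simp add: det_scal P1)
    then have "y = 1 \<or> y = - 1" by (metis power2_eq_1_iff power2_eq_square)
    ultimately show ?thesis by (auto simp: M(2) scal_minus_one)
  qed
qed

lemma conj_P1: "K ** P1 ** P0 ** P1 = scal t0 (K ** P1) + K ** P0" "P1 ** P0 ** P1 = scal t0 P1 + P0"
proof -
  have "P1 ** P0 = scal t0 (mat 1) + scal (- 1) (P0 ** P1)"
    using traceless_anticommute[OF P0(1) P1(1)] by (simp add: t0_def)
  then show 1: "P1 ** P0 ** P1 = scal t0 P1 + P0" by (simp add: lin)
  have "K ** P1 ** P0 ** P1 = K ** (P1 ** P0 ** P1)" by (simp only: matrix_mul_assoc)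
  then show "K ** P1 ** P0 ** P1 = scal t0 (K ** P1) + K ** P0" by (simp only: 1) (simp add: lin)
qed

lemma twist_comb:
  "twist B s (scal a (mat 1) + scal b (P0 ** P1)) = scal (s a) (mat 1) + scal (s b) (P2 ** P1)"
  "twist B s (scal a (mat 1) + scal b (P2 ** P1)) = scal (s a) (mat 1) + scal (s b) (P3 ** P1)"
  "twist B s (scal x P0 + scal y P1) = scal (s x) P2 + scal (s y) P1"
  "twist B s (scal x P2 + scal y P1) = scal (s x) P3 + scal (s y) P1"
  by (simp_all add: twist_add[OF B fs] twist_scal[OF B fs] twist_mult[OF B fs] twist_mat[OF B fs]
      fld_hom_simps[OF fs] S0 S1 S2)

lemma adj_traceless: "tr A = 0 \<Longrightarrow> adj A = - (A :: 'a^2^2)"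
  by (cases A rule: mk_cases) (simp add: add_eq_0_iff)

lemma adj_add: "adj (A + C) = adj A + adj (C :: 'a^2^2)"
  by (cases A rule: mk_cases, cases C rule: mk_cases) simp

lemma adj_scal: "adj (scal k A) = scal k (adj (A :: 'a^2^2))"
  by (cases A rule: mk_cases) simp

lemma adj_adj: "adj (adj A) = (A :: 'a^2^2)"
  by (cases A rule: mk_cases) simp

lemma adj_one: "adj (mat 1) = (mat 1 :: 'a^2^2)"
  by (simp add: mat_mk)

text \<open>A rotation is inverted by \<open>P1\<close>, so the norm condition reversed also holds and
  forces \<open>M\<close> to commute with its twist.\<close>

lemma norm_one_rotation:
  assumes M: "det M = 1" "M = scal a (mat 1) + scal b (P0 ** P1)"
    and norm: "M ** twist B s M ** twist B s (twist B s M) = scal k (mat 1)"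
  shows "pr M = pr (mat 1)"
proof -
  define M' where "M' = twist B s M"
  define M'' where "M'' = twist B s M'"
  have M': "M' = scal (s a) (mat 1) + scal (s b) (P2 ** P1)" by (simp add: M'_def M(2) twist_comb)
  have M'': "M'' = scal (s (s a)) (mat 1) + scal (s (s b)) (P3 ** P1)" by (simp add: M''_def M' twist_comb)
  have d: "det M' = 1" "det M'' = 1"
    using M(1) by (simp_all add: M'_def M''_def det_twist[OF B fs] fld_hom_simps[OF fs])
  \<comment> \<open>\<open>P1\<close> inverts each product \<open>R ** P1\<close> with
    \<open>R\<close> traceless, hence every combination of it with \<open>mat 1\<close> that has
    determinant 1.\<close>
  have inv: "P1 ** (scal a (mat 1) + scal b (R ** P1)) = adj (scal a (mat 1) + scal b (R ** P1)) ** P1"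
    if "tr R = 0" for a b R
    using that by (simp add: adj_add adj_scal adj_mult adj_traceless P1 adj_one minus_mult_left2 minus_mult_right2)
      (simp add: lin)
  have i: "P1 ** M = adj M ** P1" "P1 ** M' = adj M' ** P1" "P1 ** M'' = adj M'' ** P1"
    unfolding M(2) M' M'' using inv P0 P2 P3 by blast+
  have "P1 ** (M ** M' ** M'') = adj M ** adj M' ** adj M'' ** P1"
    by (metis i matrix_mul_assoc)
  then have "scal k P1 = adj (M'' ** M' ** M) ** P1"
    using norm by (simp add: M'_def M''_def scal_mult_right adj_mult matrix_mul_assoc)
  then have "scal k P1 ** P1 = adj (M'' ** M' ** M) ** P1 ** P1" by simp
  then have "scal (- k) (mat 1) = scal (- 1) (adj (M'' ** M' ** M))"
    by (simp add: scal_mult_left scal_scal)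
  then have "scal (- 1) (scal (- k) (mat 1)) = scal (- 1) (scal (- 1) (adj (M'' ** M' ** M)))" by simp
  then have "adj (M'' ** M' ** M) = scal k (mat 1)" by (simp add: scal_scal)
  then have "adj (adj (M'' ** M' ** M)) = scal k (mat 1)" by (simp add: adj_scal adj_one)
  then have r: "M'' ** (M' ** M) = scal k (mat 1)" by (simp add: adj_adj matrix_mul_assoc)
  have a: "adj M'' ** M'' = mat 1" "M'' ** adj M'' = mat 1" using d by (simp_all add: adj_left adj_right)
  have "M' ** M = adj M'' ** (M'' ** (M' ** M))" by (simp add: matrix_mul_assoc a)
  also have "\<dots> = scal k (adj M'')" by (simp only: r) (simp add: scal_mult_right)
  also have "\<dots> = (M ** M' ** M'') ** adj M''" using norm by (simp add: M'_def M''_def scal_mult_left)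
  also have "\<dots> = M ** M'" by (simp add: matrix_mul_assoc[symmetric] a)
  finally have "tr (P0 ** (M' ** M)) = tr (P0 ** (M ** M'))" by simp
  \<comment> \<open>The trace of the commutator against \<open>P0\<close> reduces to
    \<open>s b * b * e * t0 * t3\<close>, every other contribution cancelling or vanishing.\<close>
  moreover have "tr (P1 ** P2 ** P1) = 0" using P2 by (subst tr_mult_commute) (simp add: lin)
  ultimately have "s b * (b * (e * (t0 * t3))) = 0"
    by (auto simp: M(2) M' lin P0 P1 P2 P3 P02 conj_P1 tr_1)
  then have "b = 0" using e_nonzero t_nonzero by (simp add: fld_hom_eq_0[OF fs])
  then have "M = scal a (mat 1)" by (simp add: M(2))
  moreover have "a * a = 1" using M(1) calculation by (simp add: det_scal)
  then have "a = 1 \<or> a = - 1" by (metis power2_eq_1_iff power2_eq_square)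
  ultimately show ?thesis by (auto simp: scal_minus_one)
qed

lemma pr_scal: "k * k = 1 \<Longrightarrow> pr (scal k A) = pr (A :: 'a^2^2)"
proof -
  assume "k * k = 1"
  then have "k = 1 \<or> k = - 1" by (metis power2_eq_1_iff power2_eq_square)
  then show ?thesis by (auto simp: scal_minus_one)
qed

text \<open>The norm condition makes \<open>M\<close> and its twist anticommute. In odd characteristic their trace form
  then fixes \<open>x t0 / y\<close> to be 1; in characteristic 2, where that form is degenerate, the trace against
  \<open>P1\<close> is used instead and gives \<open>x s(x) = s(s(x))\<close>.\<close>

lemma norm_one_reflection:
  assumes M: "det M = 1" "M = scal x P0 + scal y P1"
    and norm: "M ** twist B s M ** twist B s (twist B s M) = scal k (mat 1)" and k: "k * k = 1"
  shows "pr M = pr P0 \<or> pr M = pr (P1 ** P0 ** P1)"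
proof -
  define M' where "M' = twist B s M"
  define M'' where "M'' = twist B s M'"
  have M': "M' = scal (s x) P2 + scal (s y) P1" by (simp add: M'_def M(2) twist_comb)
  have M'': "M'' = scal (s (s x)) P3 + scal (s (s y)) P1" by (simp add: M''_def M' twist_comb)
  have d: "det M' = 1" "det M'' = 1"
    using M(1) by (simp_all add: M'_def M''_def det_twist[OF B fs] fld_hom_simps[OF fs])
  have "tr M'' = 0" by (simp add: M'' lin P3 P1)
  \<comment> \<open>Reflections square to -1, so the norm condition becomes the product relation
    \<open>M ** M' = scal (- k) M''\<close>.\<close>
  then have "M'' ** M'' = scal (- 1) (mat 1)" using traceless_square d by metis
  then have "M ** M' ** M'' ** M'' = scal (- 1) (M ** M')"
    by (simp add: matrix_mul_assoc[symmetric]) (simp add: lin)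
  then have "scal (- 1) (M ** M') = scal k M''" using norm by (simp add: M'_def M''_def scal_mult_left)
  then have "scal (- 1) (scal (- 1) (M ** M')) = scal (- 1) (scal k M'')" by simp
  then have r: "M ** M' = scal (- k) M''" by (simp add: scal_scal)
  have det1: "x * x + y * y - x * y * t0 = 1"
    using det_traceless_comb[of P0 P1 x y] P0 P1 M by (simp add: t0_def)
  have goal2: ?thesis if "y = x * t0" "x * x = 1"
  proof -
    have "M = scal x (P1 ** P0 ** P1)" by (simp add: M(2) conj_P1 that lin add.commute)
    then show ?thesis using that pr_scal by blast
  qed
  have goal1: ?thesis if "y = 0"
  proof -
    have "M = scal x P0" "x * x = 1" using that det1 by (simp_all add: M(2))
    then show ?thesis using pr_scal by blast
  qed
  show ?thesis
  proof (cases "(2::'a) = 0")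
    case True
    have pm1: "z = 1" if "z * z = 1" for z :: 'a
    proof -
      have "z = 1 \<or> z = - 1" using that by (metis power2_eq_1_iff power2_eq_square)
      moreover have "(1::'a) = - 1" using True by (metis add_eq_0_iff one_add_one)
      ultimately show ?thesis by metis
    qed
    have "k = 1" "e = 1" by (rule pm1[OF k], rule pm1[OF e])
    have "(- 1 :: 'a) = 1" by (rule pm1) simp
    have p: "tr (P1 ** P2 ** P1) = 0" "tr (P1 ** P1 ** P1) = 0"
      by (subst tr_mult_commute, simp add: lin P1 P2)+
    have "tr (M ** M' ** P1) = tr (scal (- k) M'' ** P1)" by (simp only: r)
    then have "x * s x * t3 = s (s x) * t3"
      using \<open>k = 1\<close> \<open>e = 1\<close> \<open>- 1 = 1\<close> True
      by (simp add: M(2) M' M'' lin P0 P1 P2 P3 P02 tr_1 p tr_one mult.commute[of x "s x"])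
    then have x: "x * s x = s (s x)" using t_nonzero by simp
    have x2: "s x * s (s x) = x" by (metis x fld_hom_mult[OF fs] s3)
    then have x3: "s (s x) * x = s x" by (metis fld_hom_mult[OF fs] s3)
    show ?thesis
    proof (cases "x = 0")
      case True
      \<comment> \<open>With \<open>x = 0\<close> all three factors are multiples of
        \<open>P1\<close>; the trace against \<open>P0\<close> then forces \<open>y = 0\<close>,
        contradicting \<open>det1\<close>.\<close>
      have "tr (P0 ** (M ** M' ** M'')) = tr (P0 ** scal k (mat 1))"
        using norm by (simp add: M'_def M''_def)
      then have "y * s y * s (s y) * t0 = 0"
        using \<open>x = 0\<close> by (auto simp: M(2) M' M'' lin P0 P1 tr_1 fld_hom_simps[OF fs])
      then have "y = 0" using t_nonzero by (simp add: fld_hom_eq_0[OF fs])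
      then show ?thesis using det1 \<open>x = 0\<close> by simp
    next
      case False
      \<comment> \<open>Combine \<open>x * s x = s (s x)\<close> with its conjugate
        \<open>s (s x) * x = s x\<close>. The determinant then leaves only \<open>y = 0\<close> and
        \<open>y = t0\<close>.\<close>
      have "s x * (x * x) = s x * 1" using x x3 by (metis mult.assoc mult.commute mult.right_neutral)
      then have xx: "x * x = 1" using False fld_hom_eq_0[OF fs] by simp
      then have "x = 1" by (rule pm1)
      then have "y * (y - t0) = 0" using det1 by (simp add: algebra_simps)
      then show ?thesis using goal1 goal2 xx \<open>x = 1\<close> by auto
    qed
  next
    case False
    show ?thesis
    proof (cases "y = 0")
      case True
      then show ?thesis by (rule goal1)
    next
      case y: False
      then have sy: "s y \<noteq> 0" by (simp add: fld_hom_eq_0[OF fs])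
      have "tr (M ** M') = 0" by (simp add: r tr_scal \<open>tr M'' = 0\<close>)
      then have "x * s y * t0 + y * s x * t2 = 2 * (y * s y)"
        by (simp add: M(2) M' lin tr_1 tr_one algebra_simps)
      \<comment> \<open>Dividing the trace relation by \<open>y * s y\<close> gives
        \<open>w + s w = 2\<close>. Its conjugate shows that \<open>w\<close> is fixed by the square
        of \<open>s\<close>, hence by \<open>s\<close>, so \<open>2 * w = 2\<close>.\<close>
      define w where "w = x * t0 / y"
      have "w * (y * s y) = x * s y * t0" "s w * (y * s y) = y * s x * t2"
        using y sy by (simp_all add: w_def fld_hom_simps[OF fs] s_t)
      then have "(w + s w) * (y * s y) = 2 * (y * s y)"
        using \<open>x * s y * t0 + y * s x * t2 = 2 * (y * s y)\<close> by (simp only: distrib_right)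
      then have sw: "w + s w = 2" using y sy by simp
      have s2: "s 2 = 2" using fs by (metis fld_hom_1 fld_hom_add one_add_one)
      have sw2: "s w + s (s w) = 2"
        using arg_cong[OF sw, of s] by (simp add: fld_hom_add[OF fs] s2)
      then have "s (s w) = w" using sw by (metis add.commute add_left_cancel)
      then have "s w = w" using s3[of w] by simp
      then have "2 * w = 2 * 1" using sw by simp
      then have "w = 1" using False by (metis mult_cancel_left)
      then have yx: "y = x * t0" using y by (simp add: w_def)
      then have "x * x = 1" using det1 by (simp add: algebra_simps)
      then show ?thesis using yx goal2 by blast
    qed
  qed
qed

end

section \<open>Disjoint unions of paths\<close>

text \<open>\<open>C\<close> indexes the edges, \<open>m x\<close> is the vertex shared by the edges
  of \<open>x\<close> and \<open>t x\<close>, and \<open>f x\<close> is the private end of the edge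
  of \<open>x\<close>. An orbit of \<open>t\<close> carries the path with vertices
  \<open>f x\<close>, \<open>m x\<close>, \<open>f (t x)\<close>, so the paths correspond to the
  orbits.\<close>

lemma pairing_path_union:
  fixes C :: "'c set" and t :: "'c \<Rightarrow> 'c" and m f :: "'c \<Rightarrow> 'v" and e :: "'c \<Rightarrow> 'e"
  assumes fin: "finite C"
    and t: "\<And>x. x \<in> C \<Longrightarrow> t x \<in> C" "\<And>x. x \<in> C \<Longrightarrow> t (t x) = x" "\<And>x. x \<in> C \<Longrightarrow> t x \<noteq> x"
    and m: "\<And>x y. x \<in> C \<Longrightarrow> y \<in> C \<Longrightarrow> m x = m y \<longleftrightarrow> y = x \<or> y = t x"
    and f: "inj_on f C" and e: "inj_on e C"
    and mf: "\<And>x y. x \<in> C \<Longrightarrow> y \<in> C \<Longrightarrow> m x \<noteq> f y"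
    and V: "V = m ` C \<union> f ` C" and E: "E = e ` C"
    and I: "\<And>v x. v \<in> V \<Longrightarrow> x \<in> C \<Longrightarrow> I v (e x) \<longleftrightarrow> v = m x \<or> v = f x"
  shows "incidence_graph V E I \<and> (\<exists>N. 2 * N = card C \<and> disjoint_union_of_paths N 2 V E I)"
proof
  have feq: "f x = f y \<longleftrightarrow> x = y" if "x \<in> C" "y \<in> C" for x y
    using f that by (auto simp: inj_on_def)
  have eeq: "e x = e y \<longleftrightarrow> x = y" if "x \<in> C" "y \<in> C" for x y
    using e that by (auto simp: inj_on_def)
  have nb: "{v \<in> V. I v (e x)} = {m x, f x}" if "x \<in> C" for x
    using that I by (auto simp: V)
  show "incidence_graph V E I"
    unfolding incidence_graph_def
  proof (intro conjI ballI inj_onI)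
    fix d assume "d \<in> E"
    then show "card {v \<in> V. I v d} = 2" using mf by (auto simp: E nb)
  next
    fix d d' assume d: "d \<in> E" "d' \<in> E" "{v \<in> V. I v d} = {v \<in> V. I v d'}"
    then obtain x y where "x \<in> C" "y \<in> C" "d = e x" "d' = e y" by (auto simp: E)
    moreover from this d(3) have "f x \<in> {m y, f y}" using nb by (metis insertCI)
    ultimately show "d = d'" using mf feq by (metis insert_iff singletonD)
  qed
  define orb where "orb = (\<lambda>x. {x, t x}) ` C"
  have cover: "\<Union> orb = C" using t(1) by (auto simp: orb_def)
  have N: "2 * card orb = card C"
  proof -
    have "2 * card orb = card (\<Union> orb)"
    proof (rule card_partition)
      show "finite orb" using fin by (simp add: orb_def)
      show "finite (\<Union> orb)" using fin by (simp add: cover)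
      show "card c = 2" if "c \<in> orb" for c using that t(3) by (force simp: orb_def card_2_iff)
      show "c1 \<inter> c2 = {}" if "c1 \<in> orb" "c2 \<in> orb" "c1 \<noteq> c2" for c1 c2
        using that t(2) unfolding orb_def by (elim imageE) (auto; metis)
    qed
    then show ?thesis by (simp add: cover)
  qed
  have "finite orb" using fin by (simp add: orb_def)
  then obtain h where h: "bij_betw h {..<card orb} orb"
    using ex_bij_betw_nat_finite by (metis atLeast0LessThan)
  have "\<exists>x. x \<in> C \<and> h i = {x, t x}" if "i < card orb" for i
    using bij_betwE[OF h] that by (auto simp: orb_def)
  \<comment> \<open>\<open>c i\<close> is a chosen representative of the orbit numbered
    \<open>i\<close>; it orients the path.\<close>
  then obtain c where c: "\<And>i. i < card orb \<Longrightarrow> c i \<in> C \<and> h i = {c i, t (c i)}" by metis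
  have sep: "i = l" if "i < card orb" "l < card orb" "x \<in> {c i, t (c i)}" "x \<in> {c l, t (c l)}" for i l x
  proof -
    have "h i = {x, t x}" "h l = {x, t x}" using that c t(2) by force+
    then show ?thesis using h that by (auto simp: bij_betw_def inj_on_def)
  qed
  have reach: "\<exists>i<card orb. x \<in> {c i, t (c i)}" if "x \<in> C" for x
  proof -
    have "x \<in> \<Union> (h ` {..<card orb})" using that cover h by (simp add: bij_betw_def)
    then show ?thesis using c by auto
  qed
  let ?W = "\<lambda>i. {m (c i), f (c i), f (t (c i))}" and ?D = "\<lambda>i. {e (c i), e (t (c i))}"
  have cC: "c i \<in> C" "t (c i) \<in> C" "t (t (c i)) = c i" "t (c i) \<noteq> c i" if "i < card orb" for i
    using c[OF that] t by auto
  have mt: "m (t x) = m x" if "x \<in> C" for x using m[of x "t x"] t(1) that by simp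
  have path: "path_graph 2 (?W i) (?D i) I" if i: "i < card orb" for i
    unfolding path_graph_def
  proof (intro exI conjI allI impI)
    let ?v = "\<lambda>n::nat. if n = 0 then f (c i) else if n = 1 then m (c i) else f (t (c i))"
    let ?e = "\<lambda>n::nat. if n = 0 then e (c i) else e (t (c i))"
    have 2: "{..2::nat} = {0, 1, 2}" "{..<2::nat} = {0, 1}" by auto
    note C = cC[OF i]
    have ne: "f (c i) \<noteq> f (t (c i))" "e (c i) \<noteq> e (t (c i))" "m (c i) \<noteq> f (c i)" "m (c i) \<noteq> f (t (c i))"
      using C feq eeq mf by metis+
    show "bij_betw ?v {..2} (?W i)" using ne by (auto simp: bij_betw_def inj_on_def 2)
    show "bij_betw ?e {..<2} (?D i)" using ne by (auto simp: bij_betw_def inj_on_def 2)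
    fix n l :: nat assume nl: "n \<le> 2" "l < 2"
    have WV: "?W i \<subseteq> V" using C by (auto simp: V)
    have "n = 0 \<or> n = 1 \<or> n = 2" "l = 0 \<or> l = 1" using nl by auto
    then show "I (?v n) (?e l) \<longleftrightarrow> n = l \<or> n = Suc l"
      using ne WV C I[of _ "c i"] I[of _ "t (c i)"] mt[of "c i"] by auto
  qed
  have "disjoint_union_of_paths (card orb) 2 V E I"
    unfolding disjoint_union_of_paths_def
  proof (intro exI[of _ ?W] exI[of _ ?D] conjI allI impI ballI)
    show "V = (\<Union>i<card orb. ?W i)"
    proof
      show "V \<subseteq> (\<Union>i<card orb. ?W i)"
      proof
        fix v assume "v \<in> V"
        then obtain x where x: "x \<in> C" "v = m x \<or> v = f x" by (auto simp: V)
        obtain i where "i < card orb" "x \<in> {c i, t (c i)}" using reach x by blast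
        then show "v \<in> (\<Union>i<card orb. ?W i)" using x mt cC by auto
      qed
    qed (use cC in \<open>auto simp: V\<close>)
    show "E = (\<Union>i<card orb. ?D i)"
    proof
      show "E \<subseteq> (\<Union>i<card orb. ?D i)"
      proof
        fix d assume "d \<in> E"
        then obtain x where x: "x \<in> C" "d = e x" by (auto simp: E)
        obtain i where "i < card orb" "x \<in> {c i, t (c i)}" using reach x by blast
        then show "d \<in> (\<Union>i<card orb. ?D i)" using x by auto
      qed
    qed (use cC in \<open>auto simp: E\<close>)
    have sepm: "i = l" if "i < card orb" "l < card orb" "m (c i) = m (c l)" for i l
      using that sep[of i l "c l"] m[of "c i" "c l"] cC by auto
    have sepf: "i = l" if "i < card orb" "l < card orb" "f x = f y" "x \<in> {c i, t (c i)}" "y \<in> {c l, t (c l)}" for i l x y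
      using that sep[of i l x] feq[of x y] cC by auto
    have sepe: "i = l" if "i < card orb" "l < card orb" "e x = e y" "x \<in> {c i, t (c i)}" "y \<in> {c l, t (c l)}" for i l x y
      using that sep[of i l x] eeq[of x y] cC by auto
    have inW: "v = m (c i) \<or> (\<exists>x\<in>{c i, t (c i)}. v = f x)" if "v \<in> ?W i" for v i
      using that by auto
    have disjW: "i = l" if "i < card orb" "l < card orb" "v \<in> ?W i" "v \<in> ?W l" for i l v
    proof -
      have mfc: "m (c i) \<noteq> f x" if "i < card orb" "l < card orb" "x \<in> {c l, t (c l)}" for i l x
        using that mf cC by auto
      show ?thesis
        using inW[OF that(3)] inW[OF that(4)] that(1,2) sepm sepf mfc by metis
    qed
    then show "disjoint_family_on ?W {..<card orb}"
      unfolding disjoint_family_on_def by blast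
    show "disjoint_family_on ?D {..<card orb}"
      unfolding disjoint_family_on_def using sepe by (auto; metis insertCI)
    show "path_graph 2 (?W i) (?D i) I" if "i < card orb" for i using path that .
    fix i l v d
    assume il: "i < card orb" "l < card orb" "i \<noteq> l" and v: "v \<in> ?W i" and d: "d \<in> ?D l"
    obtain x where x: "x \<in> {c l, t (c l)}" "d = e x" using d by auto
    have "v \<in> V" using v cC[OF il(1)] by (auto simp: V)
    moreover have "x \<in> C" using x cC[OF il(2)] by auto
    moreover have "m x \<in> ?W l" "f x \<in> ?W l" using x mt cC[OF il(2)] by auto
    ultimately show "\<not> I v d" using I disjW[OF il(1,2) v] il(3) x(2) by metis
  qed
  then show "\<exists>N. 2 * N = card C \<and> disjoint_union_of_paths N 2 V E I" using N by blast
qed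

section \<open>The absolute geometry\<close>

text \<open>The geometry is treated for an abstract group; the input from matrices is concentrated
  in \<open>noncommuting\<close>, \<open>dihedral_inter\<close> and \<open>norm_one\<close>. The
  indices \<open>j\<close>, \<open>k\<close> are the types following 0 under \<open>a\<close>, left
  open so that both directions of the 3-cycle are covered.\<close>

locale triality_geometry = group G for G (structure) +
  fixes a :: "'a \<Rightarrow> 'a" and r0 r1 r2 r3 :: 'a and Hs :: "'a set list" and j k :: nat
  assumes fin: "finite (carrier G)"
    and a: "a \<in> iso G G" and a3: "x \<in> carrier G \<Longrightarrow> a (a (a x)) = x"
    and r [simp]: "r0 \<in> carrier G" "r1 \<in> carrier G" "r2 \<in> carrier G" and r3: "r3 = r0 \<otimes> r2"
    and sq [simp]: "r0 \<otimes> r0 = \<one>" "r1 \<otimes> r1 = \<one>" "r2 \<otimes> r2 = \<one>"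
    and r02: "r0 \<otimes> r2 = r2 \<otimes> r0"
    and ar [simp]: "a r0 = r2" "a r1 = r1" "a r2 = r3"
    and noncommuting: "r0 \<otimes> r1 \<noteq> r1 \<otimes> r0"
    and dihedral_inter: "g \<in> generate G {r0, r1} \<Longrightarrow> g \<in> generate G {r2, r1} \<Longrightarrow> g = \<one> \<or> g = r1"
    and norm_one: "g \<in> generate G {r0, r1} \<Longrightarrow> g \<otimes> a g \<otimes> a (a g) = \<one> \<Longrightarrow>
      g = \<one> \<or> g = r0 \<or> g = r1 \<otimes> r0 \<otimes> r1"
    and len: "length Hs = 4" and jk: "{j, k} = {2, 3}"
    and Hs: "Hs ! 0 = generate G {r0, r1}" "Hs ! 1 = generate G {r0, r2}"
      "Hs ! j = generate G {r1, r2}" "Hs ! k = generate G {r1, r3}"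
begin

lemma jk_cases: "j = 2 \<and> k = 3 \<or> j = 3 \<and> k = 2"
  using jk by (auto simp: doubleton_eq_iff)

lemma jk_simps [simp]: "j \<noteq> k" "k \<noteq> j" "0 \<noteq> j" "0 \<noteq> k" "1 \<noteq> j" "1 \<noteq> k" "j \<noteq> 0" "k \<noteq> 0" "j \<noteq> Suc 0" "k \<noteq> Suc 0"
  "Suc 0 \<noteq> j" "Suc 0 \<noteq> k" "0 < j" "0 < k" "j < 4" "k < 4"
  using jk_cases by auto

lemma lt4: "i < 4 \<longleftrightarrow> i = 0 \<or> i = 1 \<or> i = j \<or> i = k"
  using jk_cases by auto

lemma r3_closed [simp]: "r3 \<in> carrier G" by (simp add: r3)

lemma a_hom: "a \<in> hom G G" using a by (simp add: iso_def)

lemma a_mult [simp]: "x \<in> carrier G \<Longrightarrow> y \<in> carrier G \<Longrightarrow> a (x \<otimes> y) = a x \<otimes> a y"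
  and a_closed [simp]: "x \<in> carrier G \<Longrightarrow> a x \<in> carrier G"
  using a_hom by (auto simp: hom_def)

lemma a_one [simp]: "a \<one> = \<one>"
  using a_hom by (rule hom_one) (rule is_group)+

lemma a_eq_iff: "x \<in> carrier G \<Longrightarrow> y \<in> carrier G \<Longrightarrow> a x = a y \<longleftrightarrow> x = y"
  using a3 by metis

lemma mult_table:
  "r2 \<otimes> r0 = r3" "r0 \<otimes> r2 = r3" "r0 \<otimes> r3 = r2" "r3 \<otimes> r0 = r2"
  "r2 \<otimes> r3 = r0" "r3 \<otimes> r2 = r0" "r3 \<otimes> r3 = \<one>"
proof -
  show 1: "r2 \<otimes> r0 = r3" "r0 \<otimes> r2 = r3" using r02 r3 by simp_all
  show 2: "r0 \<otimes> r3 = r2" unfolding r3 by (simp add: m_assoc[symmetric])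
  show 3: "r2 \<otimes> r3 = r0" using 1 by (simp add: m_assoc[symmetric] flip: 1(1))
  show "r3 \<otimes> r0 = r2" unfolding 1(1)[symmetric] by (simp add: m_assoc)
  show 4: "r3 \<otimes> r2 = r0" unfolding r3 by (simp add: m_assoc)
  show "r3 \<otimes> r3 = \<one>" using 2 by (metis r3 m_assoc r r3_closed sq(3) 3 1(1) sq(1) 4)
qed

lemma ar3 [simp]: "a r3 = r0"
  using a_mult[of r0 r2] by (simp add: mult_table del: a_mult)

abbreviation "H0 \<equiv> generate G {r0, r1}"
abbreviation "H1 \<equiv> generate G {r0, r2}"
abbreviation "H2 \<equiv> generate G {r1, r2}"
abbreviation "H3 \<equiv> generate G {r1, r3}"

lemma subgroups [simp]: "subgroup H0 G" "subgroup H1 G" "subgroup H2 G" "subgroup H3 G"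
  by (rule generate_is_subgroup; simp)+

lemma H_subset: "H0 \<subseteq> carrier G" "H1 \<subseteq> carrier G" "H2 \<subseteq> carrier G" "H3 \<subseteq> carrier G"
  by (simp_all add: subgroup.subset)

lemma H_mem [simp]: "r0 \<in> H0" "r1 \<in> H0" "r0 \<in> H1" "r2 \<in> H1" "r1 \<in> H2" "r2 \<in> H2" "r1 \<in> H3" "r3 \<in> H3" "r3 \<in> H1"
proof -
  show "r0 \<in> H0" "r1 \<in> H0" "r0 \<in> H1" "r2 \<in> H1" "r1 \<in> H2" "r2 \<in> H2" "r1 \<in> H3" "r3 \<in> H3"
    by (auto intro: generate.incl)
  then show "r3 \<in> H1" unfolding r3 by (intro generate.eng)
qed

lemma a_H: "a ` H0 = H2" "a ` H1 = H1" "a ` H2 = H3" "a ` H3 = H0"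
proof -
  interpret h: group_hom G G a by (simp add: group_hom_def group_hom_axioms_def a_hom is_group)
  have im: "a ` generate G {x, y} = generate G {a x, a y}" if "x \<in> carrier G" "y \<in> carrier G" for x y
    using h.generate_img[of "{x, y}"] that by simp
  show "a ` H0 = H2" "a ` H2 = H3" "a ` H3 = H0"
    by (simp_all add: im insert_commute)
  have "generate G {r2, r3} \<subseteq> H1"
    by (rule generate_subgroup_incl) auto
  moreover have "r0 \<in> generate G {r2, r3}" "r2 \<in> generate G {r2, r3}"
    using generate.eng[of r2 G "{r2, r3}" r3] by (auto simp: mult_table generate.incl)
  then have "H1 \<subseteq> generate G {r2, r3}"
    by (intro generate_subgroup_incl generate_is_subgroup) auto
  ultimately show "a ` H1 = H1" by (simp add: im)
qed

lemma H1_eq: "H1 = {\<one>, r0, r2, r3}"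
proof
  have "subgroup {\<one>, r0, r2, r3} G"
  proof (rule subgroupI)
    fix x assume "x \<in> {\<one>, r0, r2, r3}"
    then show "inv x \<in> {\<one>, r0, r2, r3}"
      using inv_equality[OF sq(1)] inv_equality[OF sq(3)] inv_equality[OF mult_table(7)] by auto
  qed (auto simp: mult_table)
  then show "H1 \<subseteq> {\<one>, r0, r2, r3}" by (intro generate_subgroup_incl) auto
qed (auto intro: generate.one)

lemma distinct_r: "r0 \<noteq> \<one>" "r0 \<noteq> r1" "r2 \<noteq> \<one>" "r2 \<noteq> r1" "r0 \<noteq> r3"
proof -
  show 1: "r0 \<noteq> \<one>" using noncommuting by auto
  show 2: "r0 \<noteq> r1" using noncommuting by auto
  show 3: "r2 \<noteq> \<one>" using 1 a_eq_iff[of r0 \<one>] by simp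
  show "r2 \<noteq> r1" using 2 a_eq_iff[of r0 r1] by simp
  show "r0 \<noteq> r3" using 3 by (metis r3 r_cancel_one' r(1,3) l_cancel_one')
qed

lemma r2_notin: "r2 \<notin> H0"
  using dihedral_inter[of r2] distinct_r H_mem(6) by (auto simp: insert_commute)

lemma r3_notin: "r3 \<notin> H0"
proof
  assume "r3 \<in> H0"
  then have "r0 \<otimes> r3 \<in> H0" by (intro generate.eng) auto
  then show False using r2_notin by (simp add: mult_table)
qed

lemma a_image3:
  assumes "S \<subseteq> carrier G" shows "a ` a ` a ` S = S"
proof -
  have "(\<lambda>x. a (a (a x))) ` S = (\<lambda>x. x) ` S"
    by (rule image_cong) (use assms a3 in auto)
  then show ?thesis by (simp add: image_image)
qed

text \<open>The type of an image coset is a definite description over the list of subgroups;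
  distinctness makes it well defined.\<close>

lemma distinct_Hs: "distinct Hs"
proof -
  have 1: "H0 \<noteq> H1" "H0 \<noteq> H2" "H0 \<noteq> H3"
    using r2_notin r3_notin H_mem by metis+
  have "a ` H0 \<noteq> a ` H1" "a ` H0 \<noteq> a ` H2" "a ` (a ` H0) \<noteq> a ` (a ` H1)" "a ` (a ` H0) \<noteq> a ` (a ` H2)"
  proof -
    have *: "S = T" if "a ` S = a ` T" "S \<subseteq> carrier G" "T \<subseteq> carrier G" for S T
      using that a_image3 by metis
    show "a ` H0 \<noteq> a ` H1" "a ` H0 \<noteq> a ` H2" using 1 * H_subset by metis+
    then show "a ` (a ` H0) \<noteq> a ` (a ` H1)" "a ` (a ` H0) \<noteq> a ` (a ` H2)"
      using * H_subset by (metis a_H)+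
  qed
  then have 2: "H2 \<noteq> H1" "H2 \<noteq> H3" "H3 \<noteq> H1" by (simp_all add: a_H)
  show ?thesis
    unfolding distinct_conv_nth len
  proof (intro allI impI)
    fix i l :: nat assume "i < 4" "l < 4" "i \<noteq> l"
    then show "Hs ! i \<noteq> Hs ! l"
      unfolding lt4 by (elim disjE) (simp_all add: Hs Hs(2)[unfolded One_nat_def] 1 2 1[symmetric] 2[symmetric])
  qed
qed

lemma type_act: "(THE i. i < length Hs \<and> Hs ! i = Hs ! n) = n" if "n < 4"
  using that distinct_Hs by (intro the_equality) (auto simp: len nth_eq_iff_index_eq)

lemma act [simp]:
  "coset_act Hs a (0, S) = (j, a ` S)" "coset_act Hs a (j, S) = (k, a ` S)"
  "coset_act Hs a (k, S) = (0, a ` S)" "coset_act Hs a (Suc 0, S) = (Suc 0, a ` S)"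
  using type_act[of 0] type_act[of 1] type_act[of j] type_act[of k]
  by (simp_all add: coset_act_def Hs Hs(2)[unfolded One_nat_def] a_H)

lemma a_coset: "H \<subseteq> carrier G \<Longrightarrow> x \<in> carrier G \<Longrightarrow> a ` (H #> x) = (a ` H) #> a x"
  by (force simp: r_coset_def image_iff)

lemma a_inter:
  assumes "S \<subseteq> carrier G" "T \<subseteq> carrier G" "S \<inter> T \<noteq> {}"
  shows "a ` S \<inter> a ` T \<noteq> {}"
  using assms by blast

text \<open>The orbit of the type 0 element \<open>S\<close> under the triality. An absolute point
  is determined by its coset of type 0.\<close>

definition tri :: "'a set \<Rightarrow> (nat \<times> 'a set) set" where
  "tri S = {(0, S), (j, a ` S), (k, a ` a ` S)}"

lemma tri_inject: "tri S = tri T \<longleftrightarrow> S = T"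
proof
  assume "tri S = tri T"
  moreover have "(0, S) \<in> tri S" by (simp add: tri_def)
  ultimately have "(0, S) \<in> tri T" by simp
  then show "S = T" by (auto simp: tri_def)
qed simp

lemma types_tri: "fst ` tri S = {0, 2, 3}"
  using jk_cases by (auto simp: tri_def)

lemma rcoset_subset: "H \<subseteq> carrier G \<Longrightarrow> S \<in> rcosets H \<Longrightarrow> S \<subseteq> carrier G"
  by (auto simp: RCOSETS_def r_coset_def)

lemma a_rcosets:
  assumes "H \<subseteq> carrier G" "S \<in> rcosets H"
  shows "a ` S \<in> rcosets (a ` H)"
proof -
  obtain x where "x \<in> carrier G" "S = H #> x" using assms by (auto simp: RCOSETS_def)
  then show ?thesis using assms by (simp add: a_coset) (auto intro!: rcosetsI)
qed

lemma rcoset_repr: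
  assumes "S \<in> rcosets H" "subgroup H G" "y \<in> S"
  shows "S = H #> y"
proof -
  obtain x where "x \<in> carrier G" "S = H #> x" using assms(1) by (auto simp: RCOSETS_def)
  then show ?thesis using repr_independence assms by metis
qed

lemma tri_elements:
  assumes S: "S \<in> rcosets H0"
  shows "tri S \<subseteq> coset_elements G Hs"
proof -
  have "a ` S \<in> rcosets H2" using a_rcosets[OF H_subset(1) S] by (simp add: a_H)
  moreover from this have "a ` a ` S \<in> rcosets H3" using a_rcosets[OF H_subset(3)] by (simp add: a_H)
  ultimately show ?thesis using S by (auto simp: tri_def coset_elements_def len Hs)
qed

text \<open>One intersection suffices: applying \<open>a\<close> produces the other two, as its cube
  is the identity.\<close>

lemma flag_tri:
  assumes S: "S \<in> rcosets H0" and i: "S \<inter> a ` S \<noteq> {}"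
  shows "invariant_flag G Hs a (tri S)"
proof -
  have c: "S \<subseteq> carrier G" using rcoset_subset[OF H_subset(1) S] .
  then have c': "a ` S \<subseteq> carrier G" "a ` a ` S \<subseteq> carrier G" by auto
  have 1: "a ` S \<inter> a ` a ` S \<noteq> {}" using a_inter[OF c c'(1) i] .
  have 2: "a ` a ` S \<inter> S \<noteq> {}" using a_inter[OF c' 1] by (simp add: a_image3 c)
  have "flag G Hs (tri S)"
    unfolding flag_def using tri_elements[OF S] i 1 2
    by (auto simp: tri_def incident_def Int_commute)
  moreover have "coset_act Hs a ` tri S = tri S"
    by (auto simp: tri_def a_image3[OF c])
  ultimately show ?thesis by (simp add: invariant_flag_def)
qed

lemma tri_absolute:
  assumes S: "S \<in> rcosets H0" and i: "S \<inter> a ` S \<noteq> {}"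
  shows "tri S \<in> absolute_elements G Hs a"
proof -
  have c: "S \<subseteq> carrier G" using rcoset_subset[OF H_subset(1) S] .
  have "F = tri S" if F: "F \<noteq> {}" "F \<subseteq> tri S" "coset_act Hs a ` F = F" for F
  proof -
    have act_in: "coset_act Hs a p \<in> F" if "p \<in> F" for p using that F(3) by blast
    obtain p where "p \<in> F" using F(1) by blast
    moreover have "(0, S) \<in> F \<Longrightarrow> (j, a ` S) \<in> F" "(j, a ` S) \<in> F \<Longrightarrow> (k, a ` a ` S) \<in> F"
      "(k, a ` a ` S) \<in> F \<Longrightarrow> (0, S) \<in> F"
      using act_in[of "(0, S)"] act_in[of "(j, a ` S)"] act_in[of "(k, a ` a ` S)"]
      by (simp_all add: a_image3[OF c])
    ultimately have "tri S \<subseteq> F" using F(2) by (auto simp: tri_def)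
    then show ?thesis using F(2) by blast
  qed
  then show ?thesis
    using flag_tri[OF assms] unfolding absolute_elements_def
    by (auto simp: invariant_flag_def) (auto simp: tri_def)
qed

text \<open>Fixed points parametrise all absolute elements: \<open>mid x\<close> and
  \<open>leaf x\<close> are the two ends of \<open>edge x\<close>, coming from the cosets of
  \<open>H0\<close> that contain \<open>x\<close> and \<open>r2 \<otimes> x\<close>.\<close>

definition "fixed = {x \<in> carrier G. a x = x}"
definition "edge x = {(Suc 0, H1 #> x)}"
definition "mid x = tri (H0 #> x)"
definition "leaf x = tri (H0 #> (r2 \<otimes> x))"

lemma fixed_carrier: "x \<in> fixed \<Longrightarrow> x \<in> carrier G" and fixed_a: "x \<in> fixed \<Longrightarrow> a x = x"
  by (auto simp: fixed_def)

lemma edge_absolute: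
  assumes "x \<in> fixed" shows "edge x \<in> absolute_elements G Hs a"
proof -
  have x: "x \<in> carrier G" "a x = x" using assms by (auto simp: fixed_def)
  have "H1 #> x \<in> rcosets H1" using x H_subset by (simp add: rcosetsI)
  then have "flag G Hs (edge x)"
    using Hs(2) by (auto simp: flag_def edge_def coset_elements_def len incident_def)
  moreover have "coset_act Hs a ` edge x = edge x"
    using x H_subset by (simp add: edge_def a_coset a_H)
  ultimately show ?thesis
    unfolding absolute_elements_def by (auto simp: invariant_flag_def edge_def)
qed

lemma coset_H0: "h \<in> H0 \<Longrightarrow> x \<in> carrier G \<Longrightarrow> H0 #> (h \<otimes> x) = H0 #> x"
  using H_subset(1) by (metis coset_join2 coset_mult_assoc subgroups(1) subsetD)

text \<open>Since \<open>r3 \<otimes> x = r0 \<otimes> (r2 \<otimes> x)\<close>, and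
  \<open>a\<close> maps this coset to the one of \<open>H2\<close> through
  \<open>r3 \<otimes> x\<close>, the point \<open>r3 \<otimes> x\<close> shows that the coset meets
  its image.\<close>

lemma r3_leaf: "x \<in> carrier G \<Longrightarrow> r3 \<otimes> x \<in> H0 #> (r2 \<otimes> x)"
  using coset_H0[of r0 "r2 \<otimes> x"] rcos_self[OF _ subgroups(1), of "r3 \<otimes> x"]
  by (simp add: m_assoc[symmetric] mult_table)

lemma a_leaf: "x \<in> fixed \<Longrightarrow> a ` (H0 #> (r2 \<otimes> x)) = H2 #> (r3 \<otimes> x)"
  by (simp add: a_coset H_subset a_H fixed_carrier fixed_a)

lemma a_mid: "x \<in> fixed \<Longrightarrow> a ` (H0 #> x) = H2 #> x"
  by (simp add: a_coset H_subset a_H fixed_carrier fixed_a)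

lemma mid_absolute: "x \<in> fixed \<Longrightarrow> mid x \<in> absolute_elements G Hs a"
  unfolding mid_def
  using rcos_self[OF fixed_carrier subgroups(1), of x] rcos_self[OF fixed_carrier subgroups(3), of x]
  by (intro tri_absolute) (auto simp: a_mid rcosetsI fixed_carrier H_subset)

lemma leaf_absolute: "x \<in> fixed \<Longrightarrow> leaf x \<in> absolute_elements G Hs a"
  unfolding leaf_def
  using r3_leaf[OF fixed_carrier, of x] rcos_self[of "r3 \<otimes> x" H2] fixed_carrier[of x]
  by (intro tri_absolute) (auto simp: a_leaf rcosetsI fixed_carrier H_subset)

lemma vertex_cases:
  assumes S: "S \<in> rcosets H0" and i: "S \<inter> a ` S \<noteq> {}"
  shows "\<exists>x\<in>fixed. tri S = mid x \<or> tri S = leaf x"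
proof -
  obtain z where z: "z \<in> S" "a z \<in> S" using i by blast
  define y where "y = a z"
  have zc: "z \<in> carrier G" using rcoset_subset[OF H_subset(1) S] z by blast
  then have yc: "y \<in> carrier G" by (simp add: y_def)
  have Sy: "S = H0 #> y"
    using rcoset_repr[OF S subgroups(1) z(2)] by (simp add: y_def)
  then obtain g where g: "g \<in> H0" "z = g \<otimes> y" using z(1) by (auto simp: r_coset_def)
  have gc: "g \<in> carrier G" using g H_subset by blast
  have y1: "y = a g \<otimes> a y" using arg_cong[OF g(2), of a] yc gc by (simp add: y_def[symmetric])
  have y2: "a y = a (a g) \<otimes> a (a y)" using arg_cong[OF y1, of a] yc gc by simp
  have y3: "a (a y) = g \<otimes> y" using arg_cong[OF y2, of a] yc gc by (simp add: a3)
  \<comment> \<open>The relation \<open>y = a g \<otimes> a y\<close> and its two images under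
    \<open>a\<close> telescope around the 3-cycle to the norm condition on \<open>g\<close>.\<close>
  have "g \<otimes> a g \<otimes> a (a g) \<otimes> a (a y) = g \<otimes> (a g \<otimes> (a (a g) \<otimes> a (a y)))"
    using gc yc by (simp add: m_assoc)
  also have "\<dots> = g \<otimes> y" using y1 y2 by simp
  also have "\<dots> = \<one> \<otimes> a (a y)" using y3 gc yc by simp
  finally have "g \<otimes> a g \<otimes> a (a g) = \<one>" using gc yc by (subst (asm) r_cancel) auto
  moreover have leaf: ?thesis if "w \<in> carrier G" "a w = r2 \<otimes> w" "S = H0 #> w" for w
  proof -
    \<comment> \<open>\<open>a\<close> sends \<open>r3 \<otimes> w\<close> to
      \<open>r0 \<otimes> (r2 \<otimes> w)\<close>, which is \<open>r3 \<otimes> w\<close>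
      again.\<close>
    have "r3 \<otimes> w \<in> fixed"
      using that by (simp add: fixed_def m_assoc[symmetric] mult_table)
    moreover have "r2 \<otimes> (r3 \<otimes> w) = r0 \<otimes> w" using that by (simp add: m_assoc[symmetric] mult_table)
    then have "tri S = leaf (r3 \<otimes> w)" using that by (simp add: leaf_def coset_H0)
    ultimately show ?thesis by blast
  qed
  ultimately consider "g = \<one>" | "g = r0" | "g = r1 \<otimes> r0 \<otimes> r1" using norm_one g(1) by blast
  then show ?thesis
  proof cases
    case 1
    then have "y \<in> fixed" using y1 yc by (simp add: fixed_def)
    then show ?thesis using Sy by (auto simp: mid_def)
  next
    case 2
    then have y: "a y = r2 \<otimes> y"
      using y1 yc by (metis a_closed ar(1) l_one m_assoc r(3) sq(3))
    then show ?thesis using leaf[OF yc] Sy by blast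
  next
    case 3
    \<comment> \<open>Passing to another representative of the same coset of \<open>H0\<close>
      reduces this case to the equation of the previous one.\<close>
    let ?y = "r1 \<otimes> y"
    have ag: "a g = r1 \<otimes> r2 \<otimes> r1" using 3 by simp
    have "r2 \<otimes> ?y = r2 \<otimes> (r1 \<otimes> (r1 \<otimes> r2 \<otimes> r1 \<otimes> a y))" using y1 ag by simp
    also have "\<dots> = r2 \<otimes> ((r1 \<otimes> r1) \<otimes> (r2 \<otimes> (r1 \<otimes> a y)))" using yc by (simp add: m_assoc del: sq)
    also have "\<dots> = (r2 \<otimes> r2) \<otimes> (r1 \<otimes> a y)" using yc by (simp add: m_assoc del: sq(3))
    also have "\<dots> = a ?y" using yc by simp
    finally have y: "a ?y = r2 \<otimes> ?y" by simp
    show ?thesis using leaf[of ?y] y Sy yc by (simp add: coset_H0)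
  qed
qed

lemma edge_cases:
  assumes T: "T \<in> rcosets H1" and aT: "a ` T = T"
  shows "\<exists>x\<in>fixed. {(Suc 0, T)} = edge x"
proof -
  obtain y where y: "y \<in> carrier G" "T = H1 #> y" using T by (auto simp: RCOSETS_def)
  have "a y \<in> H1 #> y" using aT y rcos_self[OF y(1) subgroups(2)] by blast
  then obtain h where h: "h \<in> H1" "a y = h \<otimes> y" by (auto simp: r_coset_def)
  \<comment> \<open>Lang's argument on the four-group: \<open>a\<close> has no nontrivial fixed
    point there, so every \<open>h\<close> is of the form \<open>inv (a v) \<otimes> v\<close>, and
    \<open>v \<otimes> y\<close> is a fixed representative.\<close>
  have "\<exists>v\<in>H1. a v \<otimes> h = v"
    using h(1) unfolding H1_eq by (auto simp: mult_table)
  then obtain v where v: "v \<in> H1" "a v \<otimes> h = v" by blast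
  have c: "v \<in> carrier G" "h \<in> carrier G" using v h H_subset by auto
  then have "v \<otimes> y \<in> fixed" using v y h by (simp add: fixed_def m_assoc[symmetric])
  moreover have "H1 #> (v \<otimes> y) = T"
    using y v c H_subset(2) by (metis coset_join2 coset_mult_assoc subgroups(2))
  ultimately show ?thesis by (auto simp: edge_def)
qed

text \<open>An invariant flag with an element of type 1 contains its image of the same type, and
  incidence makes the two equal. Any other element has a coset of type 0 in its orbit. In both cases
  minimality identifies the flag with the orbit.\<close>

lemma absolute_cases:
  assumes F: "F \<in> absolute_elements G Hs a"
  shows "\<exists>x\<in>fixed. F = mid x \<or> F = leaf x \<or> F = edge x"
proof -
  have F1: "F \<noteq> {}" "F \<subseteq> coset_elements G Hs" "\<And>x y. x \<in> F \<Longrightarrow> y \<in> F \<Longrightarrow> incident x y"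
    and F2: "coset_act Hs a ` F = F"
    and F3: "\<And>F'. F' \<noteq> {} \<Longrightarrow> F' \<subseteq> F \<Longrightarrow> invariant_flag G Hs a F' \<Longrightarrow> F' = F"
    using F by (auto simp: absolute_elements_def invariant_flag_def flag_def)
  have act_in: "coset_act Hs a p \<in> F" if "p \<in> F" for p using that F2 by blast
  obtain i T where iT: "(i, T) \<in> F" using F1(1) by auto
  then have "i < 4" "T \<in> rcosets (Hs ! i)" using F1(2) by (auto simp: coset_elements_def len)
  consider "i = 1" | S where "(0, S) \<in> F"
    using iT \<open>i < 4\<close> act_in[OF iT] act_in[OF act_in[OF iT]] unfolding lt4 by auto
  then show ?thesis
  proof cases
    case 1
    then have T: "T \<in> rcosets H1" "(Suc 0, T) \<in> F" using \<open>T \<in> _\<close> Hs(2) iT by auto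
    then have "(Suc 0, a ` T) \<in> F" using act_in[of "(Suc 0, T)"] by simp
    then have "incident (Suc 0, T) (Suc 0, a ` T)" using F1(3) T(2) by blast
    then have "a ` T = T" by (simp add: incident_def)
    then obtain x where x: "x \<in> fixed" "{(Suc 0, T)} = edge x" using edge_cases[OF T(1)] by blast
    have "edge x = F"
      using F3[of "edge x"] edge_absolute[OF x(1)] x(2)[symmetric] T(2)
      by (simp add: absolute_elements_def)
    then show ?thesis using x by blast
  next
    case 2
    then have S: "S \<in> rcosets H0" using F1(2) Hs(1) by (auto simp: coset_elements_def len)
    have sub: "tri S \<subseteq> F"
      using 2 act_in[OF 2] act_in[OF act_in[OF 2]] by (simp add: tri_def)
    then have "incident (0, S) (j, a ` S)" using F1(3) by (auto simp: tri_def)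
    then have i: "S \<inter> a ` S \<noteq> {}" by (simp add: incident_def)
    have "tri S = F" using F3[OF _ sub flag_tri[OF S i]] by (simp add: tri_def)
    then show ?thesis using vertex_cases[OF S i] by auto
  qed
qed

lemma types: "fst ` mid x = {0, 2, 3}" "fst ` leaf x = {0, 2, 3}" "fst ` edge x = {1}"
  by (auto simp: mid_def leaf_def types_tri edge_def)

lemma absolute_vertices: "absolute_elements_of_type G Hs a {0, 2, 3} = mid ` fixed \<union> leaf ` fixed"
proof (intro equalityI subsetI)
  fix F assume "F \<in> absolute_elements_of_type G Hs a {0, 2, 3}"
  then have F: "F \<in> absolute_elements G Hs a" "fst ` F = {0, 2, 3}"
    by (simp_all add: absolute_elements_of_type_def)
  have "{0, 2, 3} \<noteq> {1 :: nat}" by auto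
  then have "F \<noteq> edge x" for x using F(2) types(3) by metis
  then show "F \<in> mid ` fixed \<union> leaf ` fixed" using absolute_cases[OF F(1)] by blast
next
  fix F assume "F \<in> mid ` fixed \<union> leaf ` fixed"
  then show "F \<in> absolute_elements_of_type G Hs a {0, 2, 3}"
    unfolding absolute_elements_of_type_def
    by (elim UnE imageE) (simp_all add: mid_absolute leaf_absolute types)
qed

lemma absolute_edges: "absolute_elements_of_type G Hs a {1} = edge ` fixed"
proof (intro equalityI subsetI)
  fix F assume "F \<in> absolute_elements_of_type G Hs a {1}"
  then have F: "F \<in> absolute_elements G Hs a" "fst ` F = {1}"
    by (simp_all add: absolute_elements_of_type_def)
  have "{0, 2, 3} \<noteq> {1 :: nat}" by auto
  then have "F \<noteq> mid x" "F \<noteq> leaf x" for x using F(2) types(1,2) by metis+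
  then show "F \<in> edge ` fixed" using absolute_cases[OF F(1)] by blast
next
  fix F assume "F \<in> edge ` fixed"
  then show "F \<in> absolute_elements_of_type G Hs a {1}"
    unfolding absolute_elements_of_type_def
    by (elim imageE) (simp add: edge_absolute types)
qed

lemma absolute_all:
  "absolute_elements G Hs a =
    absolute_elements_of_type G Hs a {0, 2, 3} \<union> absolute_elements_of_type G Hs a {1}"
  unfolding absolute_vertices absolute_edges
  using absolute_cases mid_absolute leaf_absolute edge_absolute by blast

text \<open>The four elements of \<open>H1\<close> fall into two right cosets of the subgroup
  generated by \<open>r0\<close>, represented by 1 and \<open>r2\<close>, and \<open>r0\<close> is
  absorbed by \<open>H0\<close>.\<close>

lemma meets_edge:
  assumes S: "S \<in> rcosets H0" and x: "x \<in> carrier G"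
  shows "S \<inter> (H1 #> x) \<noteq> {} \<longleftrightarrow> S = H0 #> x \<or> S = H0 #> (r2 \<otimes> x)"
proof
  assume "S \<inter> (H1 #> x) \<noteq> {}"
  then obtain v where v: "v \<in> H1" "v \<otimes> x \<in> S" by (auto simp: r_coset_def)
  have "S = H0 #> (v \<otimes> x)" using rcoset_repr[OF S subgroups(1) v(2)] .
  moreover have "v = \<one> \<or> v = r0 \<or> v = r2 \<or> v = r3" using v(1) by (simp add: H1_eq)
  moreover have "H0 #> (r3 \<otimes> x) = H0 #> (r2 \<otimes> x)"
    using coset_H0[of r0 "r2 \<otimes> x"] x by (simp add: m_assoc[symmetric] mult_table)
  ultimately show "S = H0 #> x \<or> S = H0 #> (r2 \<otimes> x)" using coset_H0[of r0 x] x by auto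
next
  have "x \<in> H1 #> x" using rcos_self x by simp
  moreover have "r2 \<otimes> x \<in> H1 #> x" using x by (auto simp: r_coset_def)
  moreover have "x \<in> H0 #> x" "r2 \<otimes> x \<in> H0 #> (r2 \<otimes> x)" using rcos_self x by simp_all
  moreover assume "S = H0 #> x \<or> S = H0 #> (r2 \<otimes> x)"
  ultimately show "S \<inter> (H1 #> x) \<noteq> {}" by blast
qed

lemma incidence:
  assumes v: "v \<in> mid ` fixed \<union> leaf ` fixed" and x: "x \<in> fixed"
  shows "absolute_incident G Hs v (edge x) \<longleftrightarrow> v = mid x \<or> v = leaf x"
proof -
  obtain S where S: "S \<in> rcosets H0" "v = tri S"
  proof -
    have "H0 #> y \<in> rcosets H0" "H0 #> (r2 \<otimes> y) \<in> rcosets H0" if "y \<in> fixed" for y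
      using fixed_carrier[OF that] by (simp_all add: rcosetsI H_subset)
    then show ?thesis using v that unfolding mid_def leaf_def by blast
  qed
  have fv: "flag G Hs v"
    using v mid_absolute leaf_absolute by (auto simp: absolute_elements_def invariant_flag_def)
  have fe: "flag G Hs (edge x)"
    using edge_absolute[OF x] by (auto simp: absolute_elements_def invariant_flag_def)
  let ?T = "H1 #> x"
  have Sc: "S \<subseteq> carrier G" using rcoset_subset[OF H_subset(1) S(1)] .
  have Tc: "?T \<subseteq> carrier G" using r_coset_subset_G H_subset(2) fixed_carrier[OF x] by blast
  have aT: "a ` ?T = ?T" using x by (simp add: a_coset H_subset a_H fixed_carrier fixed_a)
  have "absolute_incident G Hs v (edge x) \<longleftrightarrow> S \<inter> ?T \<noteq> {}"
  proof
    assume "absolute_incident G Hs v (edge x)"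
    then have "incident (0, S) (Suc 0, ?T)"
      unfolding absolute_incident_def flag_def by (auto simp: S edge_def tri_def)
    then show "S \<inter> ?T \<noteq> {}" by (simp add: incident_def)
  next
    assume 1: "S \<inter> ?T \<noteq> {}"
    have 2: "a ` S \<inter> ?T \<noteq> {}" using a_inter[OF Sc Tc 1] by (simp add: aT)
    have 3: "a ` a ` S \<inter> ?T \<noteq> {}" using a_inter[OF _ Tc 2] Sc by (force simp: aT)
    have "incident p q \<and> incident q p" if "p \<in> v" "q \<in> edge x" for p q
    proof -
      have "p = (0, S) \<or> p = (j, a ` S) \<or> p = (k, a ` a ` S)" "q = (Suc 0, ?T)"
        using that by (simp_all add: S(2) tri_def edge_def)
      then show ?thesis
        using 1 2 3 by (elim disjE) (simp_all add: incident_def Int_commute)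
    qed
    then show "absolute_incident G Hs v (edge x)"
      using fv fe unfolding absolute_incident_def flag_def by blast
  qed
  then show ?thesis
    using meets_edge[OF S(1) fixed_carrier[OF x]] S(2) by (simp add: mid_def leaf_def tri_inject)
qed

section \<open>Coincidences among absolute points and edges\<close>

lemma quotient_in_subgroup:
  assumes "subgroup H G" "x \<in> H #> z" "y \<in> H #> z" "z \<in> carrier G"
  shows "y \<otimes> inv x \<in> H"
proof -
  have "x \<in> carrier G" using assms by (meson r_coset_subset_G subgroup.subset subsetD)
  moreover have "y \<in> carrier G" using assms by (meson r_coset_subset_G subgroup.subset subsetD)
  moreover have "y \<in> H #> x" using assms repr_independence by metis
  ultimately show ?thesis using subgroup.rcos_module[OF assms(1) is_group] by blast
qed

text \<open>Two common points of \<open>S\<close> and its image differ by an element of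
  \<open>H0\<close> and \<open>H2\<close>, that is, by 1 or \<open>r1\<close>. This recovers the
  fixed point from the vertex up to \<open>r1\<close>.\<close>

lemma same_vertex:
  assumes S: "S = H0 #> z" and aS: "a ` S = H2 #> w" and c: "z \<in> carrier G" "w \<in> carrier G"
    and x: "x \<in> S" "x \<in> a ` S" and y: "y \<in> S" "y \<in> a ` S"
  shows "y = x \<or> y = r1 \<otimes> x"
proof -
  have xc: "x \<in> carrier G" "y \<in> carrier G"
    using S c x y H_subset(1) by (metis r_coset_subset_G subsetD)+
  have "y \<otimes> inv x \<in> H0"
    using quotient_in_subgroup[OF subgroups(1)] S c x y by blast
  moreover have "y \<otimes> inv x \<in> H2"
    using quotient_in_subgroup[OF subgroups(3)] aS c x y by metis
  ultimately have "y \<otimes> inv x = \<one> \<or> y \<otimes> inv x = r1"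
    using dihedral_inter by (simp add: insert_commute)
  moreover have "(y \<otimes> inv x) \<otimes> x = y" using xc by (simp add: m_assoc)
  ultimately show ?thesis using l_one[OF xc(1)] by metis
qed

lemma mid_eq_iff:
  assumes "x \<in> fixed" "y \<in> fixed"
  shows "mid x = mid y \<longleftrightarrow> y = x \<or> y = r1 \<otimes> x"
proof
  note c = fixed_carrier[OF assms(1)] fixed_carrier[OF assms(2)]
  assume "mid x = mid y"
  then have eq: "H0 #> x = H0 #> y" by (simp add: mid_def tri_inject)
  have "a ` (H0 #> x) = H2 #> y" using a_mid[OF assms(2)] eq by simp
  then show "y = x \<or> y = r1 \<otimes> x"
    using eq c a_mid[OF assms(1)] rcos_self[OF c(1)] rcos_self[OF c(2)]
    by (intro same_vertex[of "H0 #> x" x x]) auto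
next
  assume "y = x \<or> y = r1 \<otimes> x"
  then show "mid x = mid y" using fixed_carrier[OF assms(1)] by (auto simp: mid_def coset_H0)
qed

lemma leaf_inj: "inj_on leaf fixed"
proof (rule inj_onI, rule ccontr)
  fix x y assume xy: "x \<in> fixed" "y \<in> fixed" "leaf x = leaf y" "x \<noteq> y"
  note c = fixed_carrier[OF xy(1)] fixed_carrier[OF xy(2)]
  have eq: "H0 #> (r2 \<otimes> x) = H0 #> (r2 \<otimes> y)" using xy by (simp add: leaf_def tri_inject)
  then have eq2: "H2 #> (r3 \<otimes> x) = H2 #> (r3 \<otimes> y)" using a_leaf xy by metis
  have "r3 \<otimes> y = r3 \<otimes> x \<or> r3 \<otimes> y = r1 \<otimes> (r3 \<otimes> x)"
    using eq eq2 c r3_leaf[OF c(1)] r3_leaf[OF c(2)] a_leaf[OF xy(1)]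
      rcos_self[of "r3 \<otimes> x" H2] rcos_self[of "r3 \<otimes> y" H2]
    by (intro same_vertex[of "H0 #> (r2 \<otimes> x)" "r2 \<otimes> x" "r3 \<otimes> x"]) auto
  \<comment> \<open>Applying \<open>a\<close>, which fixes \<open>x\<close> and \<open>y\<close>,
    yields a second equation; together they make \<open>r2\<close> commute with \<open>r1\<close>,
    and two further applications of \<open>a\<close> carry this back to \<open>r0\<close>.\<close>
  then have y: "r3 \<otimes> y = r1 \<otimes> (r3 \<otimes> x)" using c xy(4) by simp
  then have "a (r3 \<otimes> y) = a (r1 \<otimes> (r3 \<otimes> x))" by simp
  then have y': "r0 \<otimes> y = r1 \<otimes> (r0 \<otimes> x)" using c xy by (simp add: fixed_a)
  have "r2 \<otimes> (r1 \<otimes> (r0 \<otimes> x)) = r1 \<otimes> (r3 \<otimes> x)"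
    using y y' c by (metis m_assoc mult_table(1) r(1,3))
  then have "(r2 \<otimes> r1) \<otimes> (r0 \<otimes> x) = (r1 \<otimes> r2) \<otimes> (r0 \<otimes> x)"
    using c by (simp add: m_assoc flip: mult_table(1))
  then have "a (a (r2 \<otimes> r1)) = a (a (r1 \<otimes> r2))" using c by simp
  then show False using noncommuting by simp
qed

text \<open>Otherwise \<open>r3 \<otimes> y\<close> would be \<open>x\<close> or
  \<open>r1 \<otimes> x\<close>, both fixed, whereas \<open>a\<close> sends it to
  \<open>r0 \<otimes> y\<close>.\<close>

lemma mid_neq_leaf:
  assumes "x \<in> fixed" "y \<in> fixed"
  shows "mid x \<noteq> leaf y"
proof
  note c = fixed_carrier[OF assms(1)] fixed_carrier[OF assms(2)]
  assume "mid x = leaf y"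
  then have eq: "H0 #> x = H0 #> (r2 \<otimes> y)" by (simp add: mid_def leaf_def tri_inject)
  then have eq2: "H2 #> x = H2 #> (r3 \<otimes> y)" using a_leaf a_mid assms by metis
  have "r3 \<otimes> y = x \<or> r3 \<otimes> y = r1 \<otimes> x"
    using eq eq2 c r3_leaf[OF c(2)] a_mid[OF assms(1)]
      rcos_self[of x H0] rcos_self[of x H2] rcos_self[of "r3 \<otimes> y" H2]
    by (intro same_vertex[of "H0 #> x" x x]) auto
  moreover have "a x = x" "a (r1 \<otimes> x) = r1 \<otimes> x" using c assms by (simp_all add: fixed_a)
  ultimately have "a (r3 \<otimes> y) = r3 \<otimes> y" by metis
  moreover have "a (r3 \<otimes> y) = r0 \<otimes> y" using c assms by (simp add: fixed_a)
  ultimately have "r0 = r3" using c by simp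
  then show False using distinct_r by simp
qed

lemma edge_inj: "inj_on edge fixed"
proof (rule inj_onI)
  fix x y assume xy: "x \<in> fixed" "y \<in> fixed" "edge x = edge y"
  note c = fixed_carrier[OF xy(1)] fixed_carrier[OF xy(2)]
  have "y \<in> H1 #> x" using xy c rcos_self[OF c(2) subgroups(2)] by (simp add: edge_def)
  then obtain v where v: "v \<in> H1" "y = v \<otimes> x" by (auto simp: r_coset_def)
  have vc: "v \<in> carrier G" using v H_subset by blast
  have "a v \<otimes> x = v \<otimes> x" using xy v vc c by (metis a_mult fixed_a)
  then have "a v = v" using vc c by simp
  then have "v = \<one>"
    using v(1) distinct_r a_eq_iff[of r0 r2] unfolding H1_eq by (auto simp: mult_table)
  then show "x = y" using v c by simp
qed

theorem absolute_geometry: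
  assumes V: "V = absolute_elements_of_type G Hs a {0, 2, 3}"
    and E: "E = absolute_elements_of_type G Hs a {1}"
  shows "absolute_elements G Hs a = V \<union> E \<and>
    incidence_graph V E (absolute_incident G Hs) \<and>
    (\<exists>N. 2 * N = card fixed \<and> disjoint_union_of_paths N 2 V E (absolute_incident G Hs))"
proof -
  have "incidence_graph V E (absolute_incident G Hs) \<and>
    (\<exists>N. 2 * N = card fixed \<and> disjoint_union_of_paths N 2 V E (absolute_incident G Hs))"
  proof (rule pairing_path_union[where t = "\<lambda>x. r1 \<otimes> x" and m = mid and f = leaf and e = edge])
    show "finite fixed" using fin by (simp add: fixed_def)
    fix x assume x: "x \<in> fixed"
    then show "r1 \<otimes> x \<in> fixed" by (simp add: fixed_def)
    show "r1 \<otimes> (r1 \<otimes> x) = x" using fixed_carrier[OF x] by (simp add: m_assoc[symmetric])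
    have "r1 \<noteq> \<one>" using noncommuting by auto
    then show "r1 \<otimes> x \<noteq> x" using fixed_carrier[OF x] by (simp add: l_cancel_one')
  qed (use mid_eq_iff leaf_inj edge_inj mid_neq_leaf incidence in \<open>auto simp: V E absolute_vertices absolute_edges simp del: One_nat_def\<close>)
  then show ?thesis using absolute_all V E by simp
qed

end

text \<open>By Cayley-Hamilton \<open>M ** M = scal (tr M) M - mat 1\<close>. If the square is
  scalar and the trace is nonzero, \<open>M\<close> itself is scalar and its class trivial.\<close>

lemma involution_traceless:
  assumes M: "det M = 1" and ne: "pr M \<noteq> pr (mat 1)" and sq: "pr (M ** M) = pr (mat (1::'a::field))"
  shows "tr M = 0"
proof -
  obtain a b c d where Mk: "M = mk a b c d" by (rule mk_cases)
  have d: "a * d - b * c = 1" using M by (simp add: Mk)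
  have *: "M ** M = - mat 1 + scal (a + d) M"
    using d by (simp add: Mk mat_mk algebra_simps)
  show ?thesis
  proof (rule ccontr)
    assume "tr M \<noteq> 0"
    then have t: "a + d \<noteq> 0" by (simp add: Mk)
    obtain k where "M ** M = mat k" using sq by (auto simp: pr_eq_iff mat_mk)
    then have "(a + d) * b = 0" "(a + d) * c = 0" "(a + d) * a = (a + d) * d"
      unfolding * by (auto simp: Mk mat_mk)
    then have bc: "b = 0" "c = 0" "a = d" using t by auto
    then have "a * a = 1" using d by simp
    then have "a = 1 \<or> a = - 1" by (metis power2_eq_1_iff power2_eq_square)
    then show False using ne bc by (auto simp: Mk mat_mk pr_eq_iff)
  qed
qed

lemma (in group) commute_with_generate:
  assumes S: "S \<subseteq> carrier G" and y: "y \<in> carrier G" and c: "\<And>s. s \<in> S \<Longrightarrow> s \<otimes> y = y \<otimes> s"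
    and x: "x \<in> generate G S"
  shows "x \<otimes> y = y \<otimes> x"
  using x
proof (induction rule: generate.induct)
  case (inv h)
  then have h: "h \<in> carrier G" using S by auto
  have "inv h \<otimes> y = inv h \<otimes> (y \<otimes> h) \<otimes> inv h" using h y by (simp add: m_assoc)
  also have "y \<otimes> h = h \<otimes> y" using c inv by simp
  also have "inv h \<otimes> (h \<otimes> y) \<otimes> inv h = y \<otimes> inv h" using h y by (simp add: m_assoc[symmetric])
  finally show ?case .
next
  case (eng h1 h2)
  then have h: "h1 \<in> carrier G" "h2 \<in> carrier G" using generate_in_carrier[OF S] by auto
  have "h1 \<otimes> h2 \<otimes> y = h1 \<otimes> (h2 \<otimes> y)" using h y by (simp add: m_assoc)
  also have "h2 \<otimes> y = y \<otimes> h2" by (rule eng.IH)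
  also have "h1 \<otimes> (y \<otimes> h2) = h1 \<otimes> y \<otimes> h2" using h y by (simp add: m_assoc)
  also have "h1 \<otimes> y = y \<otimes> h1" by (rule eng.IH)
  also have "y \<otimes> h1 \<otimes> h2 = y \<otimes> (h1 \<otimes> h2)" using h y by (simp add: m_assoc)
  finally show ?case .
qed (use c y in auto)

lemma (in group) generate_commute:
  assumes S: "S \<subseteq> carrier G" and c: "\<And>s t. s \<in> S \<Longrightarrow> t \<in> S \<Longrightarrow> s \<otimes> t = t \<otimes> s"
    and x: "x \<in> generate G S" "y \<in> generate G S"
  shows "x \<otimes> y = y \<otimes> x"
proof (rule commute_with_generate[OF S _ _ x(1)])
  show "y \<in> carrier G" using generate_in_carrier[OF S x(2)] .
  show "s \<otimes> y = y \<otimes> s" if "s \<in> S" for s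
    using commute_with_generate[OF S _ _ x(2), of s] c that S by (metis subsetD)
qed

lemma psl_not_abelian: "pr (upp 1) \<otimes>\<^bsub>psl\<^esub> pr (low 1) \<noteq> pr (low 1) \<otimes>\<^bsub>psl\<^esub> pr (upp (1::'a::field))"
proof -
  have "(1::'a) \<noteq> 2"
    by (metis add_cancel_right_right one_add_one zero_neq_one)
  moreover have "(2::'a) \<noteq> 0 \<or> (3::'a) \<noteq> 0"
    by (metis (no_types) add_0 numeral_plus_one one_add_one zero_neq_one semiring_norm(5))
  ultimately show ?thesis
    unfolding mult_PSL2 pr_eq_iff low_def upp_def mk_mult mk_uminus mk_eq_iff by auto
qed

lemma absolute_geometry_PSL2:
  fixes f :: "('a::{field,finite}^2^2) set \<Rightarrow> ('a^2^2) set"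
  assumes q: "primepow q" "CARD('a) = q ^ 3" "CARD('b::{field,finite}) = q"
    and f: "f \<in> iso psl psl" and f3: "\<And>x. x \<in> carrier psl \<Longrightarrow> f (f (f x)) = x"
    and outer: "\<And>A. det A = 1 \<Longrightarrow> \<exists>x\<in>carrier psl. f x \<noteq> cj A x"
    and r: "r0 \<in> carrier psl" "r1 \<in> carrier psl" "r2 \<in> carrier psl"
    and ne1: "r0 \<noteq> \<one>\<^bsub>psl\<^esub>" "r1 \<noteq> \<one>\<^bsub>psl\<^esub>" "r2 \<noteq> \<one>\<^bsub>psl\<^esub>"
    and sq: "r0 \<otimes>\<^bsub>psl\<^esub> r0 = \<one>\<^bsub>psl\<^esub>" "r1 \<otimes>\<^bsub>psl\<^esub> r1 = \<one>\<^bsub>psl\<^esub>" "r2 \<otimes>\<^bsub>psl\<^esub> r2 = \<one>\<^bsub>psl\<^esub>"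
    and fr: "f r0 = r2" "f r2 = r0 \<otimes>\<^bsub>psl\<^esub> r2" "f r1 = r1"
    and r02: "r0 \<otimes>\<^bsub>psl\<^esub> r2 = r2 \<otimes>\<^bsub>psl\<^esub> r0"
    and gen: "generate psl {r0, r1, r2} = carrier psl"
    and jk: "{j, k} = {2, 3}" and len: "length Hs = 4"
    and Hs: "Hs ! 0 = generate psl {r0, r1}" "Hs ! 1 = generate psl {r0, r2}"
      "Hs ! j = generate psl {r1, r2}" "Hs ! k = generate psl {r1, r0 \<otimes>\<^bsub>psl\<^esub> r2}"
    and V: "V = absolute_elements_of_type psl Hs f {0, 2, 3}"
    and E: "E = absolute_elements_of_type psl Hs f {1}"
  shows "absolute_elements psl Hs f = V \<union> E \<and>
    incidence_graph V E (absolute_incident psl Hs) \<and>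
    (\<exists>N. 2 * N = order (PSL2 TYPE('b)) \<and>
      disjoint_union_of_paths N 2 V E (absolute_incident psl Hs))"
proof -
  interpret group "psl :: ('a^2^2) set monoid" by (rule group_PSL2)
  obtain A s c where A: "det A \<noteq> 0" and s: "cubic_hom s"
    and A3: "A ** mmap s A ** mmap s (mmap s A) = mat c"
    and fA: "\<And>M. det M = 1 \<Longrightarrow> f (pr M) = pr (A ** mmap s M ** minv A)"
    using order3_automorphism[OF f f3 outer] by blast
  obtain B where B: "det B \<noteq> 0" and AB: "\<And>M. A ** mmap s M ** minv A = twist B s M"
    using hilbert90_twist[OF s A A3] by blast
  have fB: "f (pr M) = pr (twist B s M)" if "det M = 1" for M using fA[OF that] by (simp add: AB)
  have fs: "fld_hom s" using s by (simp add: cubic_hom_def)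
  obtain P0 where P0: "det P0 = 1" "r0 = pr P0" using r(1) by (rule PSL2_cases)
  obtain P1 where P1: "det P1 = 1" "r1 = pr P1" using r(2) by (rule PSL2_cases)
  define P2 where "P2 = twist B s P0"
  define P3 where "P3 = twist B s P2"
  have d: "det (twist B s M) = 1" if "det M = 1" for M
    using that by (simp add: det_twist[OF B fs] fld_hom_simps[OF fs])
  have P2: "det P2 = 1" "r2 = pr P2" using fB[OF P0(1)] fr d[OF P0(1)] by (simp_all add: P0 P2_def)
  have P3: "det P3 = 1" "r0 \<otimes>\<^bsub>psl\<^esub> r2 = pr P3"
    using fB[OF P2(1)] fr d[OF P2(1)] by (simp_all add: P2(2) P3_def)
  have "P0 ** P2 = P3 \<or> P0 ** P2 = - P3" using P3(2) by (simp add: P0 P2 pr_eq_iff)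
  then obtain e where e: "P0 ** P2 = scal e P3" "e * e = 1"
    using scal_one scal_minus_one[of P3] by (metis mult_1 mult_minus1 minus_minus)
  have noncommuting: "r0 \<otimes>\<^bsub>psl\<^esub> r1 \<noteq> r1 \<otimes>\<^bsub>psl\<^esub> r0"
  proof
    assume 01: "r0 \<otimes>\<^bsub>psl\<^esub> r1 = r1 \<otimes>\<^bsub>psl\<^esub> r0"
    then have 21: "r2 \<otimes>\<^bsub>psl\<^esub> r1 = r1 \<otimes>\<^bsub>psl\<^esub> r2"
      using iso_mult[OF f r(1,2)] iso_mult[OF f r(2,1)] fr by simp
    \<comment> \<open>If \<open>r0\<close> and \<open>r1\<close> commuted, so would
      \<open>r2\<close> and \<open>r1\<close> by applying \<open>f\<close>; all generators would
      commute and the group would be abelian.\<close>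
    have "x \<otimes>\<^bsub>psl\<^esub> y = y \<otimes>\<^bsub>psl\<^esub> x" if "x \<in> carrier psl" "y \<in> carrier psl" for x y :: "('a^2^2) set"
      by (rule generate_commute[of "{r0, r1, r2}"]) (use that gen r 01 21 r02 in auto)
    then show False using psl_not_abelian[where 'a = 'a] pr_in[OF det_upp] pr_in[OF det_low] by blast
  qed
  have ne02: "r0 \<noteq> r2"
  proof
    assume "r0 = r2"
    then have "f r2 = \<one>\<^bsub>psl\<^esub>" using fr sq by simp
    then have "f r2 = f \<one>\<^bsub>psl\<^esub>" using iso_one[OF f] by simp
    then show False using iso_inj[OF f] r ne1 by simp
  qed
  interpret t: triality_frame B s P0 P1 P2 P3 e
  proof
    show "tr P0 = 0" using involution_traceless[OF P0(1)] ne1 sq by (simp add: P0 one_PSL2)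
    show "tr P1 = 0" using involution_traceless[OF P1(1)] ne1 sq by (simp add: P1 one_PSL2)
    show "twist B s P1 = P1" using twist_eq_sign[OF B s] fB[OF P1(1)] fr by (simp add: P1)
    show "pr (P0 ** P1) \<noteq> pr (P1 ** P0)" using noncommuting by (simp add: P0 P1)
    show "pr P0 \<noteq> pr P2" using ne02 by (simp add: P0 P2)
  qed (use B s P0 P1 e P2_def P3_def in auto)
  interpret g: triality_geometry psl f r0 r1 r2 "r0 \<otimes>\<^bsub>psl\<^esub> r2" Hs j k
  proof
    show "finite (carrier (psl :: ('a^2^2) set monoid))" by simp
    fix g assume g: "g \<in> generate psl {r0, r1}"
    show "g = \<one>\<^bsub>psl\<^esub> \<or> g = r1" if "g \<in> generate psl {r2, r1}"
      using t.dihedral_intersection g that by (simp add: P0 P1 P2 one_PSL2)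
    assume norm: "g \<otimes>\<^bsub>psl\<^esub> f g \<otimes>\<^bsub>psl\<^esub> f (f g) = \<one>\<^bsub>psl\<^esub>"
    obtain M where M: "det M = 1" "g = pr M"
      "(\<exists>a b. M = scal a (mat 1) + scal b (P0 ** P1)) \<or> (\<exists>x y. M = scal x P0 + scal y P1)"
      using dihedral_elements[OF t.P0 t.P1, of g] g by (auto simp: P0 P1)
    have "pr (M ** twist B s M ** twist B s (twist B s M)) = pr (mat 1)"
      using norm by (simp add: M fB d one_PSL2)
    then have "M ** twist B s M ** twist B s (twist B s M) = scal 1 (mat 1) \<or>
      M ** twist B s M ** twist B s (twist B s M) = scal (- 1) (mat 1)"
      by (simp add: pr_eq_iff scal_minus_one)
    \<comment> \<open>The norm condition in \<open>PSL2\<close> lifts to matrices with an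
      undetermined sign \<open>c\<close>.\<close>
    then obtain c where c: "M ** twist B s M ** twist B s (twist B s M) = scal c (mat 1)" "c * c = 1"
      by (metis mult_1 mult_minus1 minus_minus)
    show "g = \<one>\<^bsub>psl\<^esub> \<or> g = r0 \<or> g = r1 \<otimes>\<^bsub>psl\<^esub> r0 \<otimes>\<^bsub>psl\<^esub> r1"
    proof -
      have "pr M = pr (mat 1) \<or> pr M = pr P0 \<or> pr M = pr (P1 ** P0 ** P1)"
        using M(3) t.norm_one_rotation[OF M(1) _ c(1)] t.norm_one_reflection[OF M(1) _ c] by blast
      then show ?thesis by (simp add: M(2) P0 P1 one_PSL2)
    qed
  qed (use f f3 r sq r02 fr noncommuting len jk Hs in auto)
  have "card g.fixed = order (PSL2 TYPE('b))"
    unfolding g.fixed_def by (rule card_fixed_points_PSL2[OF q B s fB])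
  then show ?thesis using g.absolute_geometry[OF V E] by simp
qed

theorem theorem3p13:
  fixes q :: nat
    and G :: "('a::{field,finite}^2^2) set monoid"
    and \<rho>\<^sub>0 \<rho>\<^sub>1 \<rho>\<^sub>2 :: "('a^2^2) set"
    and \<alpha> :: "('a^2^2) set \<Rightarrow> ('a^2^2) set"
    and Hs :: "('a^2^2) set set list"
    and V E :: "(nat \<times> ('a^2^2) set set) set set"
  assumes "primepow q"
    and "CARD('a) = q ^ 3"
    and "CARD('b::{field,finite}) = q"
    and "G = PSL2 TYPE('a)"
    and "involution G \<rho>\<^sub>0" "involution G \<rho>\<^sub>1" "involution G \<rho>\<^sub>2"
    and "outer_auto G \<alpha>"
    and "group.ord (AutoGroup G) \<alpha> = 3"
    and "cyclically_permutes \<alpha> \<rho>\<^sub>0 \<rho>\<^sub>2 (\<rho>\<^sub>0 \<otimes>\<^bsub>G\<^esub> \<rho>\<^sub>2)"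
    and "\<alpha> \<rho>\<^sub>1 = \<rho>\<^sub>1"
    and "\<rho>\<^sub>0 \<otimes>\<^bsub>G\<^esub> \<rho>\<^sub>2 = \<rho>\<^sub>2 \<otimes>\<^bsub>G\<^esub> \<rho>\<^sub>0"
    and "generate G {\<rho>\<^sub>0, \<rho>\<^sub>1, \<rho>\<^sub>2} = carrier G"
    and "\<not> (\<exists>\<phi>\<in>auto G. \<phi> \<rho>\<^sub>0 = \<rho>\<^sub>2 \<and> \<phi> \<rho>\<^sub>2 = \<rho>\<^sub>0 \<and> \<phi> \<rho>\<^sub>1 = \<rho>\<^sub>1)"
    and "Hs = [generate G {\<rho>\<^sub>0, \<rho>\<^sub>1}, generate G {\<rho>\<^sub>0, \<rho>\<^sub>2},
               generate G {\<rho>\<^sub>1, \<rho>\<^sub>2}, generate G {\<rho>\<^sub>1, \<rho>\<^sub>0 \<otimes>\<^bsub>G\<^esub> \<rho>\<^sub>2}]"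
    and "V = absolute_elements_of_type G Hs \<alpha> {0, 2, 3}"
    and "E = absolute_elements_of_type G Hs \<alpha> {1}"
  shows "absolute_elements G Hs \<alpha> = V \<union> E \<and>
         incidence_graph V E (absolute_incident G Hs) \<and>
         (\<exists>N. 2 * N = order (PSL2 TYPE('b)) \<and>
              disjoint_union_of_paths N 2 V E (absolute_incident G Hs))"
proof -
  note G = assms(4)
  interpret group G unfolding G by (rule group_PSL2)
  interpret AG: group "AutoGroup G" by (rule AutoGroup)
  have \<alpha>: "\<alpha> \<in> auto G" "\<alpha> \<notin> inner_auto G ` carrier G"
    using assms(8) by (auto simp: outer_auto_def)
  then have bij: "\<alpha> \<in> Bij (carrier G)" and "\<alpha> \<in> hom G G" by (auto simp: auto_def)
  then have iso: "\<alpha> \<in> iso G G" and extn: "\<alpha> \<in> extensional (carrier G)"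
    by (auto simp: iso_def Bij_def)
  have carA: "carrier (AutoGroup G) = auto G" by (simp add: AutoGroup_def)
  have mulA: "\<beta> \<otimes>\<^bsub>AutoGroup G\<^esub> \<gamma> = compose (carrier G) \<beta> \<gamma>" if "\<beta> \<in> auto G" "\<gamma> \<in> auto G" for \<beta> \<gamma>
    using that by (simp add: AutoGroup_def BijGroup_def auto_def)
  have "\<alpha> [^]\<^bsub>AutoGroup G\<^esub> (3::nat) = \<one>\<^bsub>AutoGroup G\<^esub>"
    using AG.pow_ord_eq_1[of \<alpha>] \<alpha> assms(9) by (simp add: carA)
  moreover have "\<alpha> \<otimes>\<^bsub>AutoGroup G\<^esub> \<alpha> \<in> auto G" using AG.m_closed[of \<alpha> \<alpha>] \<alpha> by (simp add: carA)
  ultimately have comp: "compose (carrier G) (compose (carrier G) \<alpha> \<alpha>) \<alpha> = \<one>\<^bsub>AutoGroup G\<^esub>"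
    using \<alpha>(1) by (simp add: numeral_3_eq_3 mulA carA)
  then have \<alpha>3: "\<alpha> (\<alpha> (\<alpha> x)) = x" if "x \<in> carrier G" for x
  proof -
    have "\<alpha> x \<in> carrier G" using Bij_imp_funcset[OF bij] that by blast
    then have "compose (carrier G) (compose (carrier G) \<alpha> \<alpha>) \<alpha> x = \<alpha> (\<alpha> (\<alpha> x))"
      using that by (simp add: compose_eq)
    moreover have "\<one>\<^bsub>AutoGroup G\<^esub> x = x"
      using that by (simp add: AutoGroup_def BijGroup_def)
    ultimately show ?thesis by (simp only: comp)
  qed
  have outer: "\<exists>x\<in>carrier psl. \<alpha> x \<noteq> cj A x" if A: "det A = 1" for A
  proof (rule ccontr)
    assume "\<not> ?thesis"
    then have *: "\<alpha> x = cj A x" if "x \<in> carrier psl" for x using that by blast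
    \<comment> \<open>Outside the carrier both sides are \<open>undefined\<close>, so agreement on
      the carrier gives equality of functions.\<close>
    have "\<alpha> x = inner_auto G (pr A) x" for x
    proof (cases "x \<in> carrier G")
      case True
      then obtain M where "det M = 1" "x = pr M" unfolding G by (rule PSL2_cases)
      then show ?thesis using * A by (simp add: inner_auto_def G inv_PSL2 minv_SL)
    next
      case False
      then show ?thesis using extensional_arb[OF extn] by (simp add: inner_auto_def)
    qed
    then have "\<alpha> = inner_auto G (pr A)" by (rule ext)
    then show False using \<alpha>(2) A by (simp add: G)
  qed
  have inv: "x \<in> carrier G \<and> x \<noteq> \<one>\<^bsub>G\<^esub> \<and> x \<otimes>\<^bsub>G\<^esub> x = \<one>\<^bsub>G\<^esub>" if "involution G x" for x
  proof -
    have x: "x \<in> carrier G" "ord x = 2" using that by (auto simp: involution_def)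
    then have "x [^]\<^bsub>G\<^esub> (2::nat) = \<one>\<^bsub>G\<^esub>" using pow_ord_eq_1[of x] by simp
    then have "x \<otimes>\<^bsub>G\<^esub> x = \<one>\<^bsub>G\<^esub>" using x by (simp add: numeral_2_eq_2)
    moreover have "x \<noteq> \<one>\<^bsub>G\<^esub>" using x ord_eq_1[of x] by auto
    ultimately show ?thesis using x by simp
  qed
  note r0 = inv[OF assms(5)] and r1 = inv[OF assms(6)] and r2 = inv[OF assms(7)]
  let ?r3 = "\<rho>\<^sub>0 \<otimes>\<^bsub>G\<^esub> \<rho>\<^sub>2"
  from assms(10) consider
    "\<alpha> \<rho>\<^sub>0 = \<rho>\<^sub>2" "\<alpha> \<rho>\<^sub>2 = ?r3" | "\<alpha> \<rho>\<^sub>0 = ?r3" "\<alpha> ?r3 = \<rho>\<^sub>2"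
    by (auto simp: cyclically_permutes_def)
  then show ?thesis
  proof cases
    case 1
    show ?thesis
      unfolding G
      by (rule absolute_geometry_PSL2[OF assms(1-3), of \<alpha> \<rho>\<^sub>0 \<rho>\<^sub>1 \<rho>\<^sub>2 2 3])
        (use iso \<alpha>3 outer r0 r1 r2 1 assms in \<open>simp_all add: G\<close>)
  next
    case 2
    \<comment> \<open>the other direction of the 3-cycle: exchange \<open>\<rho>\<^sub>2\<close> and \<open>\<rho>\<^sub>0 \<rho>\<^sub>2\<close>, hence the types 2 and 3\<close>
    have r3c: "?r3 \<in> carrier G" using r0 r2 by simp
    have 02: "\<rho>\<^sub>0 \<otimes>\<^bsub>G\<^esub> ?r3 = \<rho>\<^sub>2" using r0 r2 by (simp add: m_assoc[symmetric])
    have 20: "?r3 \<otimes>\<^bsub>G\<^esub> \<rho>\<^sub>0 = \<rho>\<^sub>2" using r0 r2 assms(12) by (metis 02 m_assoc)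
    have r33: "?r3 \<otimes>\<^bsub>G\<^esub> ?r3 = \<one>\<^bsub>G\<^esub>"
    proof -
      have "?r3 \<otimes>\<^bsub>G\<^esub> ?r3 = ?r3 \<otimes>\<^bsub>G\<^esub> \<rho>\<^sub>0 \<otimes>\<^bsub>G\<^esub> \<rho>\<^sub>2" using r0 r2 by (simp add: m_assoc)
      also have "\<dots> = \<one>\<^bsub>G\<^esub>" unfolding 20 using r2 by blast
      finally show ?thesis .
    qed
    have r3n: "?r3 \<noteq> \<one>\<^bsub>G\<^esub>"
    proof
      assume "?r3 = \<one>\<^bsub>G\<^esub>"
      then have "\<rho>\<^sub>2 = \<rho>\<^sub>0" using 02 r0 by simp
      then have "\<alpha> ?r3 = \<rho>\<^sub>0" using 2 by simp
      moreover have "\<alpha> \<one>\<^bsub>G\<^esub> = \<one>\<^bsub>G\<^esub>" using iso_one iso unfolding G by blast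
      ultimately show False using \<open>?r3 = \<one>\<^bsub>G\<^esub>\<close> r0 by simp
    qed
    \<comment> \<open>Beside \<open>\<rho>\<^sub>0\<close>, the elements
      \<open>\<rho>\<^sub>2\<close> and \<open>?r3\<close> generate the same subgroup, whatever else
      is adjoined.\<close>
    have eq: "generate G (insert \<rho>\<^sub>0 (insert ?r3 K)) = generate G (insert \<rho>\<^sub>0 (insert \<rho>\<^sub>2 K))"
      if K: "K \<subseteq> carrier G" for K
    proof
      have "?r3 \<in> generate G (insert \<rho>\<^sub>0 (insert \<rho>\<^sub>2 K))" by (intro generate.eng generate.incl) auto
      then show "generate G (insert \<rho>\<^sub>0 (insert ?r3 K)) \<subseteq> generate G (insert \<rho>\<^sub>0 (insert \<rho>\<^sub>2 K))"
        using K r0 r2 by (intro generate_subgroup_incl generate_is_subgroup) (auto intro: generate.incl)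
      have "\<rho>\<^sub>0 \<otimes>\<^bsub>G\<^esub> ?r3 \<in> generate G (insert \<rho>\<^sub>0 (insert ?r3 K))" by (intro generate.eng generate.incl) auto
      then show "generate G (insert \<rho>\<^sub>0 (insert \<rho>\<^sub>2 K)) \<subseteq> generate G (insert \<rho>\<^sub>0 (insert ?r3 K))"
        using K r0 r2 by (intro generate_subgroup_incl generate_is_subgroup) (auto intro: generate.incl simp: 02)
    qed
    have gen: "generate G {\<rho>\<^sub>0, \<rho>\<^sub>1, ?r3} = carrier G"
      using eq[of "{\<rho>\<^sub>1}"] r1 assms(13) by (simp add: insert_commute)
    have gen1: "generate G {\<rho>\<^sub>0, ?r3} = generate G {\<rho>\<^sub>0, \<rho>\<^sub>2}" using eq[of "{}"] by simp
    show ?thesis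
      unfolding G
      by (rule absolute_geometry_PSL2[OF assms(1-3), of \<alpha> \<rho>\<^sub>0 \<rho>\<^sub>1 ?r3 3 2])
        (use iso \<alpha>3 outer r0 r1 r3c r3n r33 2 02 20 gen gen1 assms in \<open>auto simp: G\<close>)
  qed
qed

end
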